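(* Let $N\ge1$, $0<\lambda\le\Lambda$, assume $\beta=\frac{\Lambda}{\lambda}(N-1)+1>2$, and let $1\le q\le\frac{\beta}{\beta-2}$. Let $u,v\in C(\mathbb{R}^N)$ be, respectively, a viscosity subsolution and a viscosity supersolution of $$\mathcal{M}^+_{\lambda,\Lambda}(D^2z)-|z|^{q-1}z=0\quad\text{in }\mathbb{R}^N,$$ with $u\le v$ in $\mathbb{R}^N$. Then $u\equiv v$ in $\mathbb{R}^N$.
   Context: For $M\in\mathrm{Sym}_N$ with eigenvalues $e_1,\dots,e_N$, $\mathcal{M}^+_{\lambda,\Lambda}(M)=\sup_{\lambda I_N\le A\le\Lambda I_N}(-\mathrm{Tr}(AM))=-\lambda\sum_{e_k>0}e_k-\Lambda\sum_{e_k<0}e_k$. A continuous $v$ is a viscosity supersolution of $G(x,z,Dz,D^2z)=0$ if whenever $\varphi\in C^2$ and $v-\varphi$ has a local minimum at $x_0$, $G(x_0,v(x_0),D\varphi(x_0),D^2\varphi(x_0))\ge0$; a continuous $u$ is a viscosity subsolution if whenever $u-\varphi$ has a local maximum at $x_0$, $G(x_0,u(x_0),D\varphi(x_0),D^2\varphi(x_0))\le0$. *)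

theory Defs
  imports "HOL-Analysis.Analysis"
begin

definition pucci_max :: "real \<Rightarrow> real \<Rightarrow> real^'n^'n \<Rightarrow> real" where
  "pucci_max lam Lam M =
     Sup {- trace (A ** M) | A :: real^'n^'n.
            transpose A = A \<and>
            (\<forall>\<xi>. lam * (\<xi> \<bullet> \<xi>) \<le> \<xi> \<bullet> (A *v \<xi>) \<and> \<xi> \<bullet> (A *v \<xi>) \<le> Lam * (\<xi> \<bullet> \<xi>))}"

definition C2_with :: "(real^'n \<Rightarrow> real) \<Rightarrow> (real^'n \<Rightarrow> real^'n) \<Rightarrow> (real^'n \<Rightarrow> real^'n^'n) \<Rightarrow> bool" where
  "C2_with phi Dphi D2phi \<longleftrightarrow>
     (\<forall>x. (phi has_derivative (\<lambda>h. Dphi x \<bullet> h)) (at x)) \<and>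
     (\<forall>x. (Dphi has_derivative (\<lambda>h. D2phi x *v h)) (at x)) \<and>
     continuous_on UNIV D2phi"

definition viscosity_supersol ::
  "(real^'n \<Rightarrow> real \<Rightarrow> real^'n \<Rightarrow> real^'n^'n \<Rightarrow> real) \<Rightarrow> (real^'n \<Rightarrow> real) \<Rightarrow> bool" where
  "viscosity_supersol G v \<longleftrightarrow> continuous_on UNIV v \<and>
     (\<forall>phi Dphi D2phi x0. C2_with phi Dphi D2phi \<longrightarrow>
        (\<exists>e>0. \<forall>y\<in>ball x0 e. v y - phi y \<ge> v x0 - phi x0) \<longrightarrow>
        G x0 (v x0) (Dphi x0) (D2phi x0) \<ge> 0)"

definition viscosity_subsol ::
  "(real^'n \<Rightarrow> real \<Rightarrow> real^'n \<Rightarrow> real^'n^'n \<Rightarrow> real) \<Rightarrow> (real^'n \<Rightarrow> real) \<Rightarrow> bool" where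
  "viscosity_subsol G u \<longleftrightarrow> continuous_on UNIV u \<and>
     (\<forall>phi Dphi D2phi x0. C2_with phi Dphi D2phi \<longrightarrow>
        (\<exists>e>0. \<forall>y\<in>ball x0 e. u y - phi y \<le> u x0 - phi x0) \<longrightarrow>
        G x0 (u x0) (Dphi x0) (D2phi x0) \<le> 0)"

definition pucci_eq :: "real \<Rightarrow> real \<Rightarrow> real \<Rightarrow> real^'n \<Rightarrow> real \<Rightarrow> real^'n \<Rightarrow> real^'n^'n \<Rightarrow> real" where
  "pucci_eq lam Lam q x z p X = pucci_max lam Lam X - \<bar>z\<bar> powr (q - 1) * z"

end

theory Submission
  imports Defs
begin

text \<open>
  The Pucci operator is a supremum of linear operators with constant coefficients, so \<open>u\<close> is a viscosity
  subsolution of \<open>- tr (A D\<^sup>2u) = |u|\<^bsup>q-1\<^esup>u\<close> for every admissible \<open>A\<close>. Comparing \<open>u\<close> with solutions of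
  \<open>h - \<delta> tr (A D\<^sup>2h) = f\<close> for trigonometric polynomials \<open>f \<approx> u + \<delta>|u|\<^bsup>q-1\<^esup>u\<close> and letting \<open>\<delta> \<rightarrow> 0\<close> shows that
  mollifications of \<open>u\<close> are classical approximate subsolutions. Used as test functions for \<open>v\<close>, they show
  that \<open>w = v - u \<ge> 0\<close> is a viscosity supersolution of \<open>M\<^sup>+(D\<^sup>2w) \<ge> c w\<^sup>q\<close>, without the theorem on sums.

  If \<open>w\<close> were positive at a point, the barrier \<open>|x|\<^bsup>-\<alpha>\<^esup>\<close> with \<open>\<alpha> = \<beta> - 2\<close> would give \<open>w \<ge> C|x|\<^bsup>-\<alpha>\<^esup>\<close>, and since
  \<open>\<alpha>q \<le> \<alpha> + 2\<close> this improves to \<open>w \<ge> C|x|\<^bsup>-\<alpha>\<^esup> log |x|\<close>. A concave paraboloid touching \<open>w\<close> from below gives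
  \<open>m(R)\<^bsup>q-1\<^esup> \<le> C R\<^bsup>-2\<^esup>\<close> for the minimum \<open>m(R)\<close> over the ball of radius \<open>R\<close>, a contradiction for large \<open>R\<close>.
\<close>

section \<open>Positive semidefinite matrices and the Pucci operator\<close>

text \<open>The zeroth order term has the wrong monotonicity for a comparison principle, so equality
  can only come from the behaviour of w on the whole space.

  A test function for w tests neither u nor v. Mollification commutes with constant coefficient
  operators, but a viscosity inequality cannot be integrated against a kernel. Cosines close this
  gap: they are eigenfunctions of all these operators, so the resolvent equation has explicit
  solutions, and its mollified form holds exactly.

  The Hessian of |x|^(-a) has one radial eigenvalue a(a+1)|x|^(-a-2) and N-1 tangential ones
  -a|x|^(-a-2). Hence M^+ vanishes on it exactly when \<lambda>(a+1) = \<Lambda>(N-1), that is a =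
  \<beta>-2. With this decay alone, R^2 m(R)^(q-1) is bounded below by a multiple of
  R^(2-\<alpha>(q-1)), a mere constant at the critical q, so there is no contradiction yet. The
  logarithm is available because M^+ of |x|^(-\<alpha>) log |x| is, for large |x|, a positive
  multiple of |x|^(-\<alpha>-2), an order that w^q supplies.\<close>

definition outer :: "real^'n \<Rightarrow> real^'n^'n" where
  "outer a = (\<chi> i j. a $ i * a $ j)"

lemma inner_matrix: "A \<bullet> X = (\<Sum>i\<in>UNIV. \<Sum>j\<in>UNIV. A $ i $ j * X $ i $ j)" for A X :: "real^'n^'m"
  by (simp add: inner_vec_def)

text \<open>Quadratic forms, traces and rank-one matrices all become values of one bilinear pairing,
  the Frobenius product, so matrix inequalities reduce to linear manipulations.\<close>

lemma outer_inner: "outer a \<bullet> X = a \<bullet> (X *v a)"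
  by (simp add: inner_matrix outer_def inner_vec_def matrix_vector_mult_def sum_distrib_left mult_ac)

lemma outer_inner_outer: "outer a \<bullet> outer b = (a \<bullet> b)\<^sup>2"
proof -
  have "outer b *v a = (b \<bullet> a) *\<^sub>R b"
    by (simp add: vec_eq_iff outer_def matrix_vector_mult_def inner_vec_def sum_distrib_left mult_ac)
  then show ?thesis by (simp add: outer_inner power2_eq_square inner_commute)
qed

lemma norm_outer: "norm (outer a) = (norm a)\<^sup>2"
  by (simp add: norm_eq_sqrt_inner outer_inner_outer)

lemma outer_inner_mat: "outer a \<bullet> mat c = c * (a \<bullet> a)"
proof -
  have "mat c *v a = c *\<^sub>R a"
    by (simp add: vec_eq_iff mat_def matrix_vector_mult_def if_distrib [of "\<lambda>x. x * _"] cong: if_cong)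
  then show ?thesis by (simp add: outer_inner)
qed

lemma mat1_inner_mat1: "mat 1 \<bullet> (mat 1 :: real^'n^'n) = real CARD('n)"
  by (simp add: inner_matrix mat_def if_distrib cong: if_cong)

lemma outer_scaleR: "outer (c *\<^sub>R a) = c\<^sup>2 *\<^sub>R outer a"
  by (simp add: vec_eq_iff outer_def power2_eq_square mult_ac)

lemma outer_zero [simp]: "outer 0 = 0"
  by (simp add: vec_eq_iff outer_def)

lemma transpose_outer [simp]: "transpose (outer a) = outer a"
  by (simp add: vec_eq_iff outer_def transpose_def mult.commute)

lemma transpose_plus: "transpose (X + Y) = transpose X + transpose (Y :: real^'n^'m)"
  by (simp add: vec_eq_iff transpose_def)

lemma transpose_diff: "transpose (X - Y) = transpose X - transpose (Y :: real^'n^'m)"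
  by (simp add: vec_eq_iff transpose_def)

lemma transpose_scaleR: "transpose (c *\<^sub>R X) = c *\<^sub>R transpose (X :: real^'n^'m)"
  by (simp add: vec_eq_iff transpose_def)

lemma transpose_zero [simp]: "transpose (0 :: real^'n^'m) = 0"
  by (simp add: vec_eq_iff transpose_def)

lemma transpose_mat1 [simp]: "transpose (mat 1 :: real^'n^'n) = mat 1"
  by (rule transpose_mat)

lemmas transpose_linear = transpose_plus transpose_diff transpose_scaleR

lemma symmetricD: "transpose X = X \<Longrightarrow> X $ i $ j = X $ j $ i"
  by (metis transpose_def vec_lambda_beta)

lemma trace_mult_symmetric: "transpose A = A \<Longrightarrow> trace (A ** X) = A \<bullet> X" for A X :: "real^'n^'n"
  unfolding trace_def matrix_matrix_mult_def inner_matrix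
  by (subst sum.swap) (simp add: symmetricD)

lemma symmetric_dot: "transpose X = X \<Longrightarrow> a \<bullet> (X *v b) = b \<bullet> (X *v a)" for X :: "real^'n^'n"
  by (metis dot_lmul_matrix inner_commute transpose_matrix_vector)

lemma outer_add_inner:
  "transpose X = X \<Longrightarrow> outer (a + b) \<bullet> X = outer a \<bullet> X + 2 * (b \<bullet> (X *v a)) + outer b \<bullet> X"
  using symmetric_dot [of X a b]
  by (simp add: outer_inner matrix_vector_right_distrib inner_add_left inner_add_right)

lemma axis_dot_mult: "axis i 1 \<bullet> (X *v axis j 1) = X $ i $ j" for X :: "real^'n^'m"
  by (simp add: inner_axis' matrix_vector_mult_basis column_def)

text \<open>Polarisation on pairs of basis vectors recovers every entry from the quadratic
  form.\<close>

lemma symmetric_eqI: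
  assumes "transpose X = X" "transpose Y = Y" "\<And>a. outer a \<bullet> X = outer a \<bullet> Y"
  shows "X = (Y :: real^'n^'n)"
proof -
  have "axis i 1 \<bullet> (X *v axis j 1) = axis i 1 \<bullet> (Y *v axis j 1)" for i j
    using outer_add_inner [OF assms(1), of "axis j 1" "axis i 1"]
      outer_add_inner [OF assms(2), of "axis j 1" "axis i 1"] assms(3) by simp
  then show ?thesis by (simp add: axis_dot_mult vec_eq_iff)
qed

text \<open>If the diagonal entry vanishes, the form is affine along the i-th axis, and an affine
  function bounded below is constant.\<close>

lemma psd_zero_diag:
  assumes "transpose A = A" "\<And>\<xi>. 0 \<le> outer \<xi> \<bullet> A" "A $ i $ i = 0"
  shows "A $ i = (0 :: real^'n)"
proof -
  have "A $ j $ i = 0" for j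
  proof (rule ccontr)
    assume nz: "A $ j $ i \<noteq> 0"
    \<comment> \<open>This choice makes the quadratic form equal to -1.\<close>
    define t where "t = - (A $ j $ j + 1) / (2 * A $ j $ i)"
    have "outer (t *\<^sub>R axis i 1 + axis j 1) \<bullet> A = t\<^sup>2 * A $ i $ i + 2 * (t * A $ j $ i) + A $ j $ j"
      using outer_add_inner [OF assms(1), of "t *\<^sub>R axis i 1" "axis j 1"]
      by (simp add: outer_scaleR outer_inner axis_dot_mult matrix_vector_mult_scaleR power2_eq_square)
    also have "\<dots> < 0" using nz assms(3) by (simp add: t_def field_simps)
    finally show False using assms(2) by (simp add: not_le [symmetric])
  qed
  then show ?thesis using symmetricD [OF assms(1)] by (simp add: vec_eq_iff)
qed

text \<open>Symmetric Gaussian elimination writes \<open>A\<close> as a sum of matrices \<open>outer a\<close>,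
  which avoids the spectral theorem.\<close>
lemma psd_inner_nonneg:
  assumes "transpose A = A" "\<And>\<xi>. 0 \<le> outer \<xi> \<bullet> A" "\<And>\<xi>. 0 \<le> outer \<xi> \<bullet> X"
  shows "0 \<le> A \<bullet> (X :: real^'n^'n)"
  using assms(1,2)
proof (induction "card {i. A $ i \<noteq> 0}" arbitrary: A rule: less_induct)
  case less
  show ?case
  proof (cases "\<exists>i. A $ i \<noteq> 0")
    case False
    then have "A = 0" by (simp add: vec_eq_iff)
    then show ?thesis by simp
  next
    case True
    then obtain i where i: "A $ i \<noteq> 0" by blast
    define D where "D = A $ i $ i"
    have "D = outer (axis i 1) \<bullet> A" by (simp add: D_def outer_inner axis_dot_mult)
    then have D: "D > 0" using psd_zero_diag [OF less.prems, of i] less.prems(2) [of "axis i 1"] i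
      by (fastforce simp: D_def)
    define a where "a = A $ i"
    define B where "B = A - (1 / D) *\<^sub>R outer a"
    have AB: "A = B + (1 / D) *\<^sub>R outer a" by (simp add: B_def)
    have Bsym: "transpose B = B" using less.prems(1) by (simp add: B_def transpose_linear)
    have Bpsd: "0 \<le> outer \<xi> \<bullet> B" for \<xi>
    proof -
      \<comment> \<open>The minimiser of the form of \<open>A\<close> along the i-th axis; the
        minimum is the form of the Schur complement \<open>B\<close>.\<close>
      define t where "t = - (a \<bullet> \<xi>) / D"
      have 1: "\<xi> \<bullet> (A *v axis i 1) = a \<bullet> \<xi>"
        by (subst symmetric_dot [OF less.prems(1)]) (simp add: inner_axis' matrix_vector_mul_component a_def)
      have "0 \<le> outer (t *\<^sub>R axis i 1 + \<xi>) \<bullet> A" by (rule less.prems(2))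
      also have "\<dots> = t\<^sup>2 * D + 2 * (t * (a \<bullet> \<xi>)) + outer \<xi> \<bullet> A"
        using outer_add_inner [OF less.prems(1), of "t *\<^sub>R axis i 1" \<xi>] 1
        by (simp add: outer_scaleR outer_inner axis_dot_mult matrix_vector_mult_scaleR D_def)
      also have "\<dots> = outer \<xi> \<bullet> B"
        using D by (simp add: t_def B_def inner_diff_right outer_inner_outer inner_commute power2_eq_square field_simps)
      finally show ?thesis .
    qed
    \<comment> \<open>Elimination clears row \<open>i\<close> and, by symmetry of \<open>A\<close>,
      keeps zero rows zero, so the number of nonzero rows drops.\<close>
    have "{j. B $ j \<noteq> 0} \<subset> {j. A $ j \<noteq> 0}"
    proof
      have "a $ j = 0" if "A $ j = 0" for j
        using that symmetricD [OF less.prems(1), of i j] by (simp add: a_def)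
      then have *: "B $ j = 0" if "A $ j = 0" for j using that by (simp add: B_def vec_eq_iff outer_def)
      then show "{j. B $ j \<noteq> 0} \<subseteq> {j. A $ j \<noteq> 0}" by blast
      have "B $ i = 0" using D by (simp add: B_def vec_eq_iff outer_def a_def D_def)
      then show "{j. B $ j \<noteq> 0} \<noteq> {j. A $ j \<noteq> 0}" using i by blast
    qed
    then have "card {j. B $ j \<noteq> 0} < card {j. A $ j \<noteq> 0}" by (intro psubset_card_mono) auto
    then have "0 \<le> B \<bullet> X" using less.hyps Bsym Bpsd by blast
    moreover have "0 \<le> outer a \<bullet> X" by (rule assms(3))
    ultimately show ?thesis using D by (simp add: AB inner_add_left)
  qed
qed

section \<open>Admissible matrices and bounds for the Pucci operator\<close>

definition adm :: "real \<Rightarrow> real \<Rightarrow> real^'n^'n \<Rightarrow> bool" where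
  "adm lam Lam A \<longleftrightarrow> transpose A = A \<and>
     (\<forall>\<xi>. lam * (\<xi> \<bullet> \<xi>) \<le> outer \<xi> \<bullet> A \<and> outer \<xi> \<bullet> A \<le> Lam * (\<xi> \<bullet> \<xi>))"

lemma pucci_max_eq: "pucci_max lam Lam M = Sup {- (A \<bullet> M) | A. adm lam Lam A}"
proof -
  have "{- trace (A ** M) | A. transpose A = A \<and>
            (\<forall>\<xi>. lam * (\<xi> \<bullet> \<xi>) \<le> \<xi> \<bullet> (A *v \<xi>) \<and> \<xi> \<bullet> (A *v \<xi>) \<le> Lam * (\<xi> \<bullet> \<xi>))}
      = {- (A \<bullet> M) | A. adm lam Lam A}"
    using trace_mult_symmetric unfolding adm_def outer_inner by (metis (no_types, lifting))
  then show ?thesis by (simp add: pucci_max_def)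
qed

lemma adm_symmetric: "adm lam Lam A \<Longrightarrow> transpose A = A"
  and adm_lower: "adm lam Lam A \<Longrightarrow> lam * (\<xi> \<bullet> \<xi>) \<le> A \<bullet> outer \<xi>"
  and adm_upper: "adm lam Lam A \<Longrightarrow> A \<bullet> outer \<xi> \<le> Lam * (\<xi> \<bullet> \<xi>)"
  by (simp_all add: adm_def inner_commute)

lemma adm_scalar: "lam \<le> c \<Longrightarrow> c \<le> Lam \<Longrightarrow> adm lam Lam (c *\<^sub>R mat 1)"
  by (simp add: adm_def transpose_linear outer_inner_mat mult_right_mono)

context
  fixes lam Lam :: real
  assumes lam: "0 < lam"
begin

text \<open>Degenerate ellipticity: since \<open>lam\<close> is positive, \<open>A\<close> is
  positive semidefinite, and its pairing with the positive semidefinite \<open>Y - X\<close> is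
  nonnegative.\<close>

lemma adm_inner_mono:
  fixes A :: "real^'n^'n"
  assumes "adm lam Lam A" "\<And>\<xi>. outer \<xi> \<bullet> X \<le> outer \<xi> \<bullet> Y"
  shows "A \<bullet> X \<le> A \<bullet> Y"
proof -
  have "0 \<le> A \<bullet> (Y - X)"
  proof (rule psd_inner_nonneg)
    show "0 \<le> outer \<xi> \<bullet> A" for \<xi>
      using adm_lower [OF assms(1), of \<xi>] lam
      by (metis inner_commute inner_ge_zero mult_nonneg_nonneg less_imp_le order_trans)
  qed (use assms adm_symmetric in \<open>auto simp: inner_diff_right\<close>)
  then show ?thesis by (simp add: inner_diff_right)
qed

text \<open>The trace of \<open>A\<close> on the hyperplane orthogonal to \<open>x\<close> is at
  most \<open>Lam\<close> times its dimension. Pairing \<open>Lam I - A\<close> with |x|^2 times the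
  projection onto that hyperplane gives this without eigenvectors; the bound fixes the exponent of
  the barrier.\<close>

lemma adm_trace_minus_outer:
  fixes A :: "real^'n^'n"
  assumes "adm lam Lam A"
  shows "(x \<bullet> x) * (A \<bullet> mat 1) - A \<bullet> outer x \<le> Lam * (real CARD('n) - 1) * (x \<bullet> x)"
proof -
  have "0 \<le> (Lam *\<^sub>R mat 1 - A) \<bullet> ((x \<bullet> x) *\<^sub>R mat 1 - outer x)"
  proof (rule psd_inner_nonneg)
    show "transpose (Lam *\<^sub>R mat 1 - A) = Lam *\<^sub>R mat 1 - A"
      using adm_symmetric [OF assms] by (simp add: transpose_linear)
    show "0 \<le> outer \<xi> \<bullet> (Lam *\<^sub>R mat 1 - A)" for \<xi>
      using adm_upper [OF assms, of \<xi>] by (simp add: inner_diff_right outer_inner_mat inner_commute [of A])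
    show "0 \<le> outer \<xi> \<bullet> ((x \<bullet> x) *\<^sub>R mat 1 - outer x)" for \<xi>
      using Cauchy_Schwarz_ineq [of \<xi> x]
      by (simp add: inner_diff_right outer_inner_mat outer_inner_outer mult_ac)
  qed
  then show ?thesis
    by (simp add: inner_diff_left inner_diff_right mat1_inner_mat1 outer_inner_mat
        inner_commute [of "mat 1" "outer x"] algebra_simps)
qed

lemma adm_inner_mat1:
  fixes A :: "real^'n^'n"
  assumes "adm lam Lam A"
  shows "0 \<le> A \<bullet> mat 1" "A \<bullet> mat 1 \<le> Lam * real CARD('n)"
proof -
  have "A \<bullet> 0 \<le> A \<bullet> mat 1" by (rule adm_inner_mono [OF assms]) (simp add: outer_inner_mat)
  then show "0 \<le> A \<bullet> mat 1" by simp
  let ?e = "axis undefined 1 :: real^'n"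
  have "?e \<bullet> ?e = 1" by (simp add: inner_axis_axis)
  then show "A \<bullet> mat 1 \<le> Lam * real CARD('n)"
    using adm_trace_minus_outer [OF assms, of ?e] adm_upper [OF assms, of ?e] by (simp add: algebra_simps)
qed

lemma pucci_upper:
  fixes A X :: "real^'n^'n"
  assumes "adm lam Lam A"
  shows "- (A \<bullet> X) \<le> pucci_max lam Lam X"
  unfolding pucci_max_eq
proof (rule cSup_upper)
  \<comment> \<open>\<open>Sup\<close> on the reals is only meaningful for bounded sets. The bound
    comes from -X \<le> |X| I with the Frobenius norm, paired with an arbitrary admissible
    matrix.\<close>
  define c where "c = norm X"
  have *: "- (B \<bullet> X) \<le> c * (Lam * real CARD('n))" if B: "adm lam Lam B" for B
  proof -
    have "B \<bullet> (- X) \<le> B \<bullet> (c *\<^sub>R mat 1)"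
    proof (rule adm_inner_mono [OF B])
      fix \<xi> :: "real^'n"
      have "outer \<xi> \<bullet> (- X) \<le> norm (outer \<xi>) * norm (- X)" by (rule norm_cauchy_schwarz)
      then show "outer \<xi> \<bullet> (- X) \<le> outer \<xi> \<bullet> (c *\<^sub>R mat 1)"
        by (simp add: norm_outer outer_inner_mat c_def power2_norm_eq_inner mult.commute)
    qed
    also have "\<dots> \<le> c * (Lam * real CARD('n))"
      using adm_inner_mat1(2) [OF B] by (simp add: c_def mult_left_mono)
    finally show ?thesis by simp
  qed
  then show "bdd_above {- (A \<bullet> X) | A. adm lam Lam A}" by (intro bdd_aboveI) blast
  show "- (A \<bullet> X) \<in> {- (A \<bullet> X) | A. adm lam Lam A}" using assms by blast
qed

lemma pucci_least:
  fixes X :: "real^'n^'n"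
  assumes "lam \<le> Lam" "\<And>A. adm lam Lam A \<Longrightarrow> - (A \<bullet> X) \<le> c"
  shows "pucci_max lam Lam X \<le> c"
  unfolding pucci_max_eq
proof (rule cSup_least)
  show "{- (A \<bullet> X) | A. adm lam Lam A} \<noteq> {}" using adm_scalar [of lam lam Lam] assms(1) by blast
qed (use assms in blast)

lemma pucci_add_le:
  fixes X Y :: "real^'n^'n"
  assumes "lam \<le> Lam"
  shows "pucci_max lam Lam (X + Y) \<le> pucci_max lam Lam X + pucci_max lam Lam Y"
  by (rule pucci_least [OF assms]) (use pucci_upper [of _ X] pucci_upper [of _ Y] in \<open>fastforce simp: inner_add_right\<close>)

lemma pucci_scalar_le:
  assumes "lam \<le> Lam" "0 \<le> c"
  shows "pucci_max lam Lam (- (c *\<^sub>R mat 1) :: real^'n^'n) \<le> c * (Lam * real CARD('n))"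
  by (rule pucci_least [OF assms(1)]) (use assms(2) in \<open>auto intro!: mult_left_mono adm_inner_mat1\<close>)

end

section \<open>Second order expansions\<close>

text \<open>Peano form of the remainder: the mean value inequality is applied to the remainder
  itself, whose derivative is the first order error of \<open>f'\<close> at
  \<open>s\<close>.\<close>

lemma taylor2_real:
  fixes f f' :: "real \<Rightarrow> real"
  assumes "\<forall>\<^sub>F t in nhds s. (f has_real_derivative f' t) (at t)"
    and "(f' has_real_derivative b) (at s)" and "e > 0"
  shows "\<forall>\<^sub>F \<tau> in nhds 0. \<bar>f (s + \<tau>) - f s - f' s * \<tau> - b * \<tau>\<^sup>2 / 2\<bar> \<le> e * \<tau>\<^sup>2"
proof -
  obtain d1 where d1: "d1 > 0" "\<And>t. dist t s < d1 \<Longrightarrow> (f has_real_derivative f' t) (at t)"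
    using assms(1) unfolding eventually_nhds_metric by blast
  obtain d2 where d2: "d2 > 0" "\<And>t. norm (t - s) < d2 \<Longrightarrow> norm (f' t - f' s - b * (t - s)) \<le> e * norm (t - s)"
    using assms(2,3) unfolding has_field_derivative_def has_derivative_at_alt by blast
  show ?thesis unfolding eventually_nhds_metric
  proof (intro exI [of _ "min d1 d2"] conjI allI impI)
    fix \<tau> :: real assume \<tau>: "dist \<tau> 0 < min d1 d2"
    define g where "g t = f (s + t) - f s - f' s * t - b * t\<^sup>2 / 2" for t
    have "norm (g \<tau> - g 0) \<le> (e * \<bar>\<tau>\<bar>) * norm (\<tau> - 0)"
    proof (rule field_differentiable_bound [of "cball 0 \<bar>\<tau>\<bar>"])
      fix z :: real assume "z \<in> cball 0 \<bar>\<tau>\<bar>"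
      then have z: "\<bar>z\<bar> \<le> \<bar>\<tau>\<bar>" by simp
      then have "dist (s + z) s < d1" using \<tau> by (simp add: dist_norm)
      then have "(f has_real_derivative f' (s + z)) (at (s + z))" by (rule d1)
      then have "((\<lambda>t. f (s + t)) has_real_derivative f' (s + z)) (at z)"
        using DERIV_shift [of f "f' (s + z)" z s] by (simp add: add.commute)
      then have "(g has_real_derivative (f' (s + z) - f' s - b * z)) (at z)"
        unfolding g_def by (auto intro!: derivative_eq_intros)
      then show "(g has_field_derivative (f' (s + z) - f' s - b * z)) (at z within cball 0 \<bar>\<tau>\<bar>)"
        by (rule has_field_derivative_at_within)
      have "norm (f' (s + z) - f' s - b * (s + z - s)) \<le> e * norm (s + z - s)"
        by (rule d2) (use z \<tau> in simp)
      also have "\<dots> \<le> e * \<bar>\<tau>\<bar>" using z assms(3) by simp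
      finally show "norm (f' (s + z) - f' s - b * z) \<le> e * \<bar>\<tau>\<bar>" by simp
    qed auto
    then show "\<bar>f (s + \<tau>) - f s - f' s * \<tau> - b * \<tau>\<^sup>2 / 2\<bar> \<le> e * \<tau>\<^sup>2"
      by (simp add: g_def power2_eq_square)
  qed (use d1 d2 in auto)
qed

lemma eventually_nhds_shift:
  fixes x :: "'a::real_normed_vector"
  shows "eventually P (nhds x) \<longleftrightarrow> (\<forall>\<^sub>F d in nhds 0. P (x + d))"
  unfolding eventually_nhds_metric dist_norm by (metis add_diff_cancel_left' add.commute diff_add_cancel diff_zero)

definition jet2 :: "(real^'n \<Rightarrow> real) \<Rightarrow> real^'n \<Rightarrow> real^'n \<Rightarrow> real^'n^'n \<Rightarrow> bool" where
  "jet2 \<phi> x p X \<longleftrightarrow> transpose X = X \<and>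
     (\<forall>e>0. \<forall>\<^sub>F d in nhds 0. \<bar>\<phi> (x + d) - \<phi> x - p \<bullet> d - outer d \<bullet> X / 2\<bar> \<le> e * (norm d)\<^sup>2)"

lemma jet2_symmetric: "jet2 \<phi> x p X \<Longrightarrow> transpose X = X"
  by (simp add: jet2_def)

lemma jet2_eventually:
  "jet2 \<phi> x p X \<Longrightarrow> e > 0 \<Longrightarrow>
    \<forall>\<^sub>F d in nhds 0. \<bar>\<phi> (x + d) - \<phi> x - p \<bullet> d - outer d \<bullet> X / 2\<bar> \<le> e * (norm d)\<^sup>2"
  by (simp add: jet2_def)

lemma jet2_add:
  assumes "jet2 \<phi> x p X" "jet2 \<psi> x p' X'"
  shows "jet2 (\<lambda>y. \<phi> y + \<psi> y) x (p + p') (X + X')"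
  unfolding jet2_def
proof (intro conjI allI impI)
  fix e :: real assume e: "e > 0"
  then have "e / 2 > 0" by simp
  from jet2_eventually [OF assms(1) this] jet2_eventually [OF assms(2) this]
  show "\<forall>\<^sub>F d in nhds 0. \<bar>\<phi> (x + d) + \<psi> (x + d) - (\<phi> x + \<psi> x) - (p + p') \<bullet> d - outer d \<bullet> (X + X') / 2\<bar> \<le> e * (norm d)\<^sup>2"
    by eventually_elim (simp add: inner_add_left inner_add_right abs_le_iff field_simps)
qed (use assms in \<open>simp add: jet2_def transpose_linear\<close>)

lemma jet2_cmult:
  assumes "jet2 \<phi> x p X"
  shows "jet2 (\<lambda>y. c * \<phi> y) x (c *\<^sub>R p) (c *\<^sub>R X)"
  unfolding jet2_def
proof (intro conjI allI impI)
  fix e :: real assume e: "e > 0"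
  then have "e / (\<bar>c\<bar> + 1) > 0" by simp
  from jet2_eventually [OF assms(1) this]
  show "\<forall>\<^sub>F d in nhds 0. \<bar>c * \<phi> (x + d) - c * \<phi> x - (c *\<^sub>R p) \<bullet> d - outer d \<bullet> (c *\<^sub>R X) / 2\<bar> \<le> e * (norm d)\<^sup>2"
  proof eventually_elim
    case (elim d)
    have "\<bar>c * \<phi> (x + d) - c * \<phi> x - (c *\<^sub>R p) \<bullet> d - outer d \<bullet> (c *\<^sub>R X) / 2\<bar>
        = \<bar>c\<bar> * \<bar>\<phi> (x + d) - \<phi> x - p \<bullet> d - outer d \<bullet> X / 2\<bar>"
      by (simp add: abs_mult [symmetric] algebra_simps)
    also have "\<dots> \<le> \<bar>c\<bar> * (e / (\<bar>c\<bar> + 1) * (norm d)\<^sup>2)" by (rule mult_left_mono [OF elim]) simp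
    also have "\<dots> = (\<bar>c\<bar> / (\<bar>c\<bar> + 1)) * (e * (norm d)\<^sup>2)" by simp
    also have "\<dots> \<le> 1 * (e * (norm d)\<^sup>2)" using e by (intro mult_right_mono) auto
    finally show ?case by simp
  qed
qed (use assms in \<open>simp add: jet2_def transpose_linear\<close>)

lemma jet2_quadratic:
  assumes "transpose X = X" "\<And>d. \<phi> (x + d) = \<phi> x + p \<bullet> d + outer d \<bullet> X / 2"
  shows "jet2 \<phi> x p X"
  using assms by (simp add: jet2_def)

lemma jet2_const: "jet2 (\<lambda>y. c) x 0 0"
  by (rule jet2_quadratic) auto

text \<open>The inner function is exactly quadratic, so its increment is t = p.d + (d.Xd)/2 with no
  error. In the expansion of \<open>f\<close>, replacing t^2 by (p.d)^2 costs only O(|d|^3).\<close>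

lemma jet2_compose:
  fixes f f' :: "real \<Rightarrow> real"
  assumes X: "transpose X = X" and s: "\<And>d. s (x + d) = s x + p \<bullet> d + outer d \<bullet> X / 2"
    and f: "\<forall>\<^sub>F t in nhds (s x). (f has_real_derivative f' t) (at t)"
    and f': "(f' has_real_derivative b) (at (s x))"
  shows "jet2 (\<lambda>y. f (s y)) x (f' (s x) *\<^sub>R p) (f' (s x) *\<^sub>R X + b *\<^sub>R outer p)"
  unfolding jet2_def
proof (intro conjI allI impI)
  fix e :: real assume e: "e > 0"
  define K where "K = norm p + norm X"
  have K: "K \<ge> 0" by (simp add: K_def)
  define e' where "e' = e / (2 * (K\<^sup>2 + 1))"
  have pos: "K\<^sup>2 + 1 > 0" "\<bar>b\<bar> * K\<^sup>2 + 1 > 0" by (auto intro: add_nonneg_pos)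
  have "e' > 0" using e pos by (simp add: e'_def)
  then obtain r where r: "r > 0" "\<And>\<tau>. \<bar>\<tau>\<bar> < r \<Longrightarrow>
      \<bar>f (s x + \<tau>) - f (s x) - f' (s x) * \<tau> - b * \<tau>\<^sup>2 / 2\<bar> \<le> e' * \<tau>\<^sup>2"
    using taylor2_real [OF f f'] unfolding eventually_nhds_metric by (metis diff_zero dist_real_def)
  \<comment> \<open>The three bounds give |d| \<le> 1, |t| < r for the increment t, and a cubic
    cross term below half of the allowed error.\<close>
  define r' where "r' = min (min 1 (r / (K + 1))) (e / (2 * (\<bar>b\<bar> * K\<^sup>2 + 1)))"
  have "r' > 0" using r K e pos by (simp add: r'_def)
  moreover have "\<bar>f (s (x + d)) - f (s x) - (f' (s x) *\<^sub>R p) \<bullet> d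
      - outer d \<bullet> (f' (s x) *\<^sub>R X + b *\<^sub>R outer p) / 2\<bar> \<le> e * (norm d)\<^sup>2" if d: "norm d < r'" for d
  proof -
    define t where "t = p \<bullet> d + outer d \<bullet> X / 2"
    have d1: "norm d \<le> 1" "(K + 1) * norm d < r" "norm d * (\<bar>b\<bar> * K\<^sup>2 + 1) \<le> e / 2"
      using d K pos unfolding r'_def by (auto simp: field_simps)
    have pd: "\<bar>p \<bullet> d\<bar> \<le> norm p * norm d" by (rule Cauchy_Schwarz_ineq2)
    have "\<bar>outer d \<bullet> X\<bar> \<le> norm (outer d) * norm X" by (rule Cauchy_Schwarz_ineq2)
    then have Xd: "\<bar>outer d \<bullet> X / 2\<bar> \<le> norm X * (norm d)\<^sup>2" by (simp add: norm_outer mult.commute)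
    have "(norm d)\<^sup>2 \<le> norm d" using d1(1) by (simp add: power2_eq_square mult_left_le_one_le)
    then have "norm X * (norm d)\<^sup>2 \<le> norm X * norm d" by (rule mult_left_mono) simp
    then have t: "\<bar>t\<bar> \<le> K * norm d" "\<bar>p \<bullet> d\<bar> \<le> K * norm d" and Xd': "\<bar>outer d \<bullet> X / 2\<bar> \<le> K * (norm d)\<^sup>2"
      using pd Xd unfolding t_def K_def by (simp_all add: algebra_simps add_increasing)
    have "\<bar>t\<bar> < r" using t(1) d1(2) norm_ge_zero [of d] unfolding distrib_right by linarith
    then have "\<bar>f (s x + t) - f (s x) - f' (s x) * t - b * t\<^sup>2 / 2\<bar> \<le> e' * t\<^sup>2" by (rule r)
    also have "\<dots> \<le> e' * (K * norm d)\<^sup>2"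
      using t(1) \<open>e' > 0\<close> by (intro mult_left_mono) (auto simp: abs_le_square_iff [symmetric] K)
    also have "\<dots> = (e / 2 * (norm d)\<^sup>2) * (K\<^sup>2 / (K\<^sup>2 + 1))"
      by (simp add: e'_def power_mult_distrib)
    also have "\<dots> \<le> (e / 2 * (norm d)\<^sup>2) * 1"
      using e pos by (intro mult_left_mono) (auto simp: divide_le_eq)
    finally have 1: "\<bar>f (s x + t) - f (s x) - f' (s x) * t - b * t\<^sup>2 / 2\<bar> \<le> e / 2 * (norm d)\<^sup>2" by simp
    have "\<bar>b * (t\<^sup>2 - (p \<bullet> d)\<^sup>2) / 2\<bar> = \<bar>b\<bar> / 2 * (\<bar>outer d \<bullet> X / 2\<bar> * \<bar>t + p \<bullet> d\<bar>)"
    proof -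
      have "b * (t\<^sup>2 - (p \<bullet> d)\<^sup>2) / 2 = b / 2 * (outer d \<bullet> X / 2 * (t + p \<bullet> d))"
        by (simp add: t_def power2_eq_square algebra_simps)
      then show ?thesis by (simp only: abs_mult abs_divide)
    qed
    also have "\<dots> \<le> \<bar>b\<bar> / 2 * ((K * (norm d)\<^sup>2) * (2 * (K * norm d)))"
      using Xd' t K by (intro mult_left_mono mult_mono) auto
    also have "\<dots> = (norm d * (\<bar>b\<bar> * K\<^sup>2)) * (norm d)\<^sup>2" by (simp add: power2_eq_square)
    also have "\<dots> \<le> (norm d * (\<bar>b\<bar> * K\<^sup>2 + 1)) * (norm d)\<^sup>2" by (intro mult_right_mono mult_left_mono) auto
    also have "\<dots> \<le> e / 2 * (norm d)\<^sup>2" using d1(3) by (rule mult_right_mono) simp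
    finally have 2: "\<bar>b * (t\<^sup>2 - (p \<bullet> d)\<^sup>2) / 2\<bar> \<le> e / 2 * (norm d)\<^sup>2" .
    have "f (s (x + d)) - f (s x) - (f' (s x) *\<^sub>R p) \<bullet> d - outer d \<bullet> (f' (s x) *\<^sub>R X + b *\<^sub>R outer p) / 2
       = (f (s x + t) - f (s x) - f' (s x) * t - b * t\<^sup>2 / 2) + b * (t\<^sup>2 - (p \<bullet> d)\<^sup>2) / 2"
    proof -
      have "f (s (x + d)) = f (s x + t)" by (simp add: s t_def add.assoc)
      moreover have "outer d \<bullet> (f' (s x) *\<^sub>R X + b *\<^sub>R outer p) / 2
          = f' (s x) * (outer d \<bullet> X / 2) + b * (p \<bullet> d)\<^sup>2 / 2"
        by (simp add: inner_add_right outer_inner_outer inner_commute [of d] add_divide_distrib)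
      moreover have "f' (s x) * t = (f' (s x) *\<^sub>R p) \<bullet> d + f' (s x) * (outer d \<bullet> X / 2)"
        by (simp add: t_def distrib_left)
      moreover have "b * (t\<^sup>2 - (p \<bullet> d)\<^sup>2) / 2 = b * t\<^sup>2 / 2 - b * (p \<bullet> d)\<^sup>2 / 2"
        by (simp add: right_diff_distrib diff_divide_distrib)
      ultimately show ?thesis by linarith
    qed
    then show ?thesis using 1 2 by linarith
  qed
  ultimately show "\<forall>\<^sub>F d in nhds 0. \<bar>f (s (x + d)) - f (s x) - (f' (s x) *\<^sub>R p) \<bullet> d
      - outer d \<bullet> (f' (s x) *\<^sub>R X + b *\<^sub>R outer p) / 2\<bar> \<le> e * (norm d)\<^sup>2"
    unfolding eventually_nhds_metric by (auto simp: dist_norm)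
qed (use X in \<open>simp add: transpose_linear\<close>)

lemma sq_dist_expand:
  fixes a :: "real^'n"
  shows "(x + d - a) \<bullet> (x + d - a) = (x - a) \<bullet> (x - a) + (2 *\<^sub>R (x - a)) \<bullet> d + outer d \<bullet> (2 *\<^sub>R mat 1) / 2"
  by (simp add: outer_inner_mat)
    (simp add: inner_diff_left inner_diff_right inner_add_left inner_add_right inner_commute algebra_simps)

lemma jet2_sq_dist: "jet2 (\<lambda>y. (y - a) \<bullet> (y - a)) x (2 *\<^sub>R (x - a)) (2 *\<^sub>R mat 1)"
  by (rule jet2_quadratic) (simp_all add: transpose_linear sq_dist_expand)

text \<open>Radial functions are written in the squared distance, which is a polynomial; no square
  root has to be differentiated.\<close>

lemma jet2_radial:
  fixes x a :: "real^'n"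
  assumes "\<forall>\<^sub>F t in nhds ((x - a) \<bullet> (x - a)). (f has_real_derivative f' t) (at t)"
    and "(f' has_real_derivative b) (at ((x - a) \<bullet> (x - a)))"
  shows "jet2 (\<lambda>y. f ((y - a) \<bullet> (y - a))) x (f' ((x - a) \<bullet> (x - a)) *\<^sub>R 2 *\<^sub>R (x - a))
     ((2 * f' ((x - a) \<bullet> (x - a))) *\<^sub>R mat 1 + (4 * b) *\<^sub>R outer (x - a))"
proof -
  define c where "c = f' ((x - a) \<bullet> (x - a))"
  have "c *\<^sub>R 2 *\<^sub>R mat 1 + b *\<^sub>R outer (2 *\<^sub>R (x - a)) = (2 * c) *\<^sub>R mat 1 + (4 * b) *\<^sub>R outer (x - a)"
    unfolding outer_scaleR scaleR_scaleR by (simp add: mult.commute)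
  moreover have "transpose (2 *\<^sub>R mat 1 :: real^'n^'n) = 2 *\<^sub>R mat 1" by (simp add: transpose_linear)
  ultimately show ?thesis
    using jet2_compose [of "2 *\<^sub>R mat 1" "\<lambda>y. (y - a) \<bullet> (y - a)", OF _ sq_dist_expand assms]
    unfolding c_def by metis
qed

text \<open>Adding the expansions at \<open>t \<xi>\<close> and \<open>- t \<xi>\<close> cancels the
  gradients, so only the Hessians are compared.\<close>

lemma jet2_local_max:
  assumes "jet2 \<phi> x p X" "jet2 \<psi> x p' X'"
    and "\<forall>\<^sub>F y in nhds x. \<phi> y - \<psi> y \<le> \<phi> x - \<psi> x"
  shows "outer \<xi> \<bullet> X \<le> outer \<xi> \<bullet> X'"
proof -
  define g where "g y = \<phi> y + (- 1) * \<psi> y" for y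
  define P where "P = p + (- 1) *\<^sub>R p'"
  define Y where "Y = X + (- 1) *\<^sub>R X'"
  have g: "jet2 g x P Y" unfolding g_def P_def Y_def by (intro jet2_add jet2_cmult assms)
  have "outer \<xi> \<bullet> Y \<le> 0 + e" if e: "e > 0" for e
  proof -
    define e' where "e' = e / (2 * ((norm \<xi>)\<^sup>2 + 1))"
    have n: "(norm \<xi>)\<^sup>2 + 1 > 0" by (simp add: add_nonneg_pos)
    then have "e' > 0" using e by (simp add: e'_def)
    have ev: "\<forall>\<^sub>F y in nhds x. g y \<le> g x" using assms(3) by (simp add: g_def)
    have ev: "\<forall>\<^sub>F d in nhds 0. g (x + d) \<le> g x"
      using ev by (simp add: eventually_nhds_shift [of _ x])
    have "\<forall>\<^sub>F d in nhds 0. - P \<bullet> d - outer d \<bullet> Y / 2 \<ge> - e' * (norm d)\<^sup>2"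
      using jet2_eventually [OF g \<open>e' > 0\<close>] ev by eventually_elim (simp add: abs_le_iff)
    then obtain r where r: "r > 0" "\<And>d. norm d < r \<Longrightarrow> - P \<bullet> d - outer d \<bullet> Y / 2 \<ge> - e' * (norm d)\<^sup>2"
      unfolding eventually_nhds_metric by (auto simp: dist_norm)
    define t where "t = r / (2 * (norm \<xi> + 1))"
    have "norm \<xi> + 1 > 0" by (simp add: add_nonneg_pos)
    then have t: "t > 0" "t * norm \<xi> < r" using r(1) by (simp_all add: t_def pos_divide_less_eq mult_less_cancel_left_pos)
    have "- P \<bullet> (t *\<^sub>R \<xi>) - outer (t *\<^sub>R \<xi>) \<bullet> Y / 2 \<ge> - e' * (norm (t *\<^sub>R \<xi>))\<^sup>2"
      "- P \<bullet> ((-t) *\<^sub>R \<xi>) - outer ((-t) *\<^sub>R \<xi>) \<bullet> Y / 2 \<ge> - e' * (norm ((-t) *\<^sub>R \<xi>))\<^sup>2"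
      by (rule r; use t in simp)+
    then have "t\<^sup>2 * (outer \<xi> \<bullet> Y) \<le> t\<^sup>2 * (2 * e' * (norm \<xi>)\<^sup>2)"
      unfolding outer_scaleR by (simp add: power_mult_distrib algebra_simps)
    then have "outer \<xi> \<bullet> Y \<le> 2 * e' * (norm \<xi>)\<^sup>2" using t by simp
    also have "\<dots> \<le> e" using n e by (simp add: e'_def pos_divide_le_eq mult_left_mono)
    finally show ?thesis by simp
  qed
  then have "outer \<xi> \<bullet> Y \<le> 0" by (rule field_le_epsilon)
  then show ?thesis by (simp add: Y_def inner_diff_right)
qed

text \<open>A function touches itself from both sides, so each Hessian bounds the other. This
  identifies Hessians that were computed in two different ways.\<close>

lemma jet2_unique:
  assumes "jet2 \<phi> x p X" "jet2 \<phi> x p' X'"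
  shows "X = X'"
proof (rule symmetric_eqI)
  show "outer a \<bullet> X = outer a \<bullet> X'" for a
    using jet2_local_max [OF assms, of a] jet2_local_max [OF assms(2,1), of a] by simp
qed (rule jet2_symmetric, fact)+

section \<open>From second order expansions to C2 test functions\<close>

lemma C2_with_quadratic:
  assumes X: "transpose X = X"
  shows "C2_with (\<lambda>y. c + p \<bullet> (y - x) + outer (y - x) \<bullet> X / 2) (\<lambda>y. p + X *v (y - x)) (\<lambda>y. X)"
  unfolding C2_with_def
proof (intro conjI allI)
  fix y
  have d0: "((\<lambda>y. y - x) has_derivative (\<lambda>h. h)) (at y)" by (auto intro!: derivative_eq_intros)
  have d: "((\<lambda>y. X *v (y - x)) has_derivative (\<lambda>h. X *v h)) (at y)"
    by (rule bounded_linear.has_derivative [OF matrix_vector_mul_bounded_linear d0])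
  show "((\<lambda>y. p + X *v (y - x)) has_derivative (\<lambda>h. X *v h)) (at y)"
    using has_derivative_add [OF has_derivative_const [of p] d] by simp
  have "((\<lambda>y. (y - x) \<bullet> (X *v (y - x))) has_derivative
      (\<lambda>h. (y - x) \<bullet> (X *v h) + h \<bullet> (X *v (y - x)))) (at y)"
    by (rule has_derivative_inner [OF d0 d])
  then have "((\<lambda>y. (1 / 2) * ((y - x) \<bullet> (X *v (y - x)))) has_derivative
      (\<lambda>h. (1 / 2) * ((y - x) \<bullet> (X *v h) + h \<bullet> (X *v (y - x))))) (at y)"
    by (rule has_derivative_mult_right)
  moreover have "(1 / 2) * ((y - x) \<bullet> (X *v h) + h \<bullet> (X *v (y - x))) = (X *v (y - x)) \<bullet> h" for h
    unfolding symmetric_dot [OF X, of "y - x"] by (simp add: inner_commute)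
  ultimately have "((\<lambda>y. (1 / 2) * ((y - x) \<bullet> (X *v (y - x)))) has_derivative (\<bullet>) (X *v (y - x))) (at y)"
    by simp
  moreover have "((\<lambda>y. c + p \<bullet> (y - x)) has_derivative (\<bullet>) p) (at y)"
    using has_derivative_add [OF has_derivative_const [of c] has_derivative_inner_right [OF d0, of p]] by simp
  ultimately have "((\<lambda>y. c + p \<bullet> (y - x) + (1 / 2) * ((y - x) \<bullet> (X *v (y - x)))) has_derivative
      (\<lambda>h. p \<bullet> h + (X *v (y - x)) \<bullet> h)) (at y)"
    by (rule has_derivative_add [rotated])
  then show "((\<lambda>y. c + p \<bullet> (y - x) + outer (y - x) \<bullet> X / 2) has_derivative
      (\<lambda>h. (p + X *v (y - x)) \<bullet> h)) (at y)"
    by (simp add: outer_inner inner_add_left)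
qed simp

text \<open>The Taylor polynomial lowered by k|y - x|^2 is smooth everywhere, agrees with the test
  function at \<open>x\<close> and lies below it nearby, so the minimum survives. Subadditivity of
  the Pucci operator removes the perturbation as k tends to 0.\<close>

lemma supersol_jet2:
  fixes v :: "real^'n \<Rightarrow> real"
  assumes lam: "0 < lam" "lam \<le> Lam" and v: "viscosity_supersol (pucci_eq lam Lam q) v"
    and jet: "jet2 \<phi> x p X" and min: "\<forall>\<^sub>F y in nhds x. v x - \<phi> x \<le> v y - \<phi> y"
  shows "\<bar>v x\<bar> powr (q - 1) * v x \<le> pucci_max lam Lam X"
proof (rule field_le_epsilon)
  fix e :: real assume e: "e > 0"
  \<comment> \<open>Lowering by k|y - x|^2 changes the Hessian by \<open>2 * k\<close> times the
    identity, which costs at most \<open>2 * k * Lam * N = e\<close>.\<close>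
  define k where "k = e / (2 * (Lam * real CARD('n)))"
  have k: "k > 0" using e lam by (simp add: k_def)
  define Y where "Y = X + (- ((2 * k) *\<^sub>R mat 1))"
  define P where "P y = \<phi> x + p \<bullet> (y - x) + outer (y - x) \<bullet> Y / 2" for y
  have "transpose Y = Y" using jet by (simp add: Y_def jet2_def transpose_linear)
  then have C2: "C2_with P (\<lambda>y. p + Y *v (y - x)) (\<lambda>y. Y)"
    unfolding P_def by (rule C2_with_quadratic)
  have "\<forall>\<^sub>F d in nhds 0. P (x + d) \<le> \<phi> (x + d)"
    using jet2_eventually [OF jet k]
  proof eventually_elim
    case (elim d)
    have "P (x + d) = \<phi> x + p \<bullet> d + outer d \<bullet> X / 2 - k * (norm d)\<^sup>2"
      by (simp add: P_def Y_def inner_diff_right outer_inner_mat power2_norm_eq_inner diff_divide_distrib)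
    then show ?case using elim by linarith
  qed
  then have "\<forall>\<^sub>F y in nhds x. P y \<le> \<phi> y"
    by (simp add: eventually_nhds_shift [of _ x])
  then have "\<forall>\<^sub>F y in nhds x. v x - P x \<le> v y - P y"
    using min by eventually_elim (simp add: P_def)
  then have "\<exists>r>0. \<forall>y\<in>ball x r. v y - P y \<ge> v x - P x"
    unfolding eventually_nhds_metric by (auto simp: dist_commute)
  then have "0 \<le> pucci_eq lam Lam q x (v x) (p + Y *v (x - x)) Y"
    using v C2 unfolding viscosity_supersol_def by blast
  then have "\<bar>v x\<bar> powr (q - 1) * v x \<le> pucci_max lam Lam Y" by (simp add: pucci_eq_def)
  also have "\<dots> \<le> pucci_max lam Lam X + pucci_max lam Lam (- ((2 * k) *\<^sub>R mat 1) :: real^'n^'n)"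
    unfolding Y_def by (rule pucci_add_le [OF lam(1) lam(2)])
  also have "\<dots> \<le> pucci_max lam Lam X + 2 * k * (Lam * real CARD('n))"
    using pucci_scalar_le [OF lam, of "2 * k"] k by simp
  also have "2 * k * (Lam * real CARD('n)) = e" using lam by (simp add: k_def)
  finally show "\<bar>v x\<bar> powr (q - 1) * v x \<le> pucci_max lam Lam X + e" .
qed

text \<open>The polynomial is raised instead of lowered, and the supremum is discarded in favour of
  one fixed \<open>A\<close>: from here on \<open>u\<close> is treated by linear equations
  only.\<close>

lemma subsol_jet2:
  fixes u :: "real^'n \<Rightarrow> real"
  assumes lam: "0 < lam" "lam \<le> Lam" and u: "viscosity_subsol (pucci_eq lam Lam q) u"
    and A: "adm lam Lam A"
    and jet: "jet2 \<phi> x p X" and max: "\<forall>\<^sub>F y in nhds x. u y - \<phi> y \<le> u x - \<phi> x"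
  shows "- (A \<bullet> X) \<le> \<bar>u x\<bar> powr (q - 1) * u x"
proof (rule field_le_epsilon)
  fix e :: real assume e: "e > 0"
  define k where "k = e / (2 * (Lam * real CARD('n)))"
  have k: "k > 0" using e lam by (simp add: k_def)
  define Y where "Y = X + (2 * k) *\<^sub>R mat 1"
  define P where "P y = \<phi> x + p \<bullet> (y - x) + outer (y - x) \<bullet> Y / 2" for y
  have "transpose Y = Y" using jet by (simp add: Y_def jet2_def transpose_linear)
  then have C2: "C2_with P (\<lambda>y. p + Y *v (y - x)) (\<lambda>y. Y)"
    unfolding P_def by (rule C2_with_quadratic)
  have "\<forall>\<^sub>F d in nhds 0. P (x + d) \<ge> \<phi> (x + d)"
    using jet2_eventually [OF jet k]
  proof eventually_elim
    case (elim d)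
    have "P (x + d) = \<phi> x + p \<bullet> d + outer d \<bullet> X / 2 + k * (norm d)\<^sup>2"
      by (simp add: P_def Y_def inner_add_right outer_inner_mat power2_norm_eq_inner add_divide_distrib)
    then show ?case using elim by linarith
  qed
  then have "\<forall>\<^sub>F y in nhds x. P y \<ge> \<phi> y"
    by (simp add: eventually_nhds_shift [of _ x])
  then have "\<forall>\<^sub>F y in nhds x. u y - P y \<le> u x - P x"
    using max by eventually_elim (simp add: P_def)
  then have "\<exists>r>0. \<forall>y\<in>ball x r. u y - P y \<le> u x - P x"
    unfolding eventually_nhds_metric by (auto simp: dist_commute)
  then have "pucci_eq lam Lam q x (u x) (p + Y *v (x - x)) Y \<le> 0"
    using u C2 unfolding viscosity_subsol_def by blast
  then have "pucci_max lam Lam Y \<le> \<bar>u x\<bar> powr (q - 1) * u x" by (simp add: pucci_eq_def)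
  moreover have "- (A \<bullet> Y) \<le> pucci_max lam Lam Y" by (rule pucci_upper [OF lam(1) A])
  moreover have "2 * k * (A \<bullet> mat 1) \<le> 2 * k * (Lam * real CARD('n))"
    using adm_inner_mat1(2) [OF lam(1) A] k by simp
  moreover have "2 * k * (Lam * real CARD('n)) = e" using lam by (simp add: k_def)
  ultimately show "- (A \<bullet> X) \<le> \<bar>u x\<bar> powr (q - 1) * u x + e" by (simp add: Y_def inner_add_right)
qed

section \<open>Trigonometric approximation and mollification\<close>

text \<open>The free phase covers sines as well, so the product formula for cosines keeps the class
  closed under multiplication.\<close>

inductive trig :: "(real^'n \<Rightarrow> real) \<Rightarrow> bool" where
  cos: "trig (\<lambda>y. c * cos (k \<bullet> y + \<theta>))"
| add: "trig f \<Longrightarrow> trig g \<Longrightarrow> trig (\<lambda>y. f y + g y)"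

lemma trig_const: "trig (\<lambda>y. c)"
  using trig.cos [of c 0 0] by simp

lemma trig_mult_cos: "trig g \<Longrightarrow> trig (\<lambda>y. c * cos (k \<bullet> y + \<theta>) * g y)"
proof (induction rule: trig.induct)
  case (cos a l \<eta>)
  have "c * cos (k \<bullet> y + \<theta>) * (a * cos (l \<bullet> y + \<eta>))
     = (c * a / 2) * cos ((k + l) \<bullet> y + (\<theta> + \<eta>)) + (c * a / 2) * cos ((k - l) \<bullet> y + (\<theta> - \<eta>))" for y
  proof -
    have "cos ((k + l) \<bullet> y + (\<theta> + \<eta>)) = cos ((k \<bullet> y + \<theta>) + (l \<bullet> y + \<eta>))"
      "cos ((k - l) \<bullet> y + (\<theta> - \<eta>)) = cos ((k \<bullet> y + \<theta>) - (l \<bullet> y + \<eta>))"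
      by (simp_all add: inner_add_left inner_diff_left algebra_simps)
    then show ?thesis by (simp only: cos_add cos_diff) (simp add: algebra_simps)
  qed
  then show ?case by (simp only: trig.cos trig.add)
next
  case (add f g)
  then show ?case using trig.add by (fastforce simp: distrib_left)
qed

lemma trig_mult: "trig f \<Longrightarrow> trig g \<Longrightarrow> trig (\<lambda>y. f y * g y)"
proof (induction rule: trig.induct)
  case (cos c k \<theta>)
  then show ?case by (rule trig_mult_cos)
next
  case (add f1 f2)
  then show ?case using trig.add by (fastforce simp: distrib_right)
qed

lemma trig_sum: "finite I \<Longrightarrow> (\<And>i. i \<in> I \<Longrightarrow> trig (f i)) \<Longrightarrow> trig (\<lambda>y. \<Sum>i\<in>I. f i y)"
  by (induction I rule: finite_induct) (auto intro: trig_const trig.add)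

lemma trig_continuous: "trig f \<Longrightarrow> continuous_on S f"
  by (induction rule: trig.induct) (auto intro!: continuous_intros)

lemma trig_real_polynomial_cos:
  fixes a :: "real^'n"
  assumes "real_polynomial_function p"
  shows "trig (\<lambda>y. p (\<chi> i. cos (y $ i - a $ i)))"
  using assms
proof (induction rule: real_polynomial_function.induct)
  case (linear f)
  let ?t = "\<lambda>y. \<chi> i. cos (y $ i - a $ i)"
  have "f (?t y) = (\<Sum>i\<in>UNIV. f (axis i 1) * cos (axis i 1 \<bullet> y + (- (a $ i))))" for y
  proof -
    have "?t y = (\<Sum>i\<in>UNIV. (?t y $ i) *\<^sub>R axis i 1)"
      using basis_expansion [of "?t y"] by (simp add: scalar_mult_eq_scaleR)
    then have "f (?t y) = f (\<Sum>i\<in>UNIV. (?t y $ i) *\<^sub>R axis i 1)" by (rule arg_cong)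
    also have "\<dots> = (\<Sum>i\<in>UNIV. f ((?t y $ i) *\<^sub>R axis i 1))"
      by (rule linear_sum [OF bounded_linear.linear [OF linear]])
    also have "\<dots> = (\<Sum>i\<in>UNIV. f (axis i 1) * cos (axis i 1 \<bullet> y + (- (a $ i))))"
      by (rule sum.cong) (simp_all add: linear_scale [OF bounded_linear.linear [OF linear]] inner_axis' mult.commute)
    finally show ?thesis .
  qed
  then show ?case by (simp only:) (intro trig_sum finite trig.cos)
qed (auto intro: trig_const trig.add trig_mult)

text \<open>A polynomial in the \<open>cos (y $ i - a $ i)\<close> takes all its values on the cube,
  so an approximation there controls its global bounds.\<close>
lemma trig_approximation:
  fixes x0 :: "real^'n"
  defines "Q \<equiv> {y. \<forall>i. \<bar>y $ i - x0 $ i\<bar> \<le> pi / 2}"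
  assumes F: "continuous_on Q F" and e: "e > 0"
  obtains f where "trig f" "\<And>y. y \<in> Q \<Longrightarrow> \<bar>F y - f y\<bar> < e" "\<And>y. \<exists>y'\<in>Q. f y = f y'"
proof -
  \<comment> \<open>The shift moves each coordinate range on \<open>Q\<close> to [0, pi], where
    cosine is inverted by \<open>arccos\<close>; hence \<open>c\<close> maps \<open>Q\<close>
    bijectively onto the cube \<open>T\<close> with inverse \<open>s\<close>.\<close>
  define a where "a = (\<chi> i. x0 $ i - pi / 2)"
  define c where "c = (\<lambda>y::real^'n. \<chi> i. cos (y $ i - a $ i))"
  define s where "s = (\<lambda>t::real^'n. \<chi> i. arccos (t $ i) + a $ i)"
  define T where "T = {t::real^'n. \<forall>i. -1 \<le> t $ i \<and> t $ i \<le> 1}"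
  have "T = cbox (\<chi> i. -1) (\<chi> i. 1)" by (auto simp: T_def mem_box_cart)
  then have T: "compact T" by (simp add: compact_cbox)
  have cT: "c y \<in> T" for y by (simp add: c_def T_def)
  have sQ: "s t \<in> Q" if "t \<in> T" for t
    unfolding Q_def mem_Collect_eq
  proof
    fix i
    have "-1 \<le> t $ i" "t $ i \<le> 1" using that by (auto simp: T_def)
    then have "0 \<le> arccos (t $ i)" "arccos (t $ i) \<le> pi" by (simp_all add: arccos_lbound arccos_ubound)
    moreover have "s t $ i - x0 $ i = arccos (t $ i) - pi / 2" by (simp add: s_def a_def)
    ultimately show "\<bar>s t $ i - x0 $ i\<bar> \<le> pi / 2" unfolding abs_le_iff by linarith
  qed
  have cs: "c (s t) = t" if "t \<in> T" for t
    using that by (simp add: c_def s_def vec_eq_iff T_def cos_arccos)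
  have sc: "s (c y) = y" if "y \<in> Q" for y
  proof -
    have "0 \<le> y $ i - a $ i" "y $ i - a $ i \<le> pi" for i
    proof -
      have "\<bar>y $ i - x0 $ i\<bar> \<le> pi / 2" using that unfolding Q_def by blast
      moreover have "a $ i = x0 $ i - pi / 2" by (simp add: a_def)
      ultimately show "0 \<le> y $ i - a $ i" "y $ i - a $ i \<le> pi" by linarith+
    qed
    then show ?thesis by (simp add: c_def s_def vec_eq_iff arccos_cos)
  qed
  have "continuous_on T s"
    unfolding s_def by (intro continuous_intros) (auto simp: T_def)
  then have "continuous_on T (\<lambda>t. F (s t))"
    by (rule continuous_on_compose2 [OF F]) (use sQ in auto)
  then obtain p where p: "real_polynomial_function p" "\<And>t. t \<in> T \<Longrightarrow> \<bar>F (s t) - p t\<bar> < e"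
    using Stone_Weierstrass_real_polynomial_function [OF T _ e] by metis
  show ?thesis
  proof
    show "trig (\<lambda>y. p (c y))" unfolding c_def by (rule trig_real_polynomial_cos [OF p(1)])
    show "\<bar>F y - p (c y)\<bar> < e" if "y \<in> Q" for y using p(2) [OF cT, of y] sc [OF that] by simp
    show "\<exists>y'\<in>Q. p (c y) = p (c y')" for y using sQ [OF cT, of y] cs [OF cT, of y] by metis
  qed
qed

section \<open>The mollifier and its second order expansion\<close>

lemma lborel_integral_translate:
  fixes f :: "real^'n \<Rightarrow> real"
  assumes "f \<in> borel_measurable borel"
  shows "(\<integral>y. f (z + y) \<partial>lborel) = (\<integral>y. f y \<partial>lborel)"
proof -
  have "(\<integral>y. f y \<partial>lborel) = (\<integral>y. f y \<partial>(distr lborel borel ((+) z)))" by (simp add: lborel_distr_plus)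
  also have "\<dots> = (\<integral>y. f (z + y) \<partial>lborel)" by (rule integral_distr) (use assms in auto)
  finally show ?thesis by simp
qed

lemma integrable_compact_support:
  fixes f :: "real^'n \<Rightarrow> 'b::euclidean_space"
  assumes "continuous_on UNIV f" "\<And>y. y \<notin> cball z r \<Longrightarrow> f y = 0"
  shows "integrable lborel f"
proof -
  have "integrable lborel (\<lambda>x. indicator (cball z r) x *\<^sub>R f x)"
    by (rule borel_integrable_compact) (use assms(1) in \<open>auto intro: continuous_on_subset\<close>)
  moreover have "(\<lambda>x. indicator (cball z r) x *\<^sub>R f x) = f"
    using assms(2) by (auto simp: indicator_def fun_eq_iff)
  ultimately show ?thesis by simp
qed

text \<open>The cube is the smallest integer power for which the truncated paraboloid is C2. The
  kernel is polynomial on its support and is left unnormalised.\<close>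

definition rho :: "real \<Rightarrow> real^'n \<Rightarrow> real" where
  "rho e y = (max 0 (e\<^sup>2 - y \<bullet> y)) ^ 3"

text \<open>The sign is that of the expansion of \<open>rho e (y - d)\<close> in \<open>d\<close>,
  so this is minus the gradient of \<open>rho e\<close>; the Hessian is unaffected.\<close>

definition Drho :: "real \<Rightarrow> real^'n \<Rightarrow> real^'n" where
  "Drho e y = (6 * (max 0 (e\<^sup>2 - y \<bullet> y))\<^sup>2) *\<^sub>R y"

definition D2rho :: "real \<Rightarrow> real^'n \<Rightarrow> real^'n^'n" where
  "D2rho e y = (24 * max 0 (e\<^sup>2 - y \<bullet> y)) *\<^sub>R outer y - (6 * (max 0 (e\<^sup>2 - y \<bullet> y))\<^sup>2) *\<^sub>R mat 1"

text \<open>The remainder constant does not depend on \<open>s\<close>, even when \<open>s\<close>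
  and \<open>s + \<tau>\<close> lie on different sides of the kink. This makes the expansion of the
  kernel uniform in space.\<close>

lemma max_zero_cubed_expand:
  fixes s \<tau> :: real
  shows "\<bar>(max 0 (s + \<tau>)) ^ 3 - (max 0 s) ^ 3 - 3 * (max 0 s)\<^sup>2 * \<tau> - 3 * max 0 s * \<tau>\<^sup>2\<bar> \<le> \<bar>\<tau>\<bar> ^ 3"
proof -
  have cube: "(s + \<tau>) ^ 3 = s ^ 3 + 3 * s\<^sup>2 * \<tau> + 3 * s * \<tau>\<^sup>2 + \<tau> ^ 3"
    by (simp add: power2_eq_square power3_eq_cube algebra_simps)
  consider "s \<ge> 0" "s + \<tau> \<ge> 0" | "s \<ge> 0" "s + \<tau> < 0" | "s < 0" "s + \<tau> \<ge> 0" | "s < 0" "s + \<tau> < 0" by linarith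
  then show ?thesis
  proof cases
    case 1
    then show ?thesis using cube by (simp add: max_def power_abs)
  next
    case 2
    have "(-(s + \<tau>)) ^ 3 \<le> (-\<tau>) ^ 3" "0 \<le> (-(s + \<tau>)) ^ 3" using 2 by (intro power_mono zero_le_power; simp)+
    moreover have "(-(s + \<tau>)) ^ 3 = - ((s + \<tau>) ^ 3)" "(-\<tau>) ^ 3 = - (\<tau> ^ 3)" by (rule power_minus_odd, simp)+
    moreover have "\<bar>\<tau>\<bar> ^ 3 = (- \<tau>) ^ 3" using 2 by (simp add: abs_if)
    moreover have "max 0 (s + \<tau>) = 0" "max 0 s = s" using 2 by auto
    ultimately show ?thesis using cube by (simp only: abs_le_iff) (simp add: field_simps)
  next
    case 3
    have "(s + \<tau>) ^ 3 \<le> \<tau> ^ 3" "0 \<le> (s + \<tau>) ^ 3" using 3 by (intro power_mono zero_le_power; simp)+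
    then show ?thesis using 3 by (simp add: max_def power_abs)
  qed (simp add: max_def)
qed

lemma rho_nonneg: "0 \<le> rho e y"
  by (simp add: rho_def)

lemma rho_support:
  assumes "0 < e" "e \<le> norm y"
  shows "rho e y = 0" "Drho e y = 0" "D2rho e y = 0"
proof -
  have "e\<^sup>2 \<le> (norm y)\<^sup>2" using assms by (intro power_mono) auto
  then have "max 0 (e\<^sup>2 - y \<bullet> y) = 0" by (simp add: power2_norm_eq_inner)
  then show "rho e y = 0" "Drho e y = 0" "D2rho e y = 0" by (simp_all add: rho_def Drho_def D2rho_def)
qed

lemma transpose_D2rho: "transpose (D2rho e y) = D2rho e y"
  by (simp add: D2rho_def transpose_linear)

lemma continuous_outer [continuous_intros]:
  "continuous_on S f \<Longrightarrow> continuous_on S (\<lambda>x. outer (f x))"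
  unfolding outer_def by (intro continuous_intros)

lemma rho_continuous:
  assumes "continuous_on S g"
  shows "continuous_on S (\<lambda>y. rho e (g y))" "continuous_on S (\<lambda>y. Drho e (g y))" "continuous_on S (\<lambda>y. D2rho e (g y))"
  unfolding rho_def Drho_def D2rho_def by (intro continuous_intros assms)+

text \<open>The constant is independent of \<open>y\<close>, so the remainder can be integrated. For
  |y| > e + 1 all terms vanish; otherwise the increment of the squared distance is at most (2e +
  3)|d|, since 2(e + 1) + 1 = 2e + 3, and likewise 4e + 5 = 4(e + 1) + 1.\<close>

lemma rho_expand:
  fixes y d :: "real^'n"
  assumes e: "0 < e" and d: "norm d \<le> 1"
  shows "\<bar>rho e (y - d) - rho e y - Drho e y \<bullet> d - outer d \<bullet> D2rho e y / 2\<bar>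
     \<le> ((2 * e + 3) ^ 3 + 3 * e\<^sup>2 * (4 * e + 5)) * norm d ^ 3"
proof (cases "norm y \<le> e + 1")
  case False
  have "norm y \<le> norm (y - d) + norm d" using norm_triangle_ineq [of "y - d" d] by simp
  then have "e \<le> norm y" "e \<le> norm (y - d)" using False d by linarith+
  then have "rho e y = 0" "Drho e y = 0" "D2rho e y = 0" "rho e (y - d) = 0" by (simp_all only: rho_support [OF e])
  then show ?thesis using e by simp
next
  case True
  define s where "s = e\<^sup>2 - y \<bullet> y"
  define m where "m = max 0 s"
  define \<tau> where "\<tau> = 2 * (y \<bullet> d) - d \<bullet> d"
  have m: "0 \<le> m" "m \<le> e\<^sup>2" by (simp_all add: m_def s_def)
  have yd: "\<bar>y \<bullet> d\<bar> \<le> norm y * norm d" by (rule Cauchy_Schwarz_ineq2)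
  have dd: "(norm d)\<^sup>2 \<le> norm d" using d by (simp add: power2_eq_square mult_left_le_one_le)
  have yd': "\<bar>y \<bullet> d\<bar> \<le> (e + 1) * norm d" using yd mult_right_mono [OF True, of "norm d"] by simp
  have "\<bar>\<tau>\<bar> \<le> 2 * \<bar>y \<bullet> d\<bar> + (norm d)\<^sup>2" unfolding \<tau>_def power2_norm_eq_inner
    using inner_ge_zero [of d] by linarith
  also have "\<dots> \<le> (2 * e + 3) * norm d" using yd' dd by (simp add: algebra_simps)
  finally have "\<bar>\<tau>\<bar> ^ 3 \<le> ((2 * e + 3) * norm d) ^ 3" by (rule power_mono) simp
  then have \<tau>3: "\<bar>\<tau>\<bar> ^ 3 \<le> (2 * e + 3) ^ 3 * norm d ^ 3" by (simp only: power_mult_distrib)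
  have "e\<^sup>2 - (y - d) \<bullet> (y - d) = s + \<tau>"
    by (simp add: s_def \<tau>_def inner_diff_left inner_diff_right inner_commute)
  then have 1: "\<bar>rho e (y - d) - rho e y - 3 * m\<^sup>2 * \<tau> - 3 * m * \<tau>\<^sup>2\<bar> \<le> \<bar>\<tau>\<bar> ^ 3"
  proof -
    assume "e\<^sup>2 - (y - d) \<bullet> (y - d) = s + \<tau>"
    then have "rho e (y - d) = (max 0 (s + \<tau>)) ^ 3" by (simp only: rho_def)
    moreover have "rho e y = (max 0 s) ^ 3" by (simp only: rho_def s_def)
    ultimately show ?thesis using max_zero_cubed_expand [of s \<tau>] by (simp only: m_def)
  qed
  have "\<bar>3 * m * (\<tau>\<^sup>2 - (2 * (y \<bullet> d))\<^sup>2)\<bar> = 3 * m * ((norm d)\<^sup>2 * \<bar>d \<bullet> d - 4 * (y \<bullet> d)\<bar>)"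
  proof -
    have "3 * m * (\<tau>\<^sup>2 - (2 * (y \<bullet> d))\<^sup>2) = 3 * m * ((norm d)\<^sup>2 * (d \<bullet> d - 4 * (y \<bullet> d)))"
      unfolding power2_norm_eq_inner by (simp add: \<tau>_def power2_eq_square algebra_simps)
    then show ?thesis using m(1) by (simp only: abs_mult) simp
  qed
  also have "\<dots> \<le> 3 * e\<^sup>2 * ((norm d)\<^sup>2 * ((4 * e + 5) * norm d))"
  proof (intro mult_mono)
    have "\<bar>d \<bullet> d - 4 * (y \<bullet> d)\<bar> \<le> (norm d)\<^sup>2 + 4 * \<bar>y \<bullet> d\<bar>" unfolding power2_norm_eq_inner
      using inner_ge_zero [of d] by linarith
    also have "\<dots> \<le> (4 * e + 5) * norm d" using yd' dd by (simp add: algebra_simps)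
    finally show "\<bar>d \<bullet> d - 4 * (y \<bullet> d)\<bar> \<le> (4 * e + 5) * norm d" .
  qed (use m e in auto)
  also have "\<dots> = 3 * e\<^sup>2 * (4 * e + 5) * norm d ^ 3" by (simp add: power2_eq_square power3_eq_cube)
  finally have 2: "\<bar>3 * m * (\<tau>\<^sup>2 - (2 * (y \<bullet> d))\<^sup>2)\<bar> \<le> 3 * e\<^sup>2 * (4 * e + 5) * norm d ^ 3" .
  have "Drho e y \<bullet> d + outer d \<bullet> D2rho e y / 2 = 6 * m\<^sup>2 * (y \<bullet> d) + (24 * m * (y \<bullet> d)\<^sup>2 - 6 * m\<^sup>2 * (d \<bullet> d)) / 2"
    by (simp add: Drho_def D2rho_def m_def s_def inner_diff_right outer_inner_outer outer_inner_mat inner_commute [of d y])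
  also have "\<dots> = 3 * m\<^sup>2 * \<tau> + 3 * m * (2 * (y \<bullet> d))\<^sup>2"
    by (simp add: \<tau>_def power_mult_distrib diff_divide_distrib algebra_simps)
  finally have 3: "Drho e y \<bullet> d + outer d \<bullet> D2rho e y / 2 = 3 * m\<^sup>2 * \<tau> + 3 * m * (2 * (y \<bullet> d))\<^sup>2" .
  have 4: "3 * m * (\<tau>\<^sup>2 - (2 * (y \<bullet> d))\<^sup>2) = 3 * m * \<tau>\<^sup>2 - 3 * m * (2 * (y \<bullet> d))\<^sup>2" by (rule right_diff_distrib)
  show ?thesis unfolding distrib_right using 1 2 3 4 \<tau>3 by linarith
qed

lemma rho_integrable:
  assumes w: "continuous_on UNIV w" and e: "0 < e"
  shows "integrable lborel (\<lambda>y. w y * rho e (y - z))"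
    "integrable lborel (\<lambda>y. w y *\<^sub>R Drho e (y - z))"
    "integrable lborel (\<lambda>y. w y *\<^sub>R D2rho e (y - z))"
proof -
  have c: "continuous_on UNIV (\<lambda>y. w y * rho e (y - z))" "continuous_on UNIV (\<lambda>y. w y *\<^sub>R Drho e (y - z))"
    "continuous_on UNIV (\<lambda>y. w y *\<^sub>R D2rho e (y - z))"
    by (intro continuous_intros rho_continuous w)+
  have z: "e \<le> norm (y - z)" if "y \<notin> cball z e" for y
    using that by (simp add: dist_norm norm_minus_commute)
  show "integrable lborel (\<lambda>y. w y * rho e (y - z))"
    by (rule integrable_compact_support [OF c(1), where z = z and r = e]) (simp add: rho_support(1) [OF e z])
  show "integrable lborel (\<lambda>y. w y *\<^sub>R Drho e (y - z))"
    by (rule integrable_compact_support [OF c(2), where z = z and r = e]) (simp add: rho_support(2) [OF e z])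
  show "integrable lborel (\<lambda>y. w y *\<^sub>R D2rho e (y - z))"
    by (rule integrable_compact_support [OF c(3), where z = z and r = e]) (simp add: rho_support(3) [OF e z])
qed

definition mollify :: "real \<Rightarrow> (real^'n \<Rightarrow> real) \<Rightarrow> real^'n \<Rightarrow> real" where
  "mollify e w z = (\<integral>y. w y * rho e (y - z) \<partial>lborel)"

text \<open>All derivatives fall on the kernel: the expression is linear in \<open>w\<close>, and
  uniformly close functions have close values.\<close>

definition D2mollify :: "real \<Rightarrow> (real^'n \<Rightarrow> real) \<Rightarrow> real^'n \<Rightarrow> real^'n^'n" where
  "D2mollify e w z = (\<integral>y. w y *\<^sub>R D2rho e (y - z) \<partial>lborel)"

lemma inner_D2mollify:
  assumes "continuous_on UNIV w" "0 < e"
  shows "A \<bullet> D2mollify e w z = (\<integral>y. w y * (A \<bullet> D2rho e (y - z)) \<partial>lborel)"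
    "integrable lborel (\<lambda>y. w y * (A \<bullet> D2rho e (y - z)))"
proof -
  have "integrable lborel (\<lambda>y. w y *\<^sub>R D2rho e (y - z))" by (rule rho_integrable [OF assms])
  from integral_inner_right [OF this, of A] integrable_inner_right [OF this, of A]
  show "A \<bullet> D2mollify e w z = (\<integral>y. w y * (A \<bullet> D2rho e (y - z)) \<partial>lborel)"
    "integrable lborel (\<lambda>y. w y * (A \<bullet> D2rho e (y - z)))"
    by (simp_all add: D2mollify_def)
qed

lemma mollify_jet2:
  fixes w :: "real^'n \<Rightarrow> real"
  assumes w: "continuous_on UNIV w" and e: "0 < e"
  shows "jet2 (mollify e w) z (\<integral>y. w y *\<^sub>R Drho e (y - z) \<partial>lborel) (D2mollify e w z)"
  unfolding jet2_def
proof (intro conjI allI impI)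
  note int = rho_integrable [OF w e]
  have "bounded_linear (transpose :: real^'n^'n \<Rightarrow> _)"
    by (rule linear_conv_bounded_linear [THEN iffD1], rule linearI) (simp_all add: transpose_linear)
  from integral_bounded_linear [OF this int(3), of z]
  show "transpose (D2mollify e w z) = D2mollify e w z"
    by (simp add: D2mollify_def transpose_linear transpose_D2rho)
  fix \<epsilon> :: real assume \<epsilon>: "\<epsilon> > 0"
  define B where "B = (2 * e + 3) ^ 3 + 3 * e\<^sup>2 * (4 * e + 5)"
  have B: "B \<ge> 0" using e by (simp add: B_def)
  \<comment> \<open>For |d| \<le> 1 this ball contains the supports of the kernels centred at
    \<open>z\<close> and at \<open>z + d\<close>.\<close>
  define S where "S = cball z (e + 1)"
  have "compact (w ` S)" unfolding S_def by (intro compact_continuous_image continuous_on_subset [OF w]) auto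
  then have "bounded (w ` S)" by (rule compact_imp_bounded)
  then obtain M where M: "\<And>y. y \<in> S \<Longrightarrow> \<bar>w y\<bar> \<le> M" unfolding bounded_iff by auto
  have "z \<in> S" using e by (simp add: S_def)
  then have M0: "M \<ge> 0" using M [of z] by linarith
  define J where "J = (\<integral>y. (indicator S y :: real) \<partial>(lborel :: (real^'n) measure))"
  have intS: "integrable (lborel :: (real^'n) measure) (indicator S :: _ \<Rightarrow> real)"
    using borel_integrable_compact [of S "\<lambda>_. 1 :: real"] by (simp add: S_def)
  have J: "J \<ge> 0" unfolding J_def by (rule integral_nonneg_AE) simp
  define r where "r = min 1 (\<epsilon> / (M * B * J + 1))"
  have MBJ: "M * B * J + 1 > 0" using M0 B J by (simp add: add_nonneg_pos)
  have "r > 0" using \<epsilon> MBJ by (simp add: r_def)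
  moreover have "\<bar>mollify e w (z + d) - mollify e w z - (\<integral>y. w y *\<^sub>R Drho e (y - z) \<partial>lborel) \<bullet> d
      - outer d \<bullet> D2mollify e w z / 2\<bar> \<le> \<epsilon> * (norm d)\<^sup>2" if d: "norm d < r" for d
  proof -
    have d1: "norm d \<le> 1" using d by (simp add: r_def)
    define R where "R y = rho e (y - z - d) - rho e (y - z) - Drho e (y - z) \<bullet> d - outer d \<bullet> D2rho e (y - z) / 2" for y
    have i1: "integrable lborel (\<lambda>y. w y * rho e (y - z - d))" using int(1) [of "z + d"] by (simp add: diff_diff_eq)
    have i2: "integrable lborel (\<lambda>y. (w y *\<^sub>R Drho e (y - z)) \<bullet> d)" by (intro integrable_inner_left int(2))
    have i3: "integrable lborel (\<lambda>y. outer d \<bullet> (w y *\<^sub>R D2rho e (y - z)))" using int(3) by (intro integrable_inner_right)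
    have "mollify e w (z + d) - mollify e w z - (\<integral>y. w y *\<^sub>R Drho e (y - z) \<partial>lborel) \<bullet> d
      - outer d \<bullet> D2mollify e w z / 2
      = (\<integral>y. w y * rho e (y - z - d) \<partial>lborel) - (\<integral>y. w y * rho e (y - z) \<partial>lborel)
        - (\<integral>y. (w y *\<^sub>R Drho e (y - z)) \<bullet> d \<partial>lborel) - (\<integral>y. outer d \<bullet> (w y *\<^sub>R D2rho e (y - z)) \<partial>lborel) / 2"
      using integral_inner_left [OF int(2)] integral_inner_right [OF int(3)]
      by (simp add: mollify_def D2mollify_def diff_diff_eq)
    also have "\<dots> = (\<integral>y. w y * rho e (y - z - d) - w y * rho e (y - z)
        - (w y *\<^sub>R Drho e (y - z)) \<bullet> d - outer d \<bullet> (w y *\<^sub>R D2rho e (y - z)) / 2 \<partial>lborel)"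
      using i1 i2 i3 int(1) [of z] by (simp del: inner_scaleR_left inner_scaleR_right)
    also have "\<dots> = (\<integral>y. w y * R y \<partial>lborel)"
      by (rule Bochner_Integration.integral_cong) (simp_all add: R_def algebra_simps)
    finally have eq: "mollify e w (z + d) - mollify e w z - (\<integral>y. w y *\<^sub>R Drho e (y - z) \<partial>lborel) \<bullet> d
      - outer d \<bullet> D2mollify e w z / 2 = (\<integral>y. w y * R y \<partial>lborel)" .
    have "norm (\<integral>y. w y * R y \<partial>lborel) \<le> (\<integral>y. (M * (B * norm d ^ 3)) * indicator S y \<partial>lborel)"
    proof (rule Bochner_Integration.integral_norm_bound_integral)
      have "integrable lborel (\<lambda>y. w y * rho e (y - z - d) - w y * rho e (y - z)
        - (w y *\<^sub>R Drho e (y - z)) \<bullet> d - outer d \<bullet> (w y *\<^sub>R D2rho e (y - z)) / 2)"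
        by (intro Bochner_Integration.integrable_diff integrable_divide i1 i2 i3 int)
      then show "integrable lborel (\<lambda>y. w y * R y)"
        by (rule Bochner_Integration.integrable_cong [THEN iffD1, rotated 2]) (simp_all add: R_def algebra_simps)
      show "integrable lborel (\<lambda>y. (M * (B * norm d ^ 3)) * indicator S y)"
        using intS by (intro integrable_mult_right)
      fix y :: "real^'n"
      show "norm (w y * R y) \<le> (M * (B * norm d ^ 3)) * indicator S y"
      proof (cases "y \<in> S")
        case True
        have "\<bar>R y\<bar> \<le> B * norm d ^ 3" unfolding R_def B_def by (rule rho_expand [OF e d1])
        then have "\<bar>w y\<bar> * \<bar>R y\<bar> \<le> M * (B * norm d ^ 3)" by (intro mult_mono M True) (use M0 in auto)
        then show ?thesis using True by (simp add: abs_mult)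
      next
        case False
        then have "norm (y - z) > e + 1" by (simp add: S_def dist_norm norm_minus_commute)
        moreover have "norm (y - z) \<le> norm (y - z - d) + norm d" using norm_triangle_ineq [of "y - z - d" d] by simp
        ultimately have "e \<le> norm (y - z)" "e \<le> norm (y - z - d)" using d1 by linarith+
        then have "rho e (y - z) = 0" "Drho e (y - z) = 0" "D2rho e (y - z) = 0" "rho e (y - z - d) = 0"
          by (simp_all only: rho_support [OF e])
        then have "R y = 0" by (simp add: R_def)
        then show ?thesis using False by simp
      qed
    qed
    also have "\<dots> = (M * B * J * norm d) * (norm d)\<^sup>2"
      using intS by (simp add: J_def power2_eq_square power3_eq_cube)
    also have "\<dots> \<le> \<epsilon> * (norm d)\<^sup>2"
    proof (rule mult_right_mono)
      have "norm d \<le> \<epsilon> / (M * B * J + 1)" using d by (simp add: r_def)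
      then have "(M * B * J + 1) * norm d \<le> \<epsilon>" using MBJ by (simp add: pos_le_divide_eq mult.commute)
      then show "M * B * J * norm d \<le> \<epsilon>" unfolding distrib_right using norm_ge_zero [of d] by linarith
    qed simp
    finally show ?thesis using eq by simp
  qed
  ultimately show "\<forall>\<^sub>F d in nhds 0. \<bar>mollify e w (z + d) - mollify e w z - (\<integral>y. w y *\<^sub>R Drho e (y - z) \<partial>lborel) \<bullet> d
      - outer d \<bullet> D2mollify e w z / 2\<bar> \<le> \<epsilon> * (norm d)\<^sup>2"
    unfolding eventually_nhds_metric by (auto simp: dist_norm)
qed

text \<open>Both sides are second derivatives of the same translation-invariant integral,
  which replaces an integration by parts.\<close>
lemma D2mollify_cos:
  fixes k z :: "real^'n"
  assumes e: "0 < e"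
  shows "D2mollify e (\<lambda>y. cos (k \<bullet> y + \<theta>)) z = - mollify e (\<lambda>y. cos (k \<bullet> y + \<theta>)) z *\<^sub>R outer k"
proof -
  let ?c = "\<lambda>y::real^'n. cos (k \<bullet> y + \<theta>)" and ?s = "\<lambda>y::real^'n. sin (k \<bullet> y + \<theta>)"
  have cont: "continuous_on UNIV ?c" "continuous_on UNIV ?s" by (intro continuous_intros)+
  define a where "a = mollify e ?c z"
  define b where "b = mollify e ?s z"
  \<comment> \<open>Translating the integration variable moves the dependence on \<open>x\<close>
    into the phase, where the addition formula gives this combination; its second derivative at 0 is
    \<open>- a\<close>.\<close>
  define f where "f t = a * cos t - b * sin t" for t
  define f' where "f' t = - a * sin t - b * cos t" for t
  have "mollify e ?c x = f (k \<bullet> (x - z))" for x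
  proof -
    have "mollify e ?c x = (\<integral>y. ?c ((x - z) + y) * rho e ((x - z) + y - x) \<partial>lborel)"
      unfolding mollify_def
      by (rule lborel_integral_translate [symmetric], rule borel_measurable_continuous_onI)
        (intro continuous_intros rho_continuous)
    also have "\<dots> = (\<integral>y. cos (k \<bullet> (x - z)) * (?c y * rho e (y - z)) - sin (k \<bullet> (x - z)) * (?s y * rho e (y - z)) \<partial>lborel)"
    proof (rule Bochner_Integration.integral_cong)
      fix y :: "real^'n"
      have "k \<bullet> ((x - z) + y) + \<theta> = k \<bullet> (x - z) + (k \<bullet> y + \<theta>)" by (simp add: inner_add_right)
      moreover have "x - z + y - x = y - z" by simp
      ultimately show "?c ((x - z) + y) * rho e ((x - z) + y - x)
        = cos (k \<bullet> (x - z)) * (?c y * rho e (y - z)) - sin (k \<bullet> (x - z)) * (?s y * rho e (y - z))"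
        by (simp only: cos_add) (simp add: algebra_simps)
    qed simp
    also have "\<dots> = cos (k \<bullet> (x - z)) * a - sin (k \<bullet> (x - z)) * b"
      using rho_integrable(1) [OF cont(1) e, of z] rho_integrable(1) [OF cont(2) e, of z]
      by (simp add: a_def b_def mollify_def)
    finally show ?thesis by (simp add: f_def mult.commute)
  qed
  then have eq: "mollify e ?c = (\<lambda>x. f (k \<bullet> (x - z)))" by (rule ext)
  have "jet2 (\<lambda>x. f (k \<bullet> (x - z))) z (f' (k \<bullet> (z - z)) *\<^sub>R k) (f' (k \<bullet> (z - z)) *\<^sub>R 0 + (- a) *\<^sub>R outer k)"
  proof (rule jet2_compose)
    show "\<forall>\<^sub>F t in nhds (k \<bullet> (z - z)). (f has_real_derivative f' t) (at t)"
      unfolding f_def f'_def by (intro always_eventually allI) (auto intro!: derivative_eq_intros)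
    show "(f' has_real_derivative - a) (at (k \<bullet> (z - z)))"
      unfolding f'_def by (auto intro!: derivative_eq_intros)
  qed simp_all
  then have "jet2 (mollify e ?c) z (f' (k \<bullet> (z - z)) *\<^sub>R k) (f' (k \<bullet> (z - z)) *\<^sub>R 0 + (- a) *\<^sub>R outer k)"
    by (simp only: eq)
  from jet2_unique [OF mollify_jet2 [OF cont(1) e] this] show ?thesis by (simp add: a_def)
qed

section \<open>Mollified subsolutions of linear equations\<close>

lemma mollify_cmult: "mollify e (\<lambda>y. c * w y) z = c * mollify e w z"
  by (simp add: mollify_def mult.assoc)

lemma mollify_add:
  assumes "continuous_on UNIV w" "continuous_on UNIV w'" "0 < e"
  shows "mollify e (\<lambda>y. w y + w' y) z = mollify e w z + mollify e w' z"
  using rho_integrable(1) [OF assms(1,3), of z] rho_integrable(1) [OF assms(2,3), of z]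
  by (simp add: mollify_def distrib_right)

lemma mollify_mono:
  assumes "continuous_on UNIV w" "continuous_on UNIV w'" "0 < e"
    and le: "\<And>y. y \<in> cball z e \<Longrightarrow> w y \<le> w' y"
  shows "mollify e w z \<le> mollify e w' z"
  unfolding mollify_def
proof (rule integral_mono [OF rho_integrable(1) [OF assms(1,3)] rho_integrable(1) [OF assms(2,3)]])
  fix y
  show "w y * rho e (y - z) \<le> w' y * rho e (y - z)"
  proof (cases "y \<in> cball z e")
    case True
    then show ?thesis using le by (intro mult_right_mono rho_nonneg)
  next
    case False
    then have "e \<le> norm (y - z)" by (simp add: dist_norm norm_minus_commute)
    then show ?thesis by (simp add: rho_support(1) [OF assms(3)])
  qed
qed

lemma D2mollify_cmult: "D2mollify e (\<lambda>y. c * w y) z = c *\<^sub>R D2mollify e w z"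
proof -
  have "D2mollify e (\<lambda>y. c * w y) z = (\<integral>y. c *\<^sub>R (w y *\<^sub>R D2rho e (y - z)) \<partial>lborel)"
    by (simp add: D2mollify_def)
  also have "\<dots> = c *\<^sub>R D2mollify e w z" unfolding D2mollify_def by (rule integral_scaleR_right)
  finally show ?thesis .
qed

lemma D2mollify_add:
  assumes "continuous_on UNIV w" "continuous_on UNIV w'" "0 < e"
  shows "D2mollify e (\<lambda>y. w y + w' y) z = D2mollify e w z + D2mollify e w' z"
  using rho_integrable(3) [OF assms(1,3), of z] rho_integrable(3) [OF assms(2,3), of z]
  by (simp add: D2mollify_def scaleR_add_left)

text \<open>The equation is recorded twice: pointwise, for the maximum principle, and in mollified
  form, for passing to the limit. Boundedness of \<open>h\<close> is what confines extremal points
  in the unbounded domain.\<close>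

definition resolvent :: "real^'n^'n \<Rightarrow> real \<Rightarrow> (real^'n \<Rightarrow> real) \<Rightarrow> (real^'n \<Rightarrow> real) \<Rightarrow> bool" where
  "resolvent A \<delta> f h \<longleftrightarrow> continuous_on UNIV h \<and> bounded (range h) \<and>
     (\<forall>x. \<exists>p X. jet2 h x p X \<and> h x - \<delta> * (A \<bullet> X) = f x) \<and>
     (\<forall>e>0. \<forall>z. mollify e h z - \<delta> * (A \<bullet> D2mollify e h z) = mollify e f z)"

lemma resolvent_exists:
  assumes "trig f" "0 < \<delta>" and A: "\<And>\<xi>. 0 \<le> A \<bullet> outer \<xi>"
  shows "\<exists>h. resolvent A \<delta> f h"
  using assms(1)
proof (induction rule: trig.induct)
  case (cos c k \<theta>)
  \<comment> \<open>The eigenvalue of the operator h - \<delta> tr(A D^2 h) on a cosine of frequency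
    \<open>k\<close>; it is at least 1, so division by it is harmless.\<close>
  define b where "b = 1 + \<delta> * (A \<bullet> outer k)"
  have b: "b > 0" using assms(2) A [of k] by (simp add: b_def add_pos_nonneg)
  let ?c = "\<lambda>y. cos (k \<bullet> y + \<theta>)"
  define h where "h = (\<lambda>y. c / b * ?c y)"
  have cont: "continuous_on UNIV ?c" by (intro continuous_intros)
  have "resolvent A \<delta> (\<lambda>y. c * ?c y) h"
    unfolding resolvent_def
  proof (intro conjI allI impI)
    show "continuous_on UNIV h" unfolding h_def by (intro continuous_intros)
    show "bounded (range h)" unfolding bounded_iff
    proof (intro exI ballI)
      fix v assume "v \<in> range h"
      then obtain y where "v = c / b * ?c y" by (auto simp: h_def)
      then show "norm v \<le> \<bar>c / b\<bar> * 1" unfolding real_norm_def by (simp only: abs_mult) (intro mult_left_mono; simp)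
    qed
  next
    fix x
    define a where "a = k \<bullet> x + \<theta>"
    have "jet2 (\<lambda>y. cos (k \<bullet> y + \<theta>)) x (- sin a *\<^sub>R k) (- sin a *\<^sub>R 0 + (- cos a) *\<^sub>R outer k)"
      unfolding a_def
    proof (rule jet2_compose [where f' = "\<lambda>t. - sin t"])
      show "k \<bullet> (x + d) + \<theta> = k \<bullet> x + \<theta> + k \<bullet> d + outer d \<bullet> 0 / 2" for d by (simp add: inner_add_right)
      show "\<forall>\<^sub>F t in nhds (k \<bullet> x + \<theta>). (cos has_real_derivative - sin t) (at t)"
        by (intro always_eventually allI) (auto intro!: derivative_eq_intros)
      show "((\<lambda>t. - sin t) has_real_derivative - cos (k \<bullet> x + \<theta>)) (at (k \<bullet> x + \<theta>))"
        by (auto intro!: derivative_eq_intros)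
    qed simp
    then have "jet2 h x ((c / b) *\<^sub>R (- sin a *\<^sub>R k)) ((c / b) *\<^sub>R (- sin a *\<^sub>R 0 + (- cos a) *\<^sub>R outer k))"
      unfolding h_def by (rule jet2_cmult)
    moreover have "h x - \<delta> * (A \<bullet> ((c / b) *\<^sub>R (- sin a *\<^sub>R 0 + (- cos a) *\<^sub>R outer k))) = c * ?c x"
    proof -
      have "h x - \<delta> * (A \<bullet> ((c / b) *\<^sub>R (- sin a *\<^sub>R 0 + (- cos a) *\<^sub>R outer k))) = (c / b) * cos a * b"
        by (simp add: h_def a_def b_def distrib_left add_divide_distrib mult_ac)
      then show ?thesis using b by (simp add: a_def)
    qed
    ultimately show "\<exists>p X. jet2 h x p X \<and> h x - \<delta> * (A \<bullet> X) = c * ?c x" by blast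
  next
    fix e z assume e: "(e::real) > 0"
    have "mollify e h z - \<delta> * (A \<bullet> D2mollify e h z) = (c / b) * mollify e ?c z * b"
      proof -
      have "t * r - \<delta> * (A \<bullet> (t *\<^sub>R (- r *\<^sub>R outer k))) = t * r * (1 + \<delta> * (A \<bullet> outer k))" for t r
        by (simp add: algebra_simps)
      then show ?thesis unfolding h_def mollify_cmult D2mollify_cmult D2mollify_cos [OF e] by (simp only: b_def)
    qed
    also have "\<dots> = mollify e (\<lambda>y. c * ?c y) z" using b by (simp add: mollify_cmult)
    finally show "mollify e h z - \<delta> * (A \<bullet> D2mollify e h z) = mollify e (\<lambda>y. c * ?c y) z" .
  qed
  then show ?case by blast
next
  case (add f g)
  then obtain h h' where h: "resolvent A \<delta> f h" and h': "resolvent A \<delta> g h'" by blast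
  have cont: "continuous_on UNIV f" "continuous_on UNIV g" "continuous_on UNIV h" "continuous_on UNIV h'"
    using add h h' trig_continuous by (auto simp: resolvent_def)
  have "resolvent A \<delta> (\<lambda>y. f y + g y) (\<lambda>y. h y + h' y)"
    unfolding resolvent_def
  proof (intro conjI allI impI)
    show "continuous_on UNIV (\<lambda>y. h y + h' y)" using cont by (intro continuous_intros)
    show "bounded (range (\<lambda>y. h y + h' y))"
      by (rule bounded_plus_comp) (use h h' in \<open>simp_all add: resolvent_def\<close>)
  next
    fix x
    obtain p X p' X' where "jet2 h x p X" "h x - \<delta> * (A \<bullet> X) = f x" "jet2 h' x p' X'" "h' x - \<delta> * (A \<bullet> X') = g x"
      using h h' unfolding resolvent_def by blast
    then have "jet2 (\<lambda>y. h y + h' y) x (p + p') (X + X')" "h x + h' x - \<delta> * (A \<bullet> (X + X')) = f x + g x"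
      by (simp_all add: jet2_add inner_add_right distrib_left)
    then show "\<exists>p X. jet2 (\<lambda>y. h y + h' y) x p X \<and> h x + h' x - \<delta> * (A \<bullet> X) = f x + g x" by blast
  next
    fix e z assume e: "(e::real) > 0"
    have "mollify e h z - \<delta> * (A \<bullet> D2mollify e h z) = mollify e f z"
      "mollify e h' z - \<delta> * (A \<bullet> D2mollify e h' z) = mollify e g z"
      using h h' e by (auto simp: resolvent_def)
    then show "mollify e (\<lambda>y. h y + h' y) z - \<delta> * (A \<bullet> D2mollify e (\<lambda>y. h y + h' y) z) = mollify e (\<lambda>y. f y + g y) z"
      by (simp add: mollify_add D2mollify_add cont e inner_add_right distrib_left)
  qed
  then show ?case by blast
qed

lemma resolvent_uminus:
  assumes "resolvent A \<delta> f h"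
  shows "resolvent A \<delta> (\<lambda>y. - 1 * f y) (\<lambda>y. - 1 * h y)"
  unfolding resolvent_def
proof (intro conjI allI impI)
  show "continuous_on UNIV (\<lambda>y. - 1 * h y)" using assms by (auto simp: resolvent_def intro!: continuous_intros)
  show "bounded (range (\<lambda>y. - 1 * h y))" using assms by (simp add: resolvent_def bounded_iff)
next
  fix x
  obtain p X where "jet2 h x p X" "h x - \<delta> * (A \<bullet> X) = f x" using assms unfolding resolvent_def by blast
  then have "jet2 (\<lambda>y. - 1 * h y) x (- 1 *\<^sub>R p) (- 1 *\<^sub>R X)" "- 1 * h x - \<delta> * (A \<bullet> (- 1 *\<^sub>R X)) = - 1 * f x"
    by (simp_all only: jet2_cmult) simp
  then show "\<exists>p X. jet2 (\<lambda>y. - 1 * h y) x p X \<and> - 1 * h x - \<delta> * (A \<bullet> X) = - 1 * f x" by blast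
next
  fix e z assume e: "(e::real) > 0"
  have "mollify e h z - \<delta> * (A \<bullet> D2mollify e h z) = mollify e f z" using assms e by (auto simp: resolvent_def)
  then show "mollify e (\<lambda>y. - 1 * h y) z - \<delta> * (A \<bullet> D2mollify e (\<lambda>y. - 1 * h y) z) = mollify e (\<lambda>y. - 1 * f y) z"
    unfolding mollify_cmult D2mollify_cmult by simp
qed

section \<open>Maximum principle for the resolvent equation\<close>

context
  fixes lam Lam :: real and A :: "real^'n^'n"
  assumes lam: "0 < lam" and A: "adm lam Lam A"
begin

text \<open>At a maximum of \<open>h\<close> minus the paraboloid, ellipticity bounds the second
  order term by that of the paraboloid. A small \<open>m\<close> yields global bounds, while a large
  \<open>m\<close> localises \<open>f\<close> near \<open>x\<close>.\<close>

lemma resolvent_upper: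
  assumes h: "resolvent A \<delta> f h" and \<delta>: "0 < \<delta>" and m: "0 < m"
    and f: "\<And>y. f y \<le> a + m * ((y - x) \<bullet> (y - x))"
  shows "h x \<le> a + 2 * \<delta> * m * (A \<bullet> mat 1)"
proof -
  define \<phi> where "\<phi> y = m * ((y - x) \<bullet> (y - x))" for y
  have "bounded (range h)" using h by (simp add: resolvent_def)
  then obtain K where K: "\<And>y. \<bar>h y\<bar> \<le> K" unfolding bounded_iff by auto
  have K0: "K \<ge> 0" using K [of x] by linarith
  \<comment> \<open>On and beyond this radius the paraboloid exceeds the oscillation
    \<open>2 * K\<close> of \<open>h\<close>, so a maximum over the ball is a global one.\<close>
  define r where "r = sqrt ((2 * K + 1) / m)"
  have r: "r > 0" "m * r\<^sup>2 = 2 * K + 1" using K0 m by (simp_all add: r_def)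
  have "continuous_on (cball x r) (\<lambda>y. h y - \<phi> y)"
    using h unfolding resolvent_def \<phi>_def
    by (intro continuous_intros) (auto intro: continuous_on_subset)
  then obtain y where y: "y \<in> cball x r" "\<And>y'. y' \<in> cball x r \<Longrightarrow> h y' - \<phi> y' \<le> h y - \<phi> y"
    using continuous_attains_sup [of "cball x r" "\<lambda>y. h y - \<phi> y"] r by auto
  have x: "h x \<le> h y - \<phi> y" using y(2) [of x] r by (simp add: \<phi>_def)
  have max: "h y' - \<phi> y' \<le> h y - \<phi> y" for y'
  proof (cases "y' \<in> cball x r")
    case True then show ?thesis by (rule y)
  next
    case False
    then have "r\<^sup>2 \<le> (norm (y' - x))\<^sup>2" using r by (intro power_mono) (auto simp: dist_norm norm_minus_commute)
    then have "m * r\<^sup>2 \<le> \<phi> y'" unfolding \<phi>_def power2_norm_eq_inner [symmetric] using m by (intro mult_left_mono) auto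
    then show ?thesis using x r K [of y'] K [of x] by linarith
  qed
  obtain p X where jh: "jet2 h y p X" and eq: "h y - \<delta> * (A \<bullet> X) = f y" using h unfolding resolvent_def by blast
  have j\<phi>: "jet2 \<phi> y (m *\<^sub>R 2 *\<^sub>R (y - x)) (m *\<^sub>R 2 *\<^sub>R mat 1)"
    unfolding \<phi>_def by (intro jet2_cmult jet2_sq_dist)
  have "A \<bullet> X \<le> A \<bullet> (m *\<^sub>R 2 *\<^sub>R mat 1)"
    by (rule adm_inner_mono [OF lam A], rule jet2_local_max [OF jh j\<phi>]) (use max in simp)
  then have "\<delta> * (A \<bullet> X) \<le> \<delta> * (m * (2 * (A \<bullet> mat 1)))" using \<delta> by simp
  moreover have "f y \<le> a + \<phi> y" using f by (simp add: \<phi>_def)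
  ultimately have "h y - \<phi> y \<le> a + \<delta> * (m * (2 * (A \<bullet> mat 1)))" using eq by linarith
  also have "\<delta> * (m * (2 * (A \<bullet> mat 1))) = 2 * \<delta> * m * (A \<bullet> mat 1)" by (simp add: mult_ac)
  finally show ?thesis using x by linarith
qed

text \<open>The upper bound is applied to \<open>- h\<close> with an arbitrarily flat
  paraboloid.\<close>

lemma resolvent_lower:
  assumes h: "resolvent A \<delta> f h" and \<delta>: "0 < \<delta>" and f: "\<And>y. b \<le> f y"
  shows "b \<le> h x"
proof -
  have T: "0 \<le> A \<bullet> mat 1" by (rule adm_inner_mat1 [OF lam A])
  have "- h x \<le> - b + \<epsilon>" if \<epsilon>: "\<epsilon> > 0" for \<epsilon>
  proof -
    define m where "m = \<epsilon> / (2 * \<delta> * (A \<bullet> mat 1 + 1))"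
    have p: "2 * \<delta> * (A \<bullet> mat 1 + 1) > 0" using T \<delta> by simp
    have m: "m > 0" using \<epsilon> p by (simp add: m_def)
    have "(- 1) * f y \<le> - b + m * ((y - x) \<bullet> (y - x))" for y
    proof -
      have "0 \<le> m * ((y - x) \<bullet> (y - x))" using m by simp
      then show ?thesis using f [of y] by linarith
    qed
    then have "(- 1) * h x \<le> - b + 2 * \<delta> * m * (A \<bullet> mat 1)"
      by (rule resolvent_upper [OF resolvent_uminus [OF h] \<delta> m])
    moreover have "2 * \<delta> * m * (A \<bullet> mat 1) \<le> 2 * \<delta> * m * (A \<bullet> mat 1 + 1)"
      using m \<delta> by (intro mult_left_mono) auto
    moreover have "2 * \<delta> * m * (A \<bullet> mat 1 + 1) = \<epsilon>"
      using p by (metis m_def mult.commute mult.assoc nonzero_divide_eq_eq less_irrefl)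
    ultimately show ?thesis by linarith
  qed
  then have "- h x \<le> - b" by (rule field_le_epsilon)
  then show ?thesis by simp
qed

text \<open>Viscosity subsolutions of - tr(A D^2 u) \<le> g, tested with expansions so that sums of
  resolvent solutions and barriers qualify directly.\<close>

definition linear_sub :: "(real^'n \<Rightarrow> real) \<Rightarrow> (real^'n \<Rightarrow> real) \<Rightarrow> bool" where
  "linear_sub g u \<longleftrightarrow> (\<forall>\<phi> x p X. jet2 \<phi> x p X \<longrightarrow>
     (\<forall>\<^sub>F y in nhds x. u y - \<phi> y \<le> u x - \<phi> x) \<longrightarrow> - (A \<bullet> X) \<le> g x)"

text \<open>The barrier \<open>|y - x|^4 + c\<close> with \<open>c\<close> of order \<open>\<delta>\<^sup>2\<close> is a supersolution of the resolvent
  equation and dominates on the boundary of the ball, yet contributes only \<open>O(\<delta>\<^sup>2)\<close> at the centre.\<close>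
lemma subsol_le_resolvent:
  assumes h: "resolvent A \<delta> f h" and \<delta>: "0 < \<delta>"
    and u: "continuous_on UNIV u" "linear_sub g u"
    and bound: "\<And>y. y \<in> cball x (1/2) \<Longrightarrow> u y \<le> M" "\<And>y. - (3 * M) \<le> h y" "0 \<le> M"
    and f: "\<And>y. y \<in> cball x (1/2) \<Longrightarrow> u y + \<delta> * g y \<le> f y"
  shows "u x \<le> h x + 64 * M * ((4 * (A \<bullet> mat 1) + 8 * Lam)\<^sup>2 / 4) * \<delta>\<^sup>2"
proof (rule ccontr)
  \<comment> \<open>The operator applied to |y - x|^4 is at most \<open>c1\<close> times |y -
    x|^2.\<close>
  define c1 where "c1 = 4 * (A \<bullet> mat 1) + 8 * Lam"
  define c where "c = c1\<^sup>2 / 4 * \<delta>\<^sup>2"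
  \<comment> \<open>At distance 1/2 the quartic term is 1/16, so the barrier is at least
    \<open>4 * M\<close> there, which covers u - h \<le> M + 3M.\<close>
  define K where "K = 64 * M"
  define b where "b y = K * (((y - x) \<bullet> (y - x))\<^sup>2 + c)" for y
  have K: "K \<ge> 0" using bound by (simp add: K_def)
  have c: "c \<ge> 0" by (simp add: c_def)
  assume "\<not> ?thesis"
  moreover have "b x = 64 * M * ((4 * (A \<bullet> mat 1) + 8 * Lam)\<^sup>2 / 4) * \<delta>\<^sup>2"
    by (simp add: b_def K_def c_def c1_def)
  ultimately have neg: "u x > h x + b x" by linarith
  have "continuous_on (cball x (1/2)) (\<lambda>y. u y - (h y + b y))"
    using h u unfolding resolvent_def b_def by (intro continuous_intros) (auto intro: continuous_on_subset)
  then obtain y where y: "y \<in> cball x (1/2)" "\<And>y'. y' \<in> cball x (1/2) \<Longrightarrow> u y' - (h y' + b y') \<le> u y - (h y + b y)"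
    using continuous_attains_sup [of "cball x (1/2)" "\<lambda>y. u y - (h y + b y)"] by auto
  have pos: "u y - (h y + b y) > 0" using y(2) [of x] neg by simp
  define s where "s = (y - x) \<bullet> (y - x)"
  have "norm (y - x) \<noteq> 1/2"
  proof
    assume n: "norm (y - x) = 1/2"
    have sq: "s = 1/4" unfolding s_def power2_norm_eq_inner [symmetric] n by (simp add: power2_eq_square)
    have "b y = 4 * M + K * c" unfolding b_def s_def [symmetric] sq by (simp add: K_def power2_eq_square distrib_left)
    moreover have "0 \<le> K * c" using K c by simp
    ultimately show False using pos bound(1) [OF y(1)] bound(2) [of y] by linarith
  qed
  then have "y \<in> ball x (1/2)" using y(1) by (simp add: dist_norm norm_minus_commute)
  then have "\<forall>\<^sub>F y' in nhds y. y' \<in> ball x (1/2)" by (intro eventually_nhds_in_open) auto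
  then have max: "\<forall>\<^sub>F y' in nhds y. u y' - (h y' + b y') \<le> u y - (h y + b y)"
    by eventually_elim (simp add: y)
  obtain p X where jh: "jet2 h y p X" and eq: "h y - \<delta> * (A \<bullet> X) = f y" using h unfolding resolvent_def by blast
  have "jet2 (\<lambda>y. ((y - x) \<bullet> (y - x))\<^sup>2 + c) y ((2 * s) *\<^sub>R 2 *\<^sub>R (y - x)) ((2 * (2 * s)) *\<^sub>R mat 1 + (4 * 2) *\<^sub>R outer (y - x))"
    unfolding s_def
    by (rule jet2_radial [where f = "\<lambda>t. t\<^sup>2 + c" and f' = "\<lambda>t. 2 * t"])
      (auto intro!: derivative_eq_intros always_eventually)
  then have jb: "jet2 b y (K *\<^sub>R (2 * s) *\<^sub>R 2 *\<^sub>R (y - x)) (K *\<^sub>R ((2 * (2 * s)) *\<^sub>R mat 1 + (4 * 2) *\<^sub>R outer (y - x)))"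
    unfolding b_def by (rule jet2_cmult)
  define Y where "Y = K *\<^sub>R ((2 * (2 * s)) *\<^sub>R mat 1 + (4 * 2) *\<^sub>R outer (y - x))"
  have "- (A \<bullet> (X + Y)) \<le> g y"
    using u(2) jet2_add [OF jh jb] max unfolding linear_sub_def Y_def by blast
  then have "\<delta> * (- (A \<bullet> (X + Y))) \<le> \<delta> * g y" by (rule mult_left_mono) (use \<delta> in simp)
  then have 1: "- (\<delta> * (A \<bullet> X)) - \<delta> * (A \<bullet> Y) \<le> \<delta> * g y" by (simp add: inner_add_right algebra_simps)
  have AY: "A \<bullet> Y \<le> K * (c1 * s)"
  proof -
    have "A \<bullet> Y = K * (4 * s * (A \<bullet> mat 1) + 8 * (A \<bullet> outer (y - x)))" by (simp add: Y_def inner_add_right)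
    also have "\<dots> \<le> K * (4 * s * (A \<bullet> mat 1) + 8 * (Lam * s))"
      using adm_upper [OF A, of "y - x"] K by (intro mult_left_mono add_left_mono) (auto simp: s_def)
    also have "4 * s * (A \<bullet> mat 1) + 8 * (Lam * s) = c1 * s" by (simp add: c1_def algebra_simps)
    finally show ?thesis .
  qed
  \<comment> \<open>Completing the square dictates c = (c1 \<delta> / 2)^2: with it the barrier
    absorbs \<delta> times its own second order term.\<close>
  have "0 \<le> (s - c1 * \<delta> / 2)\<^sup>2" by simp
  then have "\<delta> * (c1 * s) \<le> s\<^sup>2 + c" by (simp add: c_def power2_eq_square algebra_simps)
  then have "K * (\<delta> * (c1 * s)) \<le> b y" unfolding b_def s_def [symmetric] using K by (rule mult_left_mono)
  moreover have "\<delta> * (A \<bullet> Y) \<le> \<delta> * (K * (c1 * s))" using AY \<delta> by simp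
  moreover have "\<delta> * (K * (c1 * s)) = K * (\<delta> * (c1 * s))" by (simp add: mult_ac)
  moreover have "u y + \<delta> * g y \<le> f y" by (rule f [OF y(1)])
  ultimately show False using 1 eq pos by linarith
qed


text \<open>The solution \<open>h\<close> satisfies the mollified identity exactly and differs
  little from \<open>u\<close>. The lower bound u - O(\<delta>^2) \<le> h is essential: the identity
  is divided by \<delta>, so an error of order \<delta> would survive. For the upper side, closeness
  of \<open>h\<close> to \<open>u\<close> is enough.\<close>

lemma linear_sub_mollify:
  assumes u: "continuous_on UNIV u" "linear_sub g u" and g: "continuous_on UNIV g"
    and e: "0 < e" "e \<le> 1/2"
  shows "- (A \<bullet> D2mollify e u z) \<le> mollify e g z"
proof (rule field_le_epsilon)
  fix \<epsilon> :: real assume \<epsilon>: "\<epsilon> > 0"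
  define Q where "Q = {y. \<forall>i. \<bar>y $ i - z $ i\<bar> \<le> pi / 2}"
  have "Q = cbox (\<chi> i. z $ i - pi / 2) (\<chi> i. z $ i + pi / 2)"
    unfolding Q_def set_eq_iff mem_box_cart mem_Collect_eq vec_lambda_beta abs_le_iff by (smt (verit))
  then have Q: "compact Q" by (simp add: compact_cbox)
  have ballQ: "y \<in> Q" if "norm (y - z) \<le> 1" for y
    unfolding Q_def mem_Collect_eq
  proof
    fix i
    have "\<bar>(y - z) $ i\<bar> \<le> norm (y - z)" by (rule component_le_norm_cart)
    then show "\<bar>y $ i - z $ i\<bar> \<le> pi / 2" using that pi_gt3 by simp
  qed
  have "bounded (u ` Q)" "bounded (g ` Q)"
    by (intro compact_imp_bounded compact_continuous_image Q continuous_on_subset [OF u(1)] continuous_on_subset [OF g] subset_UNIV)+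
  then obtain M1 M2 where M12: "\<And>y. y \<in> Q \<Longrightarrow> \<bar>u y\<bar> \<le> M1" "\<And>y. y \<in> Q \<Longrightarrow> \<bar>g y\<bar> \<le> M2"
    unfolding bounded_iff by auto
  define M where "M = 1 + \<bar>M1\<bar> + \<bar>M2\<bar>"
  have M: "\<bar>u y\<bar> \<le> M" "\<bar>g y\<bar> \<le> M" if "y \<in> Q" for y using M12 [OF that] unfolding M_def by linarith+
  have M1: "M \<ge> 1" by (simp add: M_def)
  define T where "T = A \<bullet> mat 1"
  have T: "T \<ge> 0" unfolding T_def by (rule adm_inner_mat1 [OF lam A])
  have Apos: "0 \<le> A \<bullet> outer \<xi>" for \<xi>
  proof -
    have "0 \<le> lam * (\<xi> \<bullet> \<xi>)" using lam by simp
    also have "\<dots> \<le> A \<bullet> outer \<xi>" by (rule adm_lower [OF A])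
    finally show ?thesis .
  qed
  define C where "C = 64 * M * ((4 * (A \<bullet> mat 1) + 8 * Lam)\<^sup>2 / 4)"
  have C: "C \<ge> 0" using M1 by (simp add: C_def)
  define I0 where "I0 = mollify e (\<lambda>_. 1) z"
  define I2 where "I2 = (\<integral>y. \<bar>1 * (A \<bullet> D2rho e (y - z))\<bar> \<partial>lborel)"
  have I0: "I0 \<ge> 0" unfolding I0_def mollify_def by (rule integral_nonneg_AE) (simp add: rho_nonneg)
  have I2: "I2 \<ge> 0" unfolding I2_def by (rule integral_nonneg_AE) simp
  define \<tau> where "\<tau> = \<epsilon> / (2 * I2 + I0 + 1)"
  have den: "2 * I2 + I0 + 1 > 0" using I0 I2 by linarith
  have \<tau>: "\<tau> > 0" using \<epsilon> den by (simp add: \<tau>_def)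
  have "uniformly_continuous_on Q u"
    by (intro compact_uniformly_continuous Q continuous_on_subset [OF u(1)]) simp
  then obtain r0 where r0: "r0 > 0" "\<And>x y. x \<in> Q \<Longrightarrow> y \<in> Q \<Longrightarrow> dist y x < r0 \<Longrightarrow> dist (u y) (u x) < \<tau>"
    unfolding uniformly_continuous_on_def using \<tau> by blast
  define r where "r = min r0 (1/2)"
  have r: "r > 0" "r \<le> r0" "r \<le> 1/2" using r0(1) by (auto simp: r_def)
  \<comment> \<open>Outside radius \<open>r\<close> the paraboloid is at least \<open>4 * M\<close>,
    which dominates f - a, because f \<le> 3M and a \<ge> -M.\<close>
  define m where "m = 4 * M / r\<^sup>2"
  have m: "m > 0" using M1 r by (simp add: m_def)
  \<comment> \<open>The second bound controls the barrier error \<open>C * \<delta>\<^sup>2\<close>,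
    the third the cost of the paraboloid together with the size of
    \<open>\<delta> * g\<close>.\<close>
  define \<delta> where "\<delta> = min 1 (min (\<tau> / (C + 1)) (\<tau> / (M + 1 + 2 * m * T)))"
  have den2: "M + 1 + 2 * m * T > 0" using M1 m T by (simp add: add_pos_nonneg)
  have \<delta>: "\<delta> > 0" "\<delta> \<le> 1" using \<tau> C den2 by (auto simp: \<delta>_def)
  have "\<delta> \<le> \<tau> / (C + 1)" "\<delta> \<le> \<tau> / (M + 1 + 2 * m * T)" by (simp_all add: \<delta>_def)
  then have \<delta>1: "(C + 1) * \<delta> \<le> \<tau>" and \<delta>2: "(M + 1 + 2 * m * T) * \<delta> \<le> \<tau>"
    using C den2 by (simp_all add: pos_le_divide_eq mult.commute)
  have \<delta>sq: "\<delta>\<^sup>2 \<le> \<delta>" using \<delta> by (simp add: power2_eq_square mult_left_le_one_le)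
  have cF: "continuous_on Q (\<lambda>y. u y + \<delta> * g y + \<delta>\<^sup>2 / 2)"
    by (intro continuous_intros continuous_on_subset [OF u(1)] continuous_on_subset [OF g]) auto
  \<comment> \<open>Shifting the target up by half of \<delta>^2 and approximating with that same
    accuracy gives one-sided bounds: \<open>f\<close> lies between u + \<delta> g and u + \<delta> g
    + \<delta>^2 on \<open>Q\<close>.\<close>
  have "\<delta>\<^sup>2 / 2 > 0" using \<delta> by simp
  then have "\<exists>f. trig f \<and> (\<forall>y\<in>Q. \<bar>u y + \<delta> * g y + \<delta>\<^sup>2 / 2 - f y\<bar> < \<delta>\<^sup>2 / 2) \<and> (\<forall>y. \<exists>y'\<in>Q. f y = f y')"
    unfolding Q_def by (rule trig_approximation [OF cF [unfolded Q_def]]) blast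
  then obtain f where f: "trig f" "\<And>y. y \<in> Q \<Longrightarrow> \<bar>u y + \<delta> * g y + \<delta>\<^sup>2 / 2 - f y\<bar> < \<delta>\<^sup>2 / 2"
      "\<And>y. \<exists>y'\<in>Q. f y = f y'" by blast
  have f_low: "u y + \<delta> * g y \<le> f y" and f_up: "f y \<le> u y + \<delta> * g y + \<delta>\<^sup>2" if "y \<in> Q" for y
    using f(2) [OF that] by linarith+
  have \<delta>g: "\<bar>\<delta> * g y\<bar> \<le> \<delta> * M" if "y \<in> Q" for y
    using M(2) [OF that] \<delta> by (simp add: abs_mult)
  have \<delta>M: "\<delta> * M \<le> M" using \<delta> M1 by (simp add: mult_left_le_one_le)
  \<comment> \<open>Global, although \<open>u\<close> is only bounded on \<open>Q\<close>: every
    value of \<open>f\<close> is attained on \<open>Q\<close>.\<close>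
  have fb: "\<bar>f y\<bar> \<le> 3 * M" for y
  proof -
    obtain y' where y': "y' \<in> Q" "f y = f y'" using f(3) by blast
    have "0 \<le> \<delta>\<^sup>2" by simp
    then show ?thesis
      using f_low [OF y'(1)] f_up [OF y'(1)] M(1) [OF y'(1)] \<delta>g [OF y'(1)] \<delta>M \<delta>sq \<delta> M1 unfolding y'(2) by linarith
  qed
  obtain h where h: "resolvent A \<delta> f h" using resolvent_exists [OF f(1) \<delta>(1) Apos] by blast
  have h_low: "- (3 * M) \<le> h y" for y
  proof (rule resolvent_lower [OF h \<delta>(1)])
    show "- (3 * M) \<le> f y" for y using fb [of y] by linarith
  qed
  \<comment> \<open>Balls of radius 1/2 around points of \<open>cball z (1/2)\<close> stay in the
    unit ball, hence in \<open>Q\<close>, since 1 < pi/2.\<close>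
  have in_Q: "y \<in> Q" if "x \<in> cball z (1/2)" "dist y x \<le> 1/2" for x y
  proof (rule ballQ)
    have "norm (y - z) \<le> dist y x + dist z x" using norm_triangle_ineq [of "y - x" "x - z"]
      by (simp add: dist_norm norm_minus_commute)
    then show "norm (y - z) \<le> 1" using that by simp
  qed
  have u_le: "u x \<le> h x + C * \<delta>\<^sup>2" if x: "x \<in> cball z (1/2)" for x
    unfolding C_def
  proof (rule subsol_le_resolvent [OF h \<delta>(1) u _ h_low])
    fix y assume "y \<in> cball x (1/2)"
    then have "y \<in> Q" using in_Q [OF x] by (simp add: dist_commute)
    then show "u y \<le> M" "u y + \<delta> * g y \<le> f y" using M f_low by force+
  qed (use M1 in simp)
  have h_le: "h x \<le> u x + 2 * \<tau>" if x: "x \<in> cball z (1/2)" for x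
  proof -
    have xQ: "x \<in> Q" by (rule in_Q [OF x]) simp
    define a where "a = u x + \<tau> + \<delta> * (M + 1)"
    have am: "- M \<le> a" using M(1) [OF xQ] \<tau> \<delta> M1 unfolding a_def
      by (smt (verit) mult_nonneg_nonneg)
    have "f y \<le> a + m * ((y - x) \<bullet> (y - x))" for y
    proof (cases "dist y x < r")
      case True
      then have yQ: "y \<in> Q" using in_Q [OF x] r by simp
      have "dist (u y) (u x) < \<tau>" using r0(2) [OF xQ yQ] True r by simp
      then have "u y \<le> u x + \<tau>" by (simp add: dist_real_def)
      moreover have "\<delta> * (M + 1) = \<delta> * M + \<delta>" by (simp add: distrib_left)
      ultimately have "f y \<le> a" using f_up [OF yQ] \<delta>g [OF yQ] \<delta>sq unfolding a_def by linarith
      moreover have "0 \<le> m * ((y - x) \<bullet> (y - x))" using m by simp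
      ultimately show ?thesis by linarith
    next
      case False
      then have "r\<^sup>2 \<le> (norm (y - x))\<^sup>2" using r by (intro power_mono) (auto simp: dist_norm)
      then have "m * r\<^sup>2 \<le> m * ((y - x) \<bullet> (y - x))" unfolding power2_norm_eq_inner using m by (intro mult_left_mono) auto
      moreover have "m * r\<^sup>2 = 4 * M" using r by (simp add: m_def)
      ultimately show ?thesis using fb [of y] am by linarith
    qed
    then have "h x \<le> a + 2 * \<delta> * m * (A \<bullet> mat 1)" by (rule resolvent_upper [OF h \<delta>(1) m])
    also have "\<dots> = u x + \<tau> + (M + 1 + 2 * m * T) * \<delta>" by (simp add: a_def T_def algebra_simps)
    finally show ?thesis using \<delta>2 by linarith
  qed
  have C\<delta>: "C * \<delta>\<^sup>2 \<le> \<tau>"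
  proof -
    have "C * \<delta>\<^sup>2 \<le> C * \<delta>" using \<delta>sq C by (rule mult_left_mono)
    then show ?thesis using \<delta>1 \<delta> by (simp add: distrib_right)
  qed
  have ce: "x \<in> cball z (1/2)" if "x \<in> cball z e" for x using that e by simp
  have hc: "continuous_on UNIV h" using h by (simp add: resolvent_def)
  have fc: "continuous_on UNIV f" by (rule trig_continuous [OF f(1)])
  have cc: "continuous_on UNIV (\<lambda>y. k)" for k :: real by simp
  have cm: "continuous_on UNIV (\<lambda>y. k * w y)" if "continuous_on UNIV w" for k and w :: "real^'n \<Rightarrow> real"
    using that by (intro continuous_intros)
  have "mollify e (\<lambda>y. u y + (- (C * \<delta>\<^sup>2)) * 1) z \<le> mollify e h z"
  proof (rule mollify_mono [OF _ hc e(1)])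
    show "u y + (- (C * \<delta>\<^sup>2)) * 1 \<le> h y" if "y \<in> cball z e" for y using u_le [OF ce [OF that]] by simp
  qed (intro continuous_intros u)
  moreover have "mollify e (\<lambda>y. u y + (- (C * \<delta>\<^sup>2)) * 1) z = mollify e u z + (- (C * \<delta>\<^sup>2)) * I0"
    unfolding I0_def mollify_cmult [symmetric] by (rule mollify_add [OF u(1) cm [OF cc] e(1)])
  moreover have "mollify e f z \<le> mollify e (\<lambda>y. u y + (\<delta> * g y + \<delta>\<^sup>2 * 1)) z"
  proof (rule mollify_mono [OF fc _ e(1)])
    show "f y \<le> u y + (\<delta> * g y + \<delta>\<^sup>2 * 1)" if "y \<in> cball z e" for y
      using f_up [OF in_Q [OF ce [OF that], of y]] by simp
  qed (intro continuous_intros u g)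
  moreover have "mollify e (\<lambda>y. u y + (\<delta> * g y + \<delta>\<^sup>2 * 1)) z = mollify e u z + mollify e (\<lambda>y. \<delta> * g y + \<delta>\<^sup>2 * 1) z"
    by (rule mollify_add [OF u(1) _ e(1)]) (intro continuous_intros g)
  moreover have "mollify e (\<lambda>y. \<delta> * g y + \<delta>\<^sup>2 * 1) z = \<delta> * mollify e g z + \<delta>\<^sup>2 * I0"
    unfolding I0_def mollify_cmult [symmetric] by (rule mollify_add [OF cm [OF g] cm [OF cc] e(1)])
  moreover have "mollify e h z - \<delta> * (A \<bullet> D2mollify e h z) = mollify e f z"
    using h e unfolding resolvent_def by blast
  ultimately have "- (C * \<delta>\<^sup>2) * I0 - \<delta> * mollify e g z - \<delta>\<^sup>2 * I0 \<le> \<delta> * (A \<bullet> D2mollify e h z)"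
    by linarith
  \<comment> \<open>The terms in \<open>mollify e u z\<close> have cancelled, so the whole
    inequality carries a factor \<delta>; after division the errors are O(\<delta>).\<close>
  moreover have "- (C * \<delta>\<^sup>2) * I0 - \<delta> * mollify e g z - \<delta>\<^sup>2 * I0 = \<delta> * (- ((C + 1) * \<delta> * I0) - mollify e g z)"
    by (simp add: power2_eq_square algebra_simps)
  ultimately have "- ((C + 1) * \<delta> * I0) - mollify e g z \<le> A \<bullet> D2mollify e h z"
    using \<delta>(1) by simp
  moreover have "(C + 1) * \<delta> * I0 \<le> \<tau> * I0" using \<delta>1 I0 by (rule mult_right_mono)
  ultimately have 1: "- (A \<bullet> D2mollify e h z) \<le> mollify e g z + \<tau> * I0" by linarith
  have int1: "integrable lborel (\<lambda>y. 1 * (A \<bullet> D2rho e (y - z)))"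
    using inner_D2mollify(2) [OF cc e(1)] .
  \<comment> \<open>The second derivatives of \<open>h\<close> and \<open>u\<close> are compared
    through the kernel, so the bound |h - u| \<le> 2 \<tau> suffices.\<close>
  have "A \<bullet> D2mollify e h z - A \<bullet> D2mollify e u z
      = (\<integral>y. h y * (A \<bullet> D2rho e (y - z)) - u y * (A \<bullet> D2rho e (y - z)) \<partial>lborel)"
    using inner_D2mollify [OF hc e(1), of A z] inner_D2mollify [OF u(1) e(1), of A z] by simp
  also have "\<dots> \<le> (\<integral>y. 2 * \<tau> * \<bar>1 * (A \<bullet> D2rho e (y - z))\<bar> \<partial>lborel)"
  proof (rule integral_mono)
    show "integrable lborel (\<lambda>y. h y * (A \<bullet> D2rho e (y - z)) - u y * (A \<bullet> D2rho e (y - z)))"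
      by (intro Bochner_Integration.integrable_diff inner_D2mollify(2) hc u(1) e(1))
    show "integrable lborel (\<lambda>y. 2 * \<tau> * \<bar>1 * (A \<bullet> D2rho e (y - z))\<bar>)"
      by (intro integrable_mult_right integrable_abs int1)
    fix y
    show "h y * (A \<bullet> D2rho e (y - z)) - u y * (A \<bullet> D2rho e (y - z)) \<le> 2 * \<tau> * \<bar>1 * (A \<bullet> D2rho e (y - z))\<bar>"
    proof (cases "y \<in> cball z e")
      case True
      have "\<bar>h y - u y\<bar> \<le> 2 * \<tau>" using u_le [OF ce [OF True]] h_le [OF ce [OF True]] C\<delta> \<tau> by linarith
      then have "\<bar>h y - u y\<bar> * \<bar>A \<bullet> D2rho e (y - z)\<bar> \<le> 2 * \<tau> * \<bar>A \<bullet> D2rho e (y - z)\<bar>"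
        by (rule mult_right_mono) simp
      then have "(h y - u y) * (A \<bullet> D2rho e (y - z)) \<le> 2 * \<tau> * \<bar>A \<bullet> D2rho e (y - z)\<bar>"
        unfolding abs_mult [symmetric] by linarith
      then show ?thesis by (simp add: left_diff_distrib)
    next
      case False
      then have "e \<le> norm (y - z)" by (simp add: dist_norm norm_minus_commute)
      then show ?thesis by (simp add: rho_support(3) [OF e(1)])
    qed
  qed
  also have "\<dots> = 2 * \<tau> * I2" by (simp add: I2_def)
  finally have "- (A \<bullet> D2mollify e u z) \<le> mollify e g z + \<tau> * I0 + 2 * \<tau> * I2" using 1 by linarith
  moreover have "\<tau> * I0 + 2 * \<tau> * I2 \<le> \<tau> * (2 * I2 + I0 + 1)" using \<tau> by (simp add: algebra_simps)
  moreover have "\<tau> * (2 * I2 + I0 + 1) = \<epsilon>" using den by (simp add: \<tau>_def)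
  ultimately show "- (A \<bullet> D2mollify e u z) \<le> mollify e g z + \<epsilon>" by linarith
qed

end

section \<open>The difference of a supersolution and a subsolution\<close>

lemma powr_eq_powr_mult: "0 \<le> t \<Longrightarrow> t powr q = t powr (q - 1) * t" for t q :: real
proof (cases "t = 0")
  case False
  assume "0 \<le> t"
  with False have "t powr (q - 1) * t powr 1 = t powr q" by (simp only: powr_add [symmetric]) simp
  then show ?thesis using \<open>0 \<le> t\<close> by simp
qed simp

lemma signed_powr_continuous:
  assumes "1 \<le> q"
  shows "continuous_on UNIV (\<lambda>t::real. \<bar>t\<bar> powr (q - 1) * t)"
proof (cases "q = 1")
  \<comment> \<open>Here \<open>0 powr 0 = 0\<close> makes the first factor jump at the origin,
    although the product is just \<open>t\<close>.\<close>
  case True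
  have "(\<lambda>t::real. \<bar>t\<bar> powr (q - 1) * t) = (\<lambda>t. t)" by (rule ext) (simp add: True)
  then show ?thesis by (simp only: continuous_on_id)
next
  case False
  then show ?thesis using assms
    by (intro continuous_intros continuous_on_powr') auto
qed

lemma powr_superadditive:
  assumes "1 \<le> q" "0 \<le> y" "y \<le> x"
  shows "(x - y) powr q \<le> x powr q - y powr (q :: real)"
proof -
  have "(x - y) powr q = (x - y) powr (q - 1) * (x - y)" using assms by (intro powr_eq_powr_mult) simp
  also have "\<dots> \<le> x powr (q - 1) * (x - y)" using assms by (intro mult_right_mono powr_mono2) auto
  finally have "(x - y) powr q \<le> x powr (q - 1) * x - x powr (q - 1) * y" by (simp add: right_diff_distrib)
  moreover have "y powr (q - 1) * y \<le> x powr (q - 1) * y" using assms by (intro mult_right_mono powr_mono2) auto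
  ultimately show ?thesis using powr_eq_powr_mult [of x q] powr_eq_powr_mult [of y q] assms by linarith
qed

text \<open>For opposite signs the larger of \<open>a\<close> and \<open>- b\<close> is at least
  half of \<open>a - b\<close>. This case causes the factor 1/2, which becomes the constant 2^(-q)
  in the inequality for the difference.\<close>

lemma signed_powr_diff:
  fixes a b q :: real
  assumes q: "1 \<le> q" and ab: "b \<le> a"
  shows "((a - b) / 2) powr q \<le> \<bar>a\<bar> powr (q - 1) * a - \<bar>b\<bar> powr (q - 1) * b"
proof -
  have pos: "\<bar>t\<bar> powr (q - 1) * t = t powr q" if "0 \<le> t" for t
    using that powr_eq_powr_mult [of t q] by simp
  have neg: "\<bar>t\<bar> powr (q - 1) * t = - ((- t) powr q)" if "t \<le> 0" for t
    using that powr_eq_powr_mult [of "- t" q] by simp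
  have half: "((a - b) / 2) powr q \<le> (a - b) powr q" using ab q by (intro powr_mono2) auto
  consider "0 \<le> b" | "a \<le> 0" | "b \<le> 0" "0 \<le> a" by linarith
  then show ?thesis
  proof cases
    case 1
    then show ?thesis using half powr_superadditive [OF q 1 ab] pos [of a] pos [of b] ab by linarith
  next
    case 2
    then have "(- b - - a) powr q \<le> (- b) powr q - (- a) powr q" using q ab by (intro powr_superadditive) auto
    then show ?thesis using half neg [of a] neg [of b] 2 ab by simp
  next
    case 3
    have "((a - b) / 2) powr q \<le> a powr q + (- b) powr q"
    proof (cases "a - b \<le> 2 * a")
      case True
      have "((a - b) / 2) powr q \<le> a powr q" using True q ab by (intro powr_mono2) auto
      then show ?thesis by (simp add: add_increasing2)
    next
      case False
      have "((a - b) / 2) powr q \<le> (- b) powr q" using False q ab by (intro powr_mono2) auto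
      then show ?thesis by (simp add: add_increasing)
    qed
    then show ?thesis using pos [of a] neg [of b] 3 by simp
  qed
qed

text \<open>The normalising mass depends only on dimension and radius, hence the type argument in
  place of a centre.\<close>

definition rho_mass :: "'n::finite itself \<Rightarrow> real \<Rightarrow> real" where
  "rho_mass _ e = mollify e (\<lambda>_. 1) (0 :: real^'n)"

lemma mollify_const: "mollify e (\<lambda>_. c) (z :: real^'n) = c * rho_mass TYPE('n) e"
proof -
  have "(\<integral>y. rho e (y - z) \<partial>lborel) = (\<integral>y. rho e ((z + y) - z) \<partial>lborel)"
    by (rule lborel_integral_translate [symmetric], rule borel_measurable_continuous_onI)
      (intro rho_continuous continuous_intros)
  then show ?thesis by (simp add: mollify_def rho_mass_def)
qed

lemma rho_mass_pos:
  assumes "0 < e"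
  shows "0 < rho_mass TYPE('n::finite) e"
proof -
  define c where "c = (3 / 4 * e\<^sup>2) ^ 3"
  have c: "c > 0" using assms by (simp add: c_def)
  let ?B = "cball 0 (e / 2) :: (real^'n) set"
  have int: "integrable lborel (\<lambda>y. c * indicator ?B y)"
    using borel_integrable_compact [of ?B "\<lambda>_. 1 :: real"] by (intro integrable_mult_right) simp
  have int2: "integrable lborel (\<lambda>y::real^'n. 1 * rho e (y - 0))"
    by (rule rho_integrable(1) [OF _ assms]) simp
  have "0 < c * measure lborel ?B"
    using c content_cball_pos [of "e / 2" "0 :: real^'n"] assms by simp
  also have "\<dots> = (\<integral>y. c * indicator ?B y \<partial>lborel)" by simp
  also have "\<dots> \<le> (\<integral>y. 1 * rho e (y - (0 :: real^'n)) \<partial>lborel)"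
  proof (rule integral_mono [OF int int2])
    fix y :: "real^'n"
    show "c * indicator ?B y \<le> 1 * rho e (y - 0)"
    proof (cases "y \<in> ?B")
      case True
      then have "(norm y)\<^sup>2 \<le> (e / 2)\<^sup>2" by (intro power_mono) auto
      then have "3 / 4 * e\<^sup>2 \<le> e\<^sup>2 - y \<bullet> y"
        by (simp add: power2_norm_eq_inner power_divide)
      then have "3 / 4 * e\<^sup>2 \<le> max 0 (e\<^sup>2 - y \<bullet> y)" by (simp only: le_max_iff_disj simp_thms)
      then have "c \<le> rho e y" unfolding c_def rho_def by (rule power_mono) simp
      then show ?thesis using True by simp
    qed (simp add: rho_nonneg)
  qed
  finally show ?thesis by (simp add: rho_mass_def mollify_def)
qed

lemma mollify_approximation:
  fixes u :: "real^'n \<Rightarrow> real"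
  assumes u: "continuous_on UNIV u" and \<tau>: "0 < \<tau>"
  shows "\<exists>e0>0. \<forall>e. 0 < e \<longrightarrow> e < e0 \<longrightarrow>
    (\<forall>z\<in>cball x r. \<bar>mollify e u z / rho_mass TYPE('n) e - u z\<bar> \<le> \<tau>)"
proof -
  have "uniformly_continuous_on (cball x (r + 1)) u"
    by (intro compact_uniformly_continuous continuous_on_subset [OF u]) auto
  then obtain d where d: "d > 0"
    "\<And>y z. z \<in> cball x (r + 1) \<Longrightarrow> y \<in> cball x (r + 1) \<Longrightarrow> dist y z < d \<Longrightarrow> dist (u y) (u z) < \<tau>"
    unfolding uniformly_continuous_on_def using \<tau> by blast
  show ?thesis
  proof (intro exI [of _ "min 1 d"] conjI allI impI ballI)
    fix e z assume e: "0 < e" "e < min 1 d" and z: "z \<in> cball x r"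
    define Z where "Z = rho_mass TYPE('n) e"
    have Z: "Z > 0" unfolding Z_def by (rule rho_mass_pos [OF e(1)])
    have near: "\<bar>u y - u z\<bar> \<le> \<tau>" if y: "y \<in> cball z e" for y
    proof -
      have "dist x y \<le> dist x z + dist z y" by (rule dist_triangle)
      then have "y \<in> cball x (r + 1)" using y z e by simp
      moreover have "z \<in> cball x (r + 1)" using z by simp
      moreover have "dist y z < d" using y e by (simp add: dist_commute)
      ultimately have "dist (u y) (u z) < \<tau>" by (intro d)
      then show ?thesis by (simp add: dist_real_def)
    qed
    have "mollify e u z \<le> mollify e (\<lambda>_. u z + \<tau>) z"
      by (rule mollify_mono [OF u _ e(1)]) (use near in \<open>simp_all add: abs_le_iff algebra_simps\<close>)
    moreover have "mollify e (\<lambda>_. u z - \<tau>) z \<le> mollify e u z"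
      by (rule mollify_mono [OF _ u e(1)]) (use near in \<open>simp_all add: abs_le_iff algebra_simps\<close>)
    ultimately have "(u z - \<tau>) * Z \<le> mollify e u z" "mollify e u z \<le> (u z + \<tau>) * Z"
      by (simp_all only: mollify_const Z_def)
    then have "u z - \<tau> \<le> mollify e u z / Z" "mollify e u z / Z \<le> u z + \<tau>"
      using Z by (simp_all only: pos_le_divide_eq pos_divide_le_eq)
    then show "\<bar>mollify e u z / rho_mass TYPE('n) e - u z\<bar> \<le> \<tau>" unfolding Z_def by linarith
  qed (use d in auto)
qed

lemma jet2_isCont:
  fixes y :: "real^'a"
  assumes "jet2 f y p X"
  shows "isCont f y"
proof -
  have "\<forall>\<^sub>F d in nhds 0. norm (f (y + d) - f y) \<le> norm p * norm d + (norm X + 1) * (norm d)\<^sup>2"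
    using jet2_eventually [OF assms zero_less_one]
  proof eventually_elim
    case (elim d)
    have "\<bar>p \<bullet> d\<bar> \<le> norm p * norm d" by (rule Cauchy_Schwarz_ineq2)
    moreover have "\<bar>outer d \<bullet> X\<bar> \<le> (norm d)\<^sup>2 * norm X" using Cauchy_Schwarz_ineq2 [of "outer d" X] by (simp add: norm_outer)
    moreover have "(norm X + 1) * (norm d)\<^sup>2 = (norm d)\<^sup>2 * norm X + (norm d)\<^sup>2" by (simp add: algebra_simps)
    ultimately show ?case using elim unfolding real_norm_def by linarith
  qed
  then have ev: "\<forall>\<^sub>F d in at 0. norm (f (y + d) - f y) \<le> norm p * norm d + (norm X + 1) * (norm d)\<^sup>2"
    by (simp add: eventually_nhds_conv_at)
  have "((\<lambda>d::real^'a. norm p * norm d + (norm X + 1) * (norm d)\<^sup>2) \<longlongrightarrow> norm p * norm (0::real^'a) + (norm X + 1) * (norm (0::real^'a))\<^sup>2) (at 0)"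
    by (intro tendsto_intros)
  then have "((\<lambda>d. f (y + d) - f y) \<longlongrightarrow> 0) (at 0)"
    by (intro Lim_null_comparison [OF ev]) simp
  then show ?thesis unfolding isCont_iff by (rule LIM_zero_cancel)
qed

text \<open>The operator is convex, so \<open>u\<close> is a subsolution of a family of linear equations with constant
  coefficients and can be replaced by its mollifications, which are admissible test functions for \<open>v\<close>.\<close>
lemma supersol_minus_subsol:
  fixes u v :: "real^'n \<Rightarrow> real"
  assumes lam: "0 < lam" "lam \<le> Lam" and q: "1 \<le> q"
    and u: "viscosity_subsol (pucci_eq lam Lam q) u" and v: "viscosity_supersol (pucci_eq lam Lam q) v"
    and jet: "jet2 \<phi> x p X" and min: "\<forall>\<^sub>F y in nhds x. v x - u x - \<phi> x \<le> v y - u y - \<phi> y"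
  shows "\<bar>v x\<bar> powr (q - 1) * v x - \<bar>u x\<bar> powr (q - 1) * u x \<le> pucci_max lam Lam X"
proof (rule field_le_epsilon)
  fix \<epsilon> :: real assume \<epsilon>: "\<epsilon> > 0"
  define F where "F t = \<bar>t\<bar> powr (q - 1) * t" for t :: real
  define g where "g y = F (u y)" for y
  have uc: "continuous_on UNIV u" and vc: "continuous_on UNIV v"
    using u v by (simp_all add: viscosity_subsol_def viscosity_supersol_def)
  have Fc: "continuous_on UNIV F" unfolding F_def by (rule signed_powr_continuous [OF q])
  have gc: "continuous_on UNIV g" unfolding g_def by (rule continuous_on_compose2 [OF Fc uc]) simp
  have Fvc: "continuous_on UNIV (\<lambda>y. F (v y))" by (rule continuous_on_compose2 [OF Fc vc]) simp
  \<comment> \<open>The Hessian is lowered by \<open>4 * k\<close>, hence the polynomial by 2k|y -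
    x|^2: one half absorbs the Taylor error, the other makes the minimum strict. The cost is
    \<epsilon>/3.\<close>
  define k where "k = \<epsilon> / 3 / (4 * (Lam * real CARD('n)))"
  have k: "k > 0" using \<epsilon> lam by (simp add: k_def)
  have kLam: "4 * k * (Lam * real CARD('n)) = \<epsilon> / 3" using lam by (simp add: k_def)
  define Y where "Y = X + (- ((4 * k) *\<^sub>R mat 1))"
  have Ysym: "transpose Y = Y" using jet by (simp add: Y_def jet2_def transpose_linear)
  define P where "P y = \<phi> x + p \<bullet> (y - x) + outer (y - x) \<bullet> Y / 2" for y
  have "\<forall>\<^sub>F d in nhds 0. P (x + d) + k * (norm d)\<^sup>2 \<le> \<phi> (x + d)"
    using jet2_eventually [OF jet k]
  proof eventually_elim
    case (elim d)
    have "P (x + d) = \<phi> x + p \<bullet> d + outer d \<bullet> X / 2 - 2 * (k * (norm d)\<^sup>2)"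
      by (simp add: P_def Y_def inner_diff_right outer_inner_mat power2_norm_eq_inner diff_divide_distrib)
    then show ?case using elim by linarith
  qed
  then have "\<forall>\<^sub>F y in nhds x. P y + k * (norm (y - x))\<^sup>2 \<le> \<phi> y"
    by (simp add: eventually_nhds_shift [of _ x])
  with min have "\<forall>\<^sub>F y in nhds x. v x - u x - P x + k * (norm (y - x))\<^sup>2 \<le> v y - u y - P y"
    by eventually_elim (simp add: P_def)
  then obtain r1 where r1: "r1 > 0"
    "\<And>y. dist y x < r1 \<Longrightarrow> v x - u x - P x + k * (norm (y - x))\<^sup>2 \<le> v y - u y - P y"
    unfolding eventually_nhds_metric by blast
  have e3: "\<epsilon> / 3 > 0" using \<epsilon> by simp
  obtain r2 where r2: "r2 > 0" "\<And>y. dist y x < r2 \<Longrightarrow> dist (g y) (g x) < \<epsilon> / 3"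
    using gc e3 unfolding continuous_on_iff by (metis UNIV_I)
  obtain r3 where r3: "r3 > 0" "\<And>y. dist y x < r3 \<Longrightarrow> dist (F (v y)) (F (v x)) < \<epsilon> / 3"
    using Fvc e3 unfolding continuous_on_iff by (metis UNIV_I)
  define r where "r = min (min r1 r3) r2 / 2"
  have r: "r > 0" "r < r1" "2 * r \<le> r2" "r < r3" using r1(1) r2(1) r3(1) by (auto simp: r_def)
  \<comment> \<open>Replacing \<open>u\<close> by \<open>U\<close> changes differences by at most 2
    \<tau> < k r^2, so the strict minimum cannot move to the sphere of radius
    \<open>r\<close>.\<close>
  define \<tau> where "\<tau> = k * r\<^sup>2 / 3"
  have \<tau>: "\<tau> > 0" using k r by (simp add: \<tau>_def)
  obtain e0 where e0: "e0 > 0" "\<And>e z. 0 < e \<Longrightarrow> e < e0 \<Longrightarrow> z \<in> cball x r \<Longrightarrow>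
      \<bar>mollify e u z / rho_mass TYPE('n) e - u z\<bar> \<le> \<tau>"
    using mollify_approximation [OF uc \<tau>] by blast
  define e where "e = min (min (e0 / 2) (1/2)) (r / 2)"
  have e: "0 < e" "e < e0" "e \<le> 1/2" "e < r" using e0(1) r by (auto simp: e_def)
  define Z where "Z = rho_mass TYPE('n) e"
  have Z: "Z > 0" unfolding Z_def by (rule rho_mass_pos [OF e(1)])
  define U where "U y = (1 / Z) * mollify e u y" for y
  have U: "\<bar>U y - u y\<bar> \<le> \<tau>" if "y \<in> cball x r" for y
    using e0(2) [OF e(1,2) that] by (simp add: U_def Z_def)
  have jU: "\<exists>p'. jet2 U y p' ((1 / Z) *\<^sub>R D2mollify e u y)" for y
    unfolding U_def using jet2_cmult [OF mollify_jet2 [OF uc e(1)]] by blast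
  have jP: "jet2 P y (p + Y *v (y - x)) Y" for y
  proof (rule jet2_quadratic [OF Ysym])
    fix d
    have "P (y + d) = \<phi> x + p \<bullet> ((y - x) + d) + outer ((y - x) + d) \<bullet> Y / 2" by (simp add: P_def algebra_simps)
    also have "outer ((y - x) + d) \<bullet> Y = outer (y - x) \<bullet> Y + 2 * (d \<bullet> (Y *v (y - x))) + outer d \<bullet> Y"
      by (rule outer_add_inner [OF Ysym])
    finally show "P (y + d) = P y + (p + Y *v (y - x)) \<bullet> d + outer d \<bullet> Y / 2"
      by (simp add: P_def inner_add_left inner_add_right add_divide_distrib inner_commute [of d "Y *v (y - x)"])
  qed
  have UP: "continuous_on (cball x r) (\<lambda>y. v y - (U y + P y))"
  proof -
    have "isCont U y" "isCont P y" for y using jet2_isCont jU jP by blast+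
    then have "continuous_on (cball x r) U" "continuous_on (cball x r) P"
      by (simp_all add: continuous_at_imp_continuous_on)
    then show ?thesis by (intro continuous_intros continuous_on_subset [OF vc]) auto
  qed
  then obtain y where y: "y \<in> cball x r" "\<And>y'. y' \<in> cball x r \<Longrightarrow> v y - (U y + P y) \<le> v y' - (U y' + P y')"
    using continuous_attains_inf [of "cball x r" "\<lambda>y. v y - (U y + P y)"] r by auto
  have "dist y x \<noteq> r"
  proof
    assume d: "dist y x = r"
    have "v x - u x - P x + k * r\<^sup>2 \<le> v y - u y - P y" using r1(2) [of y] r d by (simp add: dist_norm)
    moreover have "v y - (U y + P y) \<le> v x - (U x + P x)" using r by (intro y) simp
    moreover have "x \<in> cball x r" using r by simp
    ultimately show False using U [OF y(1)] U [of x] \<tau> unfolding \<tau>_def by linarith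
  qed
  then have yb: "y \<in> ball x r" using y(1) by (simp add: dist_commute)
  then have "\<forall>\<^sub>F y' in nhds y. y' \<in> ball x r" by (intro eventually_nhds_in_open) auto
  then have ymin: "\<forall>\<^sub>F y' in nhds y. v y - (U y + P y) \<le> v y' - (U y' + P y')"
    by eventually_elim (simp add: y)
  obtain p' where "jet2 U y p' ((1 / Z) *\<^sub>R D2mollify e u y)" using jU by blast
  then have "jet2 (\<lambda>y. U y + P y) y (p' + (p + Y *v (y - x))) ((1 / Z) *\<^sub>R D2mollify e u y + Y)"
    by (rule jet2_add [OF _ jP])
  from supersol_jet2 [OF lam v this ymin]
  have "F (v y) \<le> pucci_max lam Lam ((1 / Z) *\<^sub>R D2mollify e u y + Y)" by (simp add: F_def)
  also have "\<dots> \<le> pucci_max lam Lam ((1 / Z) *\<^sub>R D2mollify e u y) + pucci_max lam Lam Y"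
    by (rule pucci_add_le [OF lam(1) lam(2)])
  also have "pucci_max lam Lam Y \<le> pucci_max lam Lam X + pucci_max lam Lam (- ((4 * k) *\<^sub>R mat 1) :: real^'n^'n)"
    unfolding Y_def by (rule pucci_add_le [OF lam(1) lam(2)])
  also have "pucci_max lam Lam (- ((4 * k) *\<^sub>R mat 1) :: real^'n^'n) \<le> \<epsilon> / 3"
    using pucci_scalar_le [OF lam(1) lam(2), of "4 * k", where 'n = 'n] k kLam by simp
  \<comment> \<open>The smooth function \<open>U\<close> is the same for every \<open>A\<close>, so
    the linear inequalities can be recombined into one for the supremum.\<close>
  also have "pucci_max lam Lam ((1 / Z) *\<^sub>R D2mollify e u y) \<le> g x + \<epsilon> / 3"
  proof (rule pucci_least [OF lam(1) lam(2)])
    fix A :: "real^'n^'n" assume A: "adm lam Lam A"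
    have "linear_sub A g u" unfolding linear_sub_def [OF lam(1) A] g_def F_def
      using subsol_jet2 [OF lam u A] by blast
    then have "- (A \<bullet> D2mollify e u y) \<le> mollify e g y"
      by (rule linear_sub_mollify [OF lam(1) A uc _ gc e(1) e(3)])
    also have "\<dots> \<le> mollify e (\<lambda>_. g x + \<epsilon> / 3) y"
    proof (rule mollify_mono [OF gc _ e(1)])
      fix y' assume "y' \<in> cball y e"
      then have "dist y' x < r2" using dist_triangle [of y' x y] yb e r by (simp add: dist_commute)
      then show "g y' \<le> g x + \<epsilon> / 3" using r2(2) [of y'] unfolding dist_real_def by linarith
    qed simp
    also have "\<dots> = (g x + \<epsilon> / 3) * Z" by (simp only: mollify_const Z_def)
    finally have "- (A \<bullet> D2mollify e u y) / Z \<le> g x + \<epsilon> / 3" using Z by (simp only: pos_divide_le_eq)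
    then show "- (A \<bullet> ((1 / Z) *\<^sub>R D2mollify e u y)) \<le> g x + \<epsilon> / 3" by simp
  qed
  finally have "F (v y) \<le> g x + \<epsilon> / 3 + (pucci_max lam Lam X + \<epsilon> / 3)" by simp
  moreover have "F (v x) - \<epsilon> / 3 \<le> F (v y)" 
  proof -
    have "dist y x < r3" using yb r by (simp add: dist_commute)
    from r3(2) [OF this] show ?thesis unfolding dist_real_def by linarith
  qed
  ultimately have "F (v x) - g x \<le> pucci_max lam Lam X + \<epsilon>" by linarith
  then show "\<bar>v x\<bar> powr (q - 1) * v x - \<bar>u x\<bar> powr (q - 1) * u x \<le> pucci_max lam Lam X + \<epsilon>"
    by (simp add: F_def g_def)
qed

section \<open>A Liouville theorem\<close>

lemma powr_ln_tendsto_zero: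
  assumes "0 < b"
  shows "((\<lambda>s::real. s powr (- b) * ln s) \<longlongrightarrow> 0) at_top"
proof (rule tendsto_sandwich [where f = "\<lambda>_. 0" and h = "\<lambda>s. 2 / b * s powr (- (b / 2))"])
  have ev: "\<forall>\<^sub>F s in at_top. 1 \<le> (s::real)" by (rule eventually_ge_at_top)
  then show "\<forall>\<^sub>F s in at_top. 0 \<le> s powr (- b) * ln (s::real)" by eventually_elim simp
  from ev show "\<forall>\<^sub>F s in at_top. s powr (- b) * ln s \<le> 2 / b * s powr (- (b / 2))"
  proof eventually_elim
    case (elim s)
    have "ln s \<le> s powr (b / 2) / (b / 2)" using elim assms by (intro ln_powr_bound) auto
    then have "s powr (- b) * ln s \<le> s powr (- b) * (s powr (b / 2) / (b / 2))" by (rule mult_left_mono) simp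
    also have "\<dots> = 2 / b * (s powr (- b) * s powr (b / 2))" by simp
    also have "s powr (- b) * s powr (b / 2) = s powr (- (b / 2))" unfolding powr_add [symmetric] by simp
    finally show ?case .
  qed
  have "((\<lambda>s::real. s powr (- (b / 2))) \<longlongrightarrow> 0) at_top"
    by (rule tendsto_neg_powr) (use assms in \<open>auto intro: filterlim_ident\<close>)
  then show "((\<lambda>s. 2 / b * s powr (- (b / 2))) \<longlongrightarrow> 0) at_top" by (rule tendsto_mult_right_zero)
qed simp

text \<open>Beyond \<open>exp (1 / b)\<close> the derivative is nonpositive. This carries the lower
  bound from an interior point of a ball to the radius of the ball.\<close>

lemma powr_ln_antimono:
  fixes b s t :: real
  assumes b: "0 < b" and t: "exp (1 / b) \<le> t" "t \<le> s"
  shows "s powr (- b) * ln s \<le> t powr (- b) * ln t"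
proof (rule DERIV_nonpos_imp_nonincreasing [OF t(2)])
  fix x assume x: "t \<le> x" "x \<le> s"
  have "0 < exp (1 / b)" by simp
  then have x0: "x > 0" using t x by linarith
  have "exp (1 / b) \<le> x" using t x by linarith
  then have "1 / b \<le> ln x" using x0 ln_le_cancel_iff [of "exp (1 / b)" x] by simp
  then have bl: "1 \<le> b * ln x" using b by (simp add: pos_divide_le_eq mult.commute)
  have "((\<lambda>s. s powr (- b) * ln s) has_real_derivative (- b * x powr (- b - 1)) * ln x + inverse x * x powr (- b)) (at x)"
    by (intro DERIV_mult has_real_derivative_powr DERIV_ln x0)
  moreover have "(- b * x powr (- b - 1)) * ln x + inverse x * x powr (- b) = x powr (- b - 1) * (1 - b * ln x)"
  proof -
    have "x powr (- b) = x powr (- b - 1) * x" using x0 powr_add [of x "- b - 1" 1] by simp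
    then have "inverse x * x powr (- b) = x powr (- b - 1)" using x0 by simp
    then show ?thesis by (simp add: algebra_simps)
  qed
  moreover have "x powr (- b - 1) * (1 - b * ln x) \<le> 0" using bl by (simp add: mult_nonneg_nonpos)
  ultimately show "\<exists>y. ((\<lambda>s. s powr (- b) * ln s) has_real_derivative y) (at x) \<and> y \<le> 0" by metis
qed

lemma mem_cball_sqrt: "x \<in> cball z (sqrt R) \<longleftrightarrow> (x - z) \<bullet> (x - z) \<le> R"
proof -
  have "dist z x = sqrt ((x - z) \<bullet> (x - z))" by (metis dist_commute dist_norm norm_eq_sqrt_inner)
  then show ?thesis by (simp only: mem_cball real_sqrt_le_iff)
qed

text \<open>The matrix has radial eigenvalue \<open>2 * a + 4 * (x \<bullet> x) * b\<close> and
  tangential eigenvalue \<open>2 * a\<close>. With these signs the worst \<open>A\<close> has the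
  smallest weight \<open>lam\<close> radially and the largest total weight
  \<open>Lam * (N - 1) = lam * (\<alpha> + 1)\<close> tangentially.\<close>

lemma pucci_radial_le:
  fixes x :: "real^'n"
  assumes lam: "0 < lam" "lam \<le> Lam" and \<alpha>: "Lam * (real CARD('n) - 1) = lam * (\<alpha> + 1)"
    and x: "x \<bullet> x > 0" and a: "a \<le> 0" and ab: "0 \<le> 2 * a + 4 * (x \<bullet> x) * b"
  shows "pucci_max lam Lam ((2 * a) *\<^sub>R mat 1 + (4 * b) *\<^sub>R outer x)
    \<le> - lam * (2 * (\<alpha> + 2) * a + 4 * (x \<bullet> x) * b)"
proof (rule pucci_least [OF lam])
  fix A :: "real^'n^'n" assume A: "adm lam Lam A"
  define s where "s = x \<bullet> x"
  define T where "T = A \<bullet> mat 1"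
  define P where "P = A \<bullet> outer x / s"
  have s: "s > 0" using x by (simp add: s_def)
  have sP: "A \<bullet> outer x = s * P" using s by (simp add: P_def)
  have "s * (T - P) \<le> s * (lam * (\<alpha> + 1))"
    using adm_trace_minus_outer [OF lam(1) A, of x]
    unfolding \<alpha> s_def [symmetric] T_def [symmetric] sP by (simp add: right_diff_distrib mult.commute)
  then have TP: "T - P \<le> lam * (\<alpha> + 1)" using s by simp
  have "s * lam \<le> s * P" using adm_lower [OF A, of x] sP by (simp add: s_def mult.commute)
  then have P: "lam \<le> P" using s by simp
  have "(- 2 * a) * (T - P) \<le> (- 2 * a) * (lam * (\<alpha> + 1))" using TP a by (intro mult_left_mono) auto
  moreover have "(2 * a + 4 * s * b) * lam \<le> (2 * a + 4 * s * b) * P" using P ab by (intro mult_left_mono) (auto simp: s_def)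
  moreover have "- (A \<bullet> ((2 * a) *\<^sub>R mat 1 + (4 * b) *\<^sub>R outer x)) = (- 2 * a) * (T - P) - (2 * a + 4 * s * b) * P"
    by (simp add: inner_add_right T_def [symmetric] sP algebra_simps)
  moreover have "- lam * (2 * (\<alpha> + 2) * a + 4 * s * b) = (- 2 * a) * (lam * (\<alpha> + 1)) - (2 * a + 4 * s * b) * lam"
    by (simp add: algebra_simps)
  ultimately show "- (A \<bullet> ((2 * a) *\<^sub>R mat 1 + (4 * b) *\<^sub>R outer x)) \<le> - lam * (2 * (\<alpha> + 2) * a + 4 * (x \<bullet> x) * b)"
    unfolding s_def by linarith
qed

section \<open>Barriers and minima over balls for nonnegative supersolutions\<close>

context
  fixes lam Lam \<alpha> c q :: real and w :: "real^'n \<Rightarrow> real" and z :: "real^'n"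
  assumes lam: "0 < lam" "lam \<le> Lam" and \<alpha>: "Lam * (real CARD('n) - 1) = lam * (\<alpha> + 1)" "0 < \<alpha>"
    and c: "0 < c"
    and w: "continuous_on UNIV w" "\<And>x. 0 \<le> w x"
    and super: "\<And>\<phi> x p X. jet2 \<phi> x p X \<Longrightarrow> \<forall>\<^sub>F y in nhds x. w x - \<phi> x \<le> w y - \<phi> y \<Longrightarrow>
       c * w x powr q \<le> pucci_max lam Lam X"
begin

text \<open>A negative minimum of the difference on a large annulus cannot lie on the inner sphere,
  nor on the outer one, where \<open>f\<close> is tiny and \<open>w\<close> is nonnegative. At an
  interior minimum the strict inequality contradicts the supersolution property.\<close>

lemma annulus_comparison:
  assumes s0: "0 < s0" and boundary: "\<And>x. (x - z) \<bullet> (x - z) = s0 \<Longrightarrow> f s0 \<le> w x"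
    and lim: "(f \<longlongrightarrow> 0) at_top"
    and df: "\<And>s. s > 0 \<Longrightarrow> (f has_real_derivative f' s) (at s)"
    and df': "\<And>s. s > 0 \<Longrightarrow> (f' has_real_derivative f'' s) (at s)"
    and sign: "\<And>s. s0 < s \<Longrightarrow> f' s \<le> 0" "\<And>s. s0 < s \<Longrightarrow> 0 \<le> 2 * f' s + 4 * s * f'' s"
    and strict: "\<And>x s. s = (x - z) \<bullet> (x - z) \<Longrightarrow> s0 < s \<Longrightarrow>
       - lam * (2 * (\<alpha> + 2) * f' s + 4 * s * f'' s) < c * w x powr q"
    and x: "s0 \<le> (x - z) \<bullet> (x - z)"
  shows "f ((x - z) \<bullet> (x - z)) \<le> w x"
proof (rule ccontr)
  assume "\<not> ?thesis"
  then have neg: "w x < f ((x - z) \<bullet> (x - z))" by simp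
  define \<eta> where "\<eta> = f ((x - z) \<bullet> (x - z)) - w x"
  have "\<eta> > 0" using neg by (simp add: \<eta>_def)
  then have "\<forall>\<^sub>F s in at_top. \<bar>f s\<bar> < \<eta>" using lim unfolding tendsto_iff by simp
  then obtain S where S: "\<And>s. s \<ge> S \<Longrightarrow> \<bar>f s\<bar> < \<eta>" unfolding eventually_at_top_linorder by blast
  define R where "R = max (max S (s0 + 1)) ((x - z) \<bullet> (x - z) + 1)"
  define K where "K = {y. s0 \<le> (y - z) \<bullet> (y - z) \<and> (y - z) \<bullet> (y - z) \<le> R}"
  have R: "S \<le> R" "s0 < R" "(x - z) \<bullet> (x - z) < R" by (auto simp: R_def)
  have mem: "y \<in> cball z (sqrt R) \<longleftrightarrow> (y - z) \<bullet> (y - z) \<le> R" for y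
    by (rule mem_cball_sqrt)
  have "closed K" unfolding K_def by (intro closed_Collect_conj closed_Collect_le continuous_intros)
  moreover have "K \<subseteq> cball z (sqrt R)" using mem by (auto simp: K_def)
  ultimately have "compact K" using bounded_subset [OF bounded_cball] by (auto simp: compact_eq_bounded_closed)
  moreover have fcont: "isCont f s" if "s > 0" for s using df [OF that] by (rule DERIV_isCont)
  have "continuous_on {0<..} f" by (rule continuous_at_imp_continuous_on) (use fcont in simp)
  then have "continuous_on K (\<lambda>y. f ((y - z) \<bullet> (y - z)))"
    by (rule continuous_on_compose2) (use s0 in \<open>auto simp: K_def intro!: continuous_intros\<close>)
  then have "continuous_on K (\<lambda>y. w y - f ((y - z) \<bullet> (y - z)))"
    by (intro continuous_on_diff continuous_on_subset [OF w(1)]) auto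
  moreover have xK: "x \<in> K" using x R by (simp add: K_def)
  ultimately obtain y where y: "y \<in> K" "\<And>y'. y' \<in> K \<Longrightarrow> w y - f ((y - z) \<bullet> (y - z)) \<le> w y' - f ((y' - z) \<bullet> (y' - z))"
    using continuous_attains_inf [of K "\<lambda>y. w y - f ((y - z) \<bullet> (y - z))"] by blast
  define s where "s = (y - z) \<bullet> (y - z)"
  have val: "w y - f s \<le> - \<eta>" using y(2) [OF xK] by (simp add: s_def \<eta>_def)
  have "s \<noteq> s0" using boundary [of y] val \<open>\<eta> > 0\<close> by (auto simp: s_def)
  moreover have "s \<noteq> R" using S [of s] R val w(2) [of y] by auto
  ultimately have s: "s0 < s" "s < R" using y(1) by (auto simp: K_def s_def)
  have "open {y. s0 < (y - z) \<bullet> (y - z) \<and> (y - z) \<bullet> (y - z) < R}"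
    by (intro open_Collect_conj open_Collect_less continuous_intros)
  then have "\<forall>\<^sub>F y' in nhds y. y' \<in> {y. s0 < (y - z) \<bullet> (y - z) \<and> (y - z) \<bullet> (y - z) < R}"
    by (rule eventually_nhds_in_open) (use s in \<open>simp add: s_def\<close>)
  then have min: "\<forall>\<^sub>F y' in nhds y. w y - f ((y - z) \<bullet> (y - z)) \<le> w y' - f ((y' - z) \<bullet> (y' - z))"
    by eventually_elim (rule y, simp add: K_def)
  have "\<forall>\<^sub>F t in nhds s. t \<in> {0<..}" by (rule eventually_nhds_in_open) (use s s0 in auto)
  then have d1: "\<forall>\<^sub>F t in nhds s. (f has_real_derivative f' t) (at t)"
    by eventually_elim (simp add: df)
  have d2: "(f' has_real_derivative f'' s) (at s)" using s s0 by (intro df') simp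
  have jet: "jet2 (\<lambda>y. f ((y - z) \<bullet> (y - z))) y (f' s *\<^sub>R 2 *\<^sub>R (y - z)) ((2 * f' s) *\<^sub>R mat 1 + (4 * f'' s) *\<^sub>R outer (y - z))"
    using jet2_radial [OF d1 [unfolded s_def] d2 [unfolded s_def]] unfolding s_def .
  have "c * w y powr q \<le> pucci_max lam Lam ((2 * f' s) *\<^sub>R mat 1 + (4 * f'' s) *\<^sub>R outer (y - z))"
    by (rule super [OF jet min])
  also have "\<dots> \<le> - lam * (2 * (\<alpha> + 2) * f' s + 4 * s * f'' s)"
    unfolding s_def by (rule pucci_radial_le [OF lam \<alpha>(1)]) (use s s0 sign in \<open>auto simp: s_def\<close>)
  finally show False using strict [of s y] s by (simp add: s_def)
qed

text \<open>For \<open>\<beta> > \<alpha>\<close> the operator is strictly negative on the power,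
  which gives the strictness required by the comparison even where \<open>w\<close>
  vanishes.\<close>

lemma power_decay_lower_strict:
  assumes s0: "0 < s0" and m: "0 < m" and boundary: "\<And>x. (x - z) \<bullet> (x - z) = s0 \<Longrightarrow> m \<le> w x"
    and \<beta>: "\<alpha> < \<beta>" and x: "s0 \<le> (x - z) \<bullet> (x - z)"
  shows "m * (s0 / ((x - z) \<bullet> (x - z))) powr (\<beta> / 2) \<le> w x"
proof -
  define b where "b = \<beta> / 2"
  have b: "b > 0" "2 * b - \<alpha> > 0" using \<beta> \<alpha> by (simp_all add: b_def)
  define \<kappa> where "\<kappa> = m * s0 powr b"
  have \<kappa>: "\<kappa> > 0" using m s0 by (simp add: \<kappa>_def)
  define f where "f s = \<kappa> * s powr (- b)" for s
  define f' where "f' s = \<kappa> * ((- b) * s powr (- b - 1))" for s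
  define f'' where "f'' s = \<kappa> * ((- b) * ((- b - 1) * s powr (- b - 1 - 1)))" for s
  have sf'': "s * f'' s = \<kappa> * ((- b) * ((- b - 1) * s powr (- b - 1)))" if "s > 0" for s
  proof -
    have "s powr (- b - 1) = s powr 1 * s powr (- b - 1 - 1)" unfolding powr_add [symmetric]
      by (rule arg_cong [where f = "\<lambda>t. s powr t"]) simp
    then show ?thesis using that by (simp add: f''_def)
  qed
  have f_eq: "f s = m * (s0 / s) powr (\<beta> / 2)" if "s > 0" for s
  proof -
    have "(s0 / s) powr b = s0 powr b * s powr (- b)"
      using that s0 by (simp add: powr_divide powr_minus_divide)
    then show ?thesis by (simp add: f_def \<kappa>_def b_def)
  qed
  have "f ((x - z) \<bullet> (x - z)) \<le> w x"
  proof (rule annulus_comparison [OF s0 _ _ _ _ _ _ _ x, where f' = f' and f'' = f''])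
    show "f s0 \<le> w y" if "(y - z) \<bullet> (y - z) = s0" for y
      using boundary [OF that] f_eq [OF s0] s0 by simp
    have "((\<lambda>s::real. s powr (- b)) \<longlongrightarrow> 0) at_top"
      by (rule tendsto_neg_powr) (use b in \<open>auto intro: filterlim_ident\<close>)
    then show "(f \<longlongrightarrow> 0) at_top" unfolding f_def by (rule tendsto_mult_right_zero)
    show "(f has_real_derivative f' s) (at s)" if "s > 0" for s
      unfolding f_def f'_def using that by (intro DERIV_cmult has_real_derivative_powr)
    show "(f' has_real_derivative f'' s) (at s)" if "s > 0" for s
      unfolding f'_def f''_def using that by (intro DERIV_cmult has_real_derivative_powr)
    have s4: "4 * s * f'' s = 4 * (s * f'' s)" for s by simp
    have id1: "2 * (\<kappa> * ((- b) * P)) + 4 * (\<kappa> * ((- b) * ((- b - 1) * P))) = \<kappa> * (2 * b * (2 * b + 1)) * P" for P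
      by (simp add: algebra_simps)
    have id2: "2 * (\<alpha> + 2) * (\<kappa> * ((- b) * P)) + 4 * (\<kappa> * ((- b) * ((- b - 1) * P))) = \<kappa> * (2 * b * (2 * b - \<alpha>)) * P" for P
      by (simp add: algebra_simps)
    have eq1: "2 * f' s + 4 * s * f'' s = \<kappa> * (2 * b * (2 * b + 1)) * s powr (- b - 1)" if "s > 0" for s
      unfolding s4 sf'' [OF that] f'_def by (rule id1)
    have eq2: "2 * (\<alpha> + 2) * f' s + 4 * s * f'' s = \<kappa> * (2 * b * (2 * b - \<alpha>)) * s powr (- b - 1)" if "s > 0" for s
      unfolding s4 sf'' [OF that] f'_def by (rule id2)
    show "f' s \<le> 0" if "s0 < s" for s
      using \<kappa> b by (simp add: f'_def)
    show "0 \<le> 2 * f' s + 4 * s * f'' s" if "s0 < s" for s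
    proof -
      have "s > 0" using that s0 by simp
      then show ?thesis unfolding eq1 [OF \<open>s > 0\<close>] using \<kappa> b by simp
    qed
    show "- lam * (2 * (\<alpha> + 2) * f' s + 4 * s * f'' s) < c * w y powr q" if "s0 < s" for y s
    proof -
      have s: "s > 0" using that s0 by simp
      have "0 < lam * (\<kappa> * (2 * b * (2 * b - \<alpha>)) * s powr (- b - 1))"
        using lam \<kappa> b s by (intro mult_pos_pos) auto
      moreover have "0 \<le> c * w y powr q" using c by simp
      ultimately show ?thesis unfolding eq2 [OF s] by linarith
    qed
  qed
  moreover have "(x - z) \<bullet> (x - z) > 0" using s0 x by linarith
  ultimately show ?thesis by (simp only: f_eq)
qed

text \<open>At the exponent \<alpha> itself the power only solves the equation with zero right side,
  so the bound is obtained as a limit of strictly faster decays.\<close>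

lemma power_decay_lower:
  assumes "0 < s0" "0 < m" "\<And>x. (x - z) \<bullet> (x - z) = s0 \<Longrightarrow> m \<le> w x" "s0 \<le> (x - z) \<bullet> (x - z)"
  shows "m * (s0 / ((x - z) \<bullet> (x - z))) powr (\<alpha> / 2) \<le> w x"
proof (rule tendsto_upperbound [where F = "at_right \<alpha>"])
  let ?t = "s0 / ((x - z) \<bullet> (x - z))"
  have "(x - z) \<bullet> (x - z) > 0" using assms(1,4) by linarith
  then have "?t \<noteq> 0" using assms(1) by simp
  then show "((\<lambda>\<beta>. m * ?t powr (\<beta> / 2)) \<longlongrightarrow> m * ?t powr (\<alpha> / 2)) (at_right \<alpha>)"
    by (rule tendsto_mult [OF tendsto_const tendsto_powr [OF tendsto_const tendsto_divide [OF tendsto_ident_at tendsto_const]], rotated]) simp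
  have "\<forall>\<^sub>F \<beta> in at_right \<alpha>. \<alpha> < \<beta>" by (rule eventually_at_right_less)
  then show "\<forall>\<^sub>F \<beta> in at_right \<alpha>. m * ?t powr (\<beta> / 2) \<le> w x"
    by eventually_elim (rule power_decay_lower_strict [OF assms(1,2,3) _ assms(4)])
qed simp

lemma minimum_on_ball:
  assumes "0 \<le> R"
  obtains y where "(y - z) \<bullet> (y - z) \<le> R" "\<And>x. (x - z) \<bullet> (x - z) \<le> R \<Longrightarrow> w y \<le> w x"
proof -
  have mem: "x \<in> cball z (sqrt R) \<longleftrightarrow> (x - z) \<bullet> (x - z) \<le> R" for x
    by (rule mem_cball_sqrt)
  have "cball z (sqrt R) \<noteq> {}" using assms by simp
  moreover have "continuous_on (cball z (sqrt R)) w" by (rule continuous_on_subset [OF w(1)]) simp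
  ultimately obtain y where y: "y \<in> cball z (sqrt R)" "\<forall>x\<in>cball z (sqrt R). w y \<le> w x"
    using continuous_attains_inf [OF compact_cball] by metis
  show ?thesis
  proof (rule that)
    show "(y - z) \<bullet> (y - z) \<le> R" using y(1) mem by simp
    show "w y \<le> w x" if "(x - z) \<bullet> (x - z) \<le> R" for x using y(2) mem that by simp
  qed
qed

text \<open>\<open>R\<close> is a squared radius. The touching point of the paraboloid may lie
  outside the ball over which \<open>w y\<close> is the minimum; the power barrier then gives back
  at least the fraction \<open>4 powr (- \<alpha> / 2)\<close> of that minimum.\<close>

lemma minimum_upper:
  assumes R: "0 < R" and pos: "\<And>x. 0 < w x" and q: "1 \<le> q"
    and y: "(y - z) \<bullet> (y - z) \<le> R" "\<And>x. (x - z) \<bullet> (x - z) \<le> R \<Longrightarrow> w y \<le> w x"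
  shows "R * w y powr (q - 1) \<le> Lam * real CARD('n) / (c * (4 powr (- \<alpha> / 2)) powr q)"
proof -
  define m where "m = w y"
  have m: "m > 0" using pos by (simp add: m_def)
  \<comment> \<open>With this slope the paraboloid equals \<open>m\<close> at squared distance
    \<open>R\<close> and 0 at \<open>4 * R\<close>, so positivity of \<open>w\<close> forces contact
    strictly inside.\<close>
  define k where "k = m / (3 * R)"
  have k: "k > 0" "k * R = m / 3" using m R by (simp_all add: k_def)
  define \<phi> where "\<phi> x = 4 / 3 * m + (- k) * ((x - z) \<bullet> (x - z))" for x
  obtain x where x: "(x - z) \<bullet> (x - z) \<le> 4 * R" "\<And>x'. (x' - z) \<bullet> (x' - z) \<le> 4 * R \<Longrightarrow> w x - \<phi> x \<le> w x' - \<phi> x'"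
  proof -
    have mem: "x \<in> cball z (sqrt (4 * R)) \<longleftrightarrow> (x - z) \<bullet> (x - z) \<le> 4 * R" for x
      by (rule mem_cball_sqrt)
    have ne: "cball z (sqrt (4 * R)) \<noteq> {}" using R by simp
    have cont: "continuous_on (cball z (sqrt (4 * R))) (\<lambda>x. w x - \<phi> x)"
      unfolding \<phi>_def by (intro continuous_intros continuous_on_subset [OF w(1)]) auto
    obtain x where x: "x \<in> cball z (sqrt (4 * R))" "\<forall>x'\<in>cball z (sqrt (4 * R)). w x - \<phi> x \<le> w x' - \<phi> x'"
      using continuous_attains_inf [OF compact_cball ne cont] by blast
    show ?thesis
    proof (rule that)
      show "(x - z) \<bullet> (x - z) \<le> 4 * R" using x(1) mem by simp
      show "w x - \<phi> x \<le> w x' - \<phi> x'" if "(x' - z) \<bullet> (x' - z) \<le> 4 * R" for x' using x(2) mem that by simp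
    qed
  qed
  have "k * ((y - z) \<bullet> (y - z)) \<le> k * R" using y(1) k by simp
  then have "w y - \<phi> y \<le> 0" using k by (simp add: \<phi>_def m_def)
  moreover have "w x - \<phi> x \<le> w y - \<phi> y" using y(1) R by (intro x) simp
  ultimately have val: "w x - \<phi> x \<le> 0" by linarith
  have "(x - z) \<bullet> (x - z) \<noteq> 4 * R"
  proof
    assume s: "(x - z) \<bullet> (x - z) = 4 * R"
    have "\<phi> x = 0" unfolding \<phi>_def s using k(2) by (simp add: mult_ac)
    then show False using val pos [of x] by simp
  qed
  then have "(x - z) \<bullet> (x - z) < 4 * R" using x(1) by simp
  moreover have "open {x. (x - z) \<bullet> (x - z) < 4 * R}" by (intro open_Collect_less continuous_intros)
  ultimately have "\<forall>\<^sub>F x' in nhds x. x' \<in> {x. (x - z) \<bullet> (x - z) < 4 * R}" by (intro eventually_nhds_in_open) auto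
  then have min: "\<forall>\<^sub>F x' in nhds x. w x - \<phi> x \<le> w x' - \<phi> x'"
    by eventually_elim (simp add: x)
  have jet: "jet2 \<phi> x (0 + (- k) *\<^sub>R 2 *\<^sub>R (x - z)) (0 + (- k) *\<^sub>R 2 *\<^sub>R mat 1)"
    unfolding \<phi>_def by (intro jet2_add jet2_const jet2_cmult jet2_sq_dist)
  have "c * w x powr q \<le> pucci_max lam Lam (0 + (- k) *\<^sub>R 2 *\<^sub>R mat 1 :: real^'n^'n)" by (rule super [OF jet min])
  also have "\<dots> = pucci_max lam Lam (- ((2 * k) *\<^sub>R mat 1) :: real^'n^'n)" by (simp add: mult.commute)
  also have "\<dots> \<le> 2 * k * (Lam * real CARD('n))" by (rule pucci_scalar_le [OF lam]) (use k in simp)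
  finally have 1: "c * w x powr q \<le> 2 * k * (Lam * real CARD('n))" .
  define t where "t = (4::real) powr (- \<alpha> / 2)"
  have t: "0 < t" "t \<le> 1" using \<alpha>(2) powr_mono [of "- \<alpha> / 2" 0 4] by (simp_all add: t_def)
  have low: "m * t \<le> w x"
  proof (cases "(x - z) \<bullet> (x - z) \<le> R")
    case True
    then have "m \<le> w x" unfolding m_def by (rule y)
    moreover have "m * t \<le> m * 1" using t m by (intro mult_left_mono) auto
    ultimately show ?thesis by simp
  next
    case False
    define s where "s = (x - z) \<bullet> (x - z)"
    have s: "R \<le> s" "s \<le> 4 * R" using False x(1) by (simp_all add: s_def)
    have "m * (R / s) powr (\<alpha> / 2) \<le> w x"
      unfolding s_def by (rule power_decay_lower) (use R m y(2) s in \<open>auto simp: m_def s_def\<close>)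
    moreover have "t \<le> (R / s) powr (\<alpha> / 2)"
    proof -
      have "t = (1 / 4) powr (\<alpha> / 2)" by (simp add: t_def powr_divide powr_minus_divide)
      also have "\<dots> \<le> (R / s) powr (\<alpha> / 2)" using s R \<alpha>(2) by (intro powr_mono2) (auto simp: pos_le_divide_eq)
      finally show ?thesis .
    qed
    then have "m * t \<le> m * (R / s) powr (\<alpha> / 2)" using m by (intro mult_left_mono) auto
    ultimately show ?thesis by linarith
  qed
  have mq: "m powr q = m powr (q - 1) * m"
    using m powr_add [of m "q - 1" 1] by simp
  have "(m * t) powr q \<le> w x powr q" using low q m t by (intro powr_mono2) auto
  then have "c * (m powr q * t powr q) \<le> c * w x powr q" using c m t by (simp add: powr_mult)
  then have "(c * t powr q * m powr (q - 1)) * m \<le> (2 / 3 * (Lam * real CARD('n)) / R) * m"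
    using 1 R unfolding mq k_def by (simp add: mult_ac)
  then have "c * t powr q * m powr (q - 1) \<le> 2 / 3 * (Lam * real CARD('n)) / R" using m by (simp only: mult_le_cancel_right_pos)
  then have "c * t powr q * m powr (q - 1) * R \<le> 2 / 3 * (Lam * real CARD('n))" using R by (simp only: pos_le_divide_eq)
  moreover have "0 \<le> Lam * real CARD('n)" using lam by simp
  ultimately have "(R * m powr (q - 1)) * (c * t powr q) \<le> Lam * real CARD('n)" by (simp add: mult_ac)
  moreover have "0 < c * t powr q" using c t by simp
  ultimately show ?thesis unfolding m_def t_def by (simp only: pos_le_divide_eq)
qed

text \<open>On the logarithmic barrier the operator is at most a multiple of \<gamma> s^(-b-1), with
  s the squared distance. The power bound already gives w^q \<ge> m^q s^(-bq) \<ge> m^q s^(-b-1), so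
  a small \<gamma> makes the barrier strict.\<close>

lemma logarithmic_decay_lower:
  assumes pos: "\<And>x. 0 < w x" and q: "1 \<le> q" "\<alpha> * q \<le> \<alpha> + 2"
  obtains \<gamma> s1 where "\<gamma> > 0" "s1 \<ge> exp (2 / \<alpha>)"
    "\<And>x. s1 \<le> (x - z) \<bullet> (x - z) \<Longrightarrow>
      \<gamma> * (((x - z) \<bullet> (x - z)) powr (- (\<alpha> / 2)) * ln ((x - z) \<bullet> (x - z))) \<le> w x"
proof -
  define b where "b = \<alpha> / 2"
  have b: "b > 0" "b * q \<le> b + 1" using \<alpha> q by (simp_all add: b_def)
  obtain y where "\<And>x. (x - z) \<bullet> (x - z) \<le> 1 \<Longrightarrow> w y \<le> w x" using minimum_on_ball [of 1] by auto
  then obtain m where m: "m > 0" "\<And>x. (x - z) \<bullet> (x - z) \<le> 1 \<Longrightarrow> m \<le> w x" using pos by blast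
  have low: "m * s powr (- b) \<le> w x" if "s = (x - z) \<bullet> (x - z)" "1 \<le> s" for x s
  proof -
    have "m * (1 / s) powr (\<alpha> / 2) \<le> w x"
      unfolding that(1) by (rule power_decay_lower) (use m that in auto)
    moreover have "(1 / s) powr (\<alpha> / 2) = s powr (- b)" using that by (simp add: b_def powr_divide powr_minus_divide)
    ultimately show ?thesis by simp
  qed
  \<comment> \<open>Once \<open>ln s\<close> exceeds the first entry the barrier decreases, and once
    it exceeds the second its radial second derivative is nonnegative.\<close>
  define L where "L = max (1 / b) ((1 + 4 * b) / (b * (2 * b + 1)))"
  have bb: "b * (2 * b + 1) > 0" using b by simp
  have L: "1 / b \<le> L" "(1 + 4 * b) / (b * (2 * b + 1)) \<le> L" by (simp_all add: L_def)
  have "1 / b > 0" using b by simp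
  then have L0: "L > 0" using L(1) by linarith
  define s1 where "s1 = exp L"
  have s1: "s1 > 1" using L0 by (simp add: s1_def)
  have ln_ge: "L \<le> ln s" if "s1 \<le> s" for s
    using that s1 ln_mono [of s1 s] by (simp add: s1_def)
  \<comment> \<open>The first entry fits the barrier under the power bound at \<open>s1\<close>,
    where \<open>ln s1 = L\<close>; the second uses 8 where 4 would give equality, for
    strictness.\<close>
  define \<gamma> where "\<gamma> = min (m / L) (c * m powr q / (8 * b * lam))"
  have cm: "c * m powr q > 0" using c m by simp
  have "8 * b * lam > 0" using b lam by simp
  then have \<gamma>: "\<gamma> > 0" "\<gamma> * L \<le> m" "\<gamma> * (8 * b * lam) \<le> c * m powr q"
    using m L0 cm by (simp_all add: \<gamma>_def min_mult_distrib_right min_le_iff_disj)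
  define f where "f s = \<gamma> * (s powr (- b) * ln s)" for s
  define f' where "f' s = \<gamma> * (s powr (- b - 1) * (1 - b * ln s))" for s
  define f'' where "f'' s = \<gamma> * (s powr (- b - 1 - 1) * ((- b - 1) * (1 - b * ln s) - b))" for s
  have pow1: "s powr (t - 1) * s = s powr t" if "s > 0" for s t :: real
    using that powr_add [of s "t - 1" 1] by simp
  have sf'': "s * f'' s = \<gamma> * (s powr (- b - 1) * ((- b - 1) * (1 - b * ln s) - b))" if "s > 0" for s
    unfolding pow1 [OF that, of "- b - 1", symmetric] f''_def by (simp only: mult_ac)
  have s4: "4 * s * f'' s = 4 * (s * f'' s)" for s by simp
  have \<alpha>b: "\<alpha> = 2 * b" by (simp add: b_def)
  have id1: "2 * (\<gamma> * (P * (1 - b * l))) + 4 * (\<gamma> * (P * ((- b - 1) * (1 - b * l) - b)))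
    = 2 * \<gamma> * P * (l * (b * (2 * b + 1)) - (1 + 4 * b))" for P l by (simp add: algebra_simps)
  have id2: "2 * (2 * b + 2) * (\<gamma> * (P * (1 - b * l))) + 4 * (\<gamma> * (P * ((- b - 1) * (1 - b * l) - b)))
    = - (4 * b * \<gamma> * P)" for P l by (simp add: algebra_simps)
  show ?thesis
  proof (rule that [OF \<gamma>(1)])
    show "exp (2 / \<alpha>) \<le> s1" using L(1) by (simp add: s1_def b_def)
    fix x assume x: "s1 \<le> (x - z) \<bullet> (x - z)"
    have "f ((x - z) \<bullet> (x - z)) \<le> w x"
    proof (rule annulus_comparison [OF _ _ _ _ _ _ _ _ x, where f' = f' and f'' = f''])
      show "0 < s1" using s1 by simp
      show "f s1 \<le> w y" if "(y - z) \<bullet> (y - z) = s1" for y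
      proof -
        have "f s1 = \<gamma> * L * s1 powr (- b)" by (simp add: f_def s1_def)
        also have "\<dots> \<le> m * s1 powr (- b)" using \<gamma>(2) by (rule mult_right_mono) simp
        also have "\<dots> \<le> w y" by (rule low) (use that s1 in auto)
        finally show ?thesis .
      qed
      show "(f \<longlongrightarrow> 0) at_top" unfolding f_def
        by (rule tendsto_mult_right_zero, rule powr_ln_tendsto_zero [OF b(1)])
      show "(f has_real_derivative f' s) (at s)" if "s > 0" for s
      proof -
        have "((\<lambda>s. s powr (- b) * ln s) has_real_derivative (- b * s powr (- b - 1)) * ln s + inverse s * s powr (- b)) (at s)"
          by (intro DERIV_mult has_real_derivative_powr DERIV_ln that)
        moreover have "inverse s * s powr (- b) = s powr (- b - 1)"
          unfolding pow1 [OF that, of "- b", symmetric] using that by simp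
        ultimately have "((\<lambda>s. s powr (- b) * ln s) has_real_derivative s powr (- b - 1) * (1 - b * ln s)) (at s)"
          by (simp add: algebra_simps)
        then show ?thesis unfolding f_def f'_def by (rule DERIV_cmult)
      qed
      show "(f' has_real_derivative f'' s) (at s)" if "s > 0" for s
      proof -
        have "((\<lambda>s. 1 - b * ln s) has_real_derivative 0 - b * inverse s) (at s)"
          by (intro DERIV_diff DERIV_const DERIV_cmult DERIV_ln that)
        then have "((\<lambda>s. s powr (- b - 1) * (1 - b * ln s)) has_real_derivative
            ((- b - 1) * s powr (- b - 1 - 1)) * (1 - b * ln s) + (0 - b * inverse s) * s powr (- b - 1)) (at s)"
          by (intro DERIV_mult has_real_derivative_powr that)
        moreover have "(0 - b * inverse s) * s powr (- b - 1) = - b * s powr (- b - 1 - 1)"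
          unfolding pow1 [OF that, of "- b - 1", symmetric] using that by simp
        moreover have "((- b - 1) * P) * (1 - b * l) + - b * P = P * ((- b - 1) * (1 - b * l) - b)" for P l
          by (simp add: algebra_simps)
        ultimately have "((\<lambda>s. s powr (- b - 1) * (1 - b * ln s)) has_real_derivative
            s powr (- b - 1 - 1) * ((- b - 1) * (1 - b * ln s) - b)) (at s)"
          by (simp only:)
        then show ?thesis unfolding f'_def f''_def by (rule DERIV_cmult)
      qed
    next
      fix s assume s: "s1 < s"
      then have s0: "s > 0" "s \<ge> 1" "L \<le> ln s" using s1 ln_ge [of s] by auto
      have "1 / b \<le> ln s" using L s0 by linarith
      then have "1 \<le> b * ln s" using b by (simp add: pos_divide_le_eq mult.commute)
      then show "f' s \<le> 0" using \<gamma> by (simp add: f'_def mult_nonneg_nonpos)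
      have "(1 + 4 * b) / (b * (2 * b + 1)) \<le> ln s" using L s0 by linarith
      then have "1 + 4 * b \<le> ln s * (b * (2 * b + 1))" using bb by (simp only: pos_divide_le_eq)
      then have "0 \<le> 2 * \<gamma> * s powr (- b - 1) * (ln s * (b * (2 * b + 1)) - (1 + 4 * b))"
        using \<gamma> by (intro mult_nonneg_nonneg) auto
      then show "0 \<le> 2 * f' s + 4 * s * f'' s"
        unfolding s4 sf'' [OF s0(1)] f'_def id1 .
      fix y assume y: "s = (y - z) \<bullet> (y - z)"
      have P: "s powr (- b - 1) > 0" using s0 by simp
      have "- lam * (2 * (\<alpha> + 2) * f' s + 4 * s * f'' s) = \<gamma> * (4 * b * lam) * s powr (- b - 1)"
        unfolding s4 sf'' [OF s0(1)] f'_def \<alpha>b id2 by simp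
      also have "\<dots> < c * m powr q * s powr (- b - 1)"
        using \<gamma> cm P by (intro mult_strict_right_mono) auto
      also have "\<dots> \<le> c * m powr q * s powr (- b * q)"
        using b s0 cm by (intro mult_left_mono powr_mono) auto
      also have "\<dots> = c * (m * s powr (- b)) powr q"
        using m s0 by (simp add: powr_mult powr_powr)
      also have "\<dots> \<le> c * w y powr q"
        using low [OF y s0(2)] c m q by (intro mult_left_mono powr_mono2) auto
      finally show "- lam * (2 * (\<alpha> + 2) * f' s + 4 * s * f'' s) < c * w y powr q" .
    qed
    then show "\<gamma> * (((x - z) \<bullet> (x - z)) powr (- (\<alpha> / 2)) * ln ((x - z) \<bullet> (x - z))) \<le> w x"
      by (simp add: f_def b_def)
  qed
qed

lemma liouville:
  assumes q: "1 \<le> q" "\<alpha> * q \<le> \<alpha> + 2"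
  shows "w z = 0"
proof (rule ccontr)
  assume "w z \<noteq> 0"
  then have wz: "w z > 0" using w(2) [of z] by simp
  \<comment> \<open>Strong minimum principle: positivity near \<open>z\<close> spreads to the whole
    space along the power barrier.\<close>
  have pos: "0 < w x" for x
  proof -
    have "w z / 2 > 0" using wz by simp
    then obtain r where r: "r > 0" "\<And>y. dist y z < r \<Longrightarrow> dist (w y) (w z) < w z / 2"
      using w(1) unfolding continuous_on_iff by (metis UNIV_I)
    have near: "w z / 2 \<le> w y" if "dist y z < r" for y
      using r(2) [OF that] unfolding dist_real_def by linarith
    define s0 where "s0 = (r / 2)\<^sup>2"
    have s0: "s0 > 0" using r by (simp add: s0_def)
    have s0_iff: "dist y z < r" if "(y - z) \<bullet> (y - z) \<le> s0" for y
    proof -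
      have "y \<in> cball z (sqrt s0)" using that by (simp only: mem_cball_sqrt)
      then show ?thesis using r by (simp add: s0_def dist_commute)
    qed
    show ?thesis
    proof (cases "(x - z) \<bullet> (x - z) \<le> s0")
      case True
      then show ?thesis using near [OF s0_iff] wz by force
    next
      case False
      then have s: "s0 \<le> (x - z) \<bullet> (x - z)" "(x - z) \<bullet> (x - z) > 0" using s0 by linarith+
      have "w z / 2 * (s0 / ((x - z) \<bullet> (x - z))) powr (\<alpha> / 2) \<le> w x"
        by (rule power_decay_lower) (use s s0 wz near s0_iff in auto)
      moreover have "0 < w z / 2 * (s0 / ((x - z) \<bullet> (x - z))) powr (\<alpha> / 2)" using s s0 wz by simp
      ultimately show ?thesis by linarith
    qed
  qed
  define b where "b = \<alpha> / 2"
  have b: "b > 0" "b * (q - 1) \<le> 1" using \<alpha> q by (simp_all add: b_def algebra_simps)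
  obtain \<gamma> s1 where \<gamma>: "\<gamma> > 0" "s1 \<ge> exp (1 / b)"
    and low: "\<And>x. s1 \<le> (x - z) \<bullet> (x - z) \<Longrightarrow>
      \<gamma> * (((x - z) \<bullet> (x - z)) powr (- b) * ln ((x - z) \<bullet> (x - z))) \<le> w x"
    using logarithmic_decay_lower [OF pos q] by (auto simp: b_def)
  have s1: "s1 > 1" using \<gamma>(2) b by (smt (verit) exp_gt_one zero_less_divide_1_iff)
  obtain y1 where y1: "\<And>x. (x - z) \<bullet> (x - z) \<le> s1 \<Longrightarrow> w y1 \<le> w x" using minimum_on_ball [of s1] s1 by auto
  define D where "D = Lam * real CARD('n) / (c * (4 powr (- \<alpha> / 2)) powr q)"
  have "((\<lambda>s. \<gamma> * (s powr (- b) * ln s)) \<longlongrightarrow> 0) at_top"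
    by (rule tendsto_mult_right_zero, rule powr_ln_tendsto_zero [OF b(1)])
  then have "\<forall>\<^sub>F s in at_top. \<bar>\<gamma> * (s powr (- b) * ln s)\<bar> < w y1"
    unfolding tendsto_iff using pos by simp
  moreover have "\<forall>\<^sub>F s in at_top. s1 \<le> (s::real)" by (rule eventually_ge_at_top)
  \<comment> \<open>The upper and lower bounds for the minimum over the ball of squared radius
    \<open>s\<close> are combined. The exponent of \<open>s\<close> on the left is nonnegative
    because b(q - 1) \<le> 1.\<close>
  ultimately have ev: "\<forall>\<^sub>F s in at_top. s powr (1 - b * (q - 1)) * (\<gamma> * ln s) powr (q - 1) \<le> D"
  proof eventually_elim
    case (elim s)
    have s: "s > 1" using elim s1 by simp
    obtain y where y: "(y - z) \<bullet> (y - z) \<le> s" "\<And>x. (x - z) \<bullet> (x - z) \<le> s \<Longrightarrow> w y \<le> w x"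
      using minimum_on_ball [of s] s by auto
    have "\<gamma> * (s powr (- b) * ln s) \<le> w y"
    proof (cases "(y - z) \<bullet> (y - z) \<le> s1")
      case True
      then show ?thesis using y1 [of y] elim by linarith
    next
      case False
      define t where "t = (y - z) \<bullet> (y - z)"
      have t: "s1 \<le> t" "t \<le> s" using False y(1) by (simp_all add: t_def)
      have "s powr (- b) * ln s \<le> t powr (- b) * ln t"
        by (rule powr_ln_antimono [OF b(1)]) (use t \<gamma>(2) in auto)
      then have "\<gamma> * (s powr (- b) * ln s) \<le> \<gamma> * (t powr (- b) * ln t)" using \<gamma>(1) by simp
      also have "\<dots> \<le> w y" using low [of y] t by (simp add: t_def)
      finally show ?thesis .
    qed
    then have "(\<gamma> * (s powr (- b) * ln s)) powr (q - 1) \<le> w y powr (q - 1)"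
      using q \<gamma> s by (intro powr_mono2) auto
    then have "s * (\<gamma> * (s powr (- b) * ln s)) powr (q - 1) \<le> s * w y powr (q - 1)" using s by simp
    also have "\<dots> \<le> D" unfolding D_def by (rule minimum_upper [OF _ pos q(1) y]) (use s in simp)
    finally have "s * (\<gamma> * (s powr (- b) * ln s)) powr (q - 1) \<le> D" .
    moreover have "s * (\<gamma> * (s powr (- b) * ln s)) powr (q - 1) = s powr (1 - b * (q - 1)) * (\<gamma> * ln s) powr (q - 1)"
    proof -
      have "(\<gamma> * (s powr (- b) * ln s)) powr (q - 1) = (s powr (- b) * (\<gamma> * ln s)) powr (q - 1)" by (simp only: mult_ac)
      also have "\<dots> = s powr (- b * (q - 1)) * (\<gamma> * ln s) powr (q - 1)"
        using \<gamma> s by (simp add: powr_mult powr_powr)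
      also have "s * \<dots> = (s powr 1 * s powr (- b * (q - 1))) * (\<gamma> * ln s) powr (q - 1)" using s by simp
      also have "s powr 1 * s powr (- b * (q - 1)) = s powr (1 - b * (q - 1))" unfolding powr_add [symmetric] by simp
      finally show ?thesis .
    qed
    ultimately show ?case by simp
  qed
  show False
  proof (cases "q = 1")
    case True
    \<comment> \<open>For q = 1 the factor \<open>s\<close> alone diverges. A positive logarithm is
      still required, since \<open>0 powr 0 = 0\<close>.\<close>
    have "\<forall>\<^sub>F s in at_top. s > max D (exp (1 / \<gamma>))" by (rule eventually_gt_at_top)
    with ev have "\<forall>\<^sub>F s in (at_top :: real filter). False"
    proof eventually_elim
      case (elim s)
      have "0 < exp (1 / \<gamma>)" by simp
      then have s: "s > 0" using elim by linarith
      then have "1 / \<gamma> < ln s" using elim ln_less_cancel_iff [of "exp (1 / \<gamma>)" s] by simp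
      moreover have "1 / \<gamma> > 0" using \<gamma> by simp
      ultimately have "ln s > 0" by linarith
      then show ?case using elim s \<gamma> True by simp
    qed
    then show False by simp
  next
    case False
    then have q1: "q > 1" using q by simp
    \<comment> \<open>At the critical exponent the power of \<open>s\<close> is constant, so the
      contradiction has to come from the logarithm: it must reach a level whose (q-1)-th power
      exceeds \<open>D\<close>.\<close>
    define T where "T = (\<bar>D\<bar> + 1) powr (1 / (q - 1))"
    have T: "T \<ge> 0" "T powr (q - 1) = \<bar>D\<bar> + 1" using q1 by (simp_all add: T_def powr_powr)
    have "\<forall>\<^sub>F s in at_top. s \<ge> exp (T / \<gamma>)" by (rule eventually_ge_at_top)
    with ev have "\<forall>\<^sub>F s in (at_top :: real filter). False"
    proof eventually_elim
      case (elim s)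
      have "T / \<gamma> \<ge> 0" using T \<gamma> by simp
      then have "exp (T / \<gamma>) \<ge> 1" by simp
      then have s: "s \<ge> 1" using elim by linarith
      then have "T / \<gamma> \<le> ln s" using elim ln_le_cancel_iff [of "exp (T / \<gamma>)" s] by simp
      then have "T \<le> \<gamma> * ln s" using \<gamma> by (simp add: pos_divide_le_eq mult.commute)
      then have "T powr (q - 1) \<le> (\<gamma> * ln s) powr (q - 1)" using T q1 by (intro powr_mono2) auto
      then have 1: "\<bar>D\<bar> + 1 \<le> (\<gamma> * ln s) powr (q - 1)" using T by simp
      have "1 \<le> s powr (1 - b * (q - 1))" using b s by (intro ge_one_powr_ge_zero) auto
      then have "1 * (\<gamma> * ln s) powr (q - 1) \<le> s powr (1 - b * (q - 1)) * (\<gamma> * ln s) powr (q - 1)"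
        by (rule mult_right_mono) simp
      then show ?case using 1 elim by linarith
    qed
    then show False by simp
  qed
qed

end

theorem theorem5p1:
  fixes u v :: "real^'n \<Rightarrow> real" and lam Lam q :: real
  assumes "0 < lam" and "lam \<le> Lam"
    and "Lam / lam * (real CARD('n) - 1) + 1 > 2"
    and "1 \<le> q"
    and "q \<le> (Lam / lam * (real CARD('n) - 1) + 1) / (Lam / lam * (real CARD('n) - 1) + 1 - 2)"
    and "viscosity_subsol (pucci_eq lam Lam q) u"
    and "viscosity_supersol (pucci_eq lam Lam q) v"
    and "\<forall>x. u x \<le> v x"
  shows "u = v"
proof
  fix z
  define \<alpha> where "\<alpha> = Lam / lam * (real CARD('n) - 1) + 1 - 2"
  have \<alpha>: "\<alpha> > 0" using assms(3) by (simp add: \<alpha>_def)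
  have \<alpha>1: "Lam * (real CARD('n) - 1) = lam * (\<alpha> + 1)" using assms(1) by (simp add: \<alpha>_def)
  have e: "Lam / lam * (real CARD('n) - 1) + 1 = \<alpha> + 2" by (simp add: \<alpha>_def)
  have "q \<le> (\<alpha> + 2) / \<alpha>" using assms(5) unfolding e by simp
  then have q: "\<alpha> * q \<le> \<alpha> + 2" using \<alpha> by (simp add: pos_le_divide_eq mult.commute)
  have cont: "continuous_on UNIV (\<lambda>x. v x - u x)"
    using assms(6,7) by (auto simp: viscosity_subsol_def viscosity_supersol_def intro!: continuous_intros)
  have "v z - u z = 0"
  proof (rule liouville [OF assms(1,2) \<alpha>1 \<alpha> _ cont _ _ assms(4) q])
    \<comment> \<open>The constant 2^(-q) comes from the halved difference in
      \<open>signed_powr_diff\<close>.\<close>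
    show "0 < (1 / 2 :: real) powr q" by simp
    show "0 \<le> v x - u x" for x using assms(8) by simp
    fix \<phi> x p and X :: "real^'n^'n"
    assume jet: "jet2 \<phi> x p X" and min: "\<forall>\<^sub>F y in nhds x. v x - u x - \<phi> x \<le> v y - u y - \<phi> y"
    have "(1 / 2) powr q * (v x - u x) powr q = ((v x - u x) / 2) powr q"
      using assms(8) by (simp add: powr_mult [symmetric])
    also have "\<dots> \<le> \<bar>v x\<bar> powr (q - 1) * v x - \<bar>u x\<bar> powr (q - 1) * u x"
      using assms(8) by (intro signed_powr_diff assms(4)) simp
    also have "\<dots> \<le> pucci_max lam Lam X"
      by (rule supersol_minus_subsol [OF assms(1,2,4,6,7) jet min])
    finally show "(1 / 2) powr q * (v x - u x) powr q \<le> pucci_max lam Lam X" .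
  qed
  then show "u z = v z" by simp
qed

end
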